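(* Let $(i,\pm,n)$ be one of the following: $i\in\{1,3\}$ with sign $+$ and $n\ge 2$ even; $i=1$ with sign $-$ and $n\ge 1$ odd; $i=3$ with sign $-$ and $n\ge 3$ odd. Put $\eta=+1$ if the sign is $+$ and $\eta=-1$ if the sign is $-$, and write $A=A_i^{\pm}(n,q)$, $B=B_i^{\pm}(n,q)$, $N=N_i^{\pm}(n,q)=|DC_i^{\pm}(n,q)|$. Then $N=AB$, and for every integer $h\ge 1$, $$(-\eta)^h\,SK^h=-\sum_{l=0}^{h-1}(-\eta)^l\binom{h}{l}B^{\,h-l}\,SK^l+qA^{-h}\sum_{j=0}^{\min\{N,h\}}(-1)^jC_j\sum_{t=j}^{h}t!\,S(h,t)\,3^{h-t}2^{t-h-j-1}\binom{N-j}{N-t},$$ where $\{C_j\}_{j=0}^{N}$ is the weight distribution of the ternary code $C(DC_i^{\pm}(n,q))$.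
   Context: Let $q=3^s$ ($s\ge1$), $\mathrm{tr}:\mathbb F_q\to\mathbb F_3$ the absolute trace, $\lambda(x)=e^{2\pi i\,\mathrm{tr}(x)/3}$ the canonical additive character of $\mathbb F_q$. For a nontrivial additive character $\psi$ of $\mathbb F_q$ and $a\in\mathbb F_q^*$, the Kloosterman sum is $K(\psi;a)=\sum_{\alpha\in\mathbb F_q^*}\psi(\alpha+a\alpha^{-1})$. For an integer $h\ge0$, $SK^h=\sum_{a\in\mathbb F_q^*,\ a\text{ a square}}K(\lambda;a)^h$ (so $SK^0=(q-1)/2$). $S(h,t)=\frac1{t!}\sum_{j=0}^t(-1)^{t-j}\binom tj j^h$ is the Stirling number of the second kind. Matrix groups: fix a nonsquare $\epsilon\in\mathbb F_q^*$ and $\delta_\epsilon=\mathrm{diag}(1,-\epsilon)$. For $n\ge1$ let $J=\begin{bmatrix}0&1_{n-1}&0\\1_{n-1}&0&0\\0&0&\delta_\epsilon\end{bmatrix}$ ($2n\times 2n$), $O^-(2n,q)=\{w\in GL(2n,q):{}^twJw=J\}$, $SO^-(2n,q)=\{w\in O^-(2n,q):\det w=1\}$. Let $Q=Q(2n,q)$ be the set of all products $\begin{bmatrix}A&0&0\\0&{}^tA^{-1}&0\\0&0&i\end{bmatrix}\begin{bmatrix}1_{n-1}&B&-{}^th\delta_\epsilon\\0&1_{n-1}&0\\0&h&1_2\end{bmatrix}$ with $A\in GL(n-1,q)$, $i\in SO^-(2,q)$, $B$ an $(n-1)\times(n-1)$ matrix, $h$ a $2\times(n-1)$ matrix, ${}^tB+B+{}^th\delta_\epsilon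 h=0$. Let $\rho=\mathrm{diag}(1_{n-1},1_{n-1},1,-1)$, and for $0\le r\le n-1$ let $\sigma_r$ be the block matrix (block sizes $r,n-1-r,r,n-1-r,2$) $\sigma_r=\begin{bmatrix}0&0&1_r&0&0\\0&1_{n-1-r}&0&0&0\\1_r&0&0&0&0\\0&0&0&1_{n-1-r}&0\\0&0&0&0&1_2\end{bmatrix}$. Write $Q\sigma_rQ=\{x\sigma_ry:x,y\in Q\}$ and $\rho Q\sigma_rQ=\{\rho x\sigma_ry:x,y\in Q\}$. Define: $DC_1^+(n,q)=Q\sigma_{n-1}Q$, $DC_2^+(n,q)=Q\sigma_{n-2}Q$, $DC_3^+(n,q)=\rho Q\sigma_{n-2}Q$ ($n\ge2$ even); $DC_4^+(n,q)=\rho Q\sigma_{n-3}Q$ ($n\ge4$ even); $DC_1^-(n,q)=Q\sigma_{n-1}Q$ ($n\ge1$ odd); $DC_2^-(n,q)=Q\sigma_{n-2}Q$, $DC_3^-(n,q)=\rho Q\sigma_{n-2}Q$, $DC_4^-(n,q)=\rho Q\sigma_{n-3}Q$ ($n\ge3$ odd). Constants (empty products equal $1$; $\left[{n\atop r}\right]_q=\prod_{j=0}^{r-1}\frac{q^{n-j}-1}{q^{r-j}-1}$): $A_1^+=q^{(5n^2-2n-4)/4}(q^{n-1}-1)\prod_{j=1}^{(n-2)/2}(q^{2j-1}-1)$, $B_1^+=(q+1)q^{n^2/4}\prod_{j=1}^{(n-2)/2}(q^{2j}-1)$; $A_3^+=(q+1)q^{(5n^2-2n-8)/4}\left[{n-1\atop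 1}\right]_q\prod_{j=1}^{(n-2)/2}(q^{2j-1}-1)$, $B_3^+=q^{(n-2)^2/4}(q^{n-1}-1)\prod_{j=1}^{(n-2)/2}(q^{2j}-1)$; $A_1^-=q^{5(n^2-1)/4}\prod_{j=1}^{(n-1)/2}(q^{2j-1}-1)$, $B_1^-=(q+1)q^{(n-1)^2/4}\prod_{j=1}^{(n-1)/2}(q^{2j}-1)$; $A_3^-=(q+1)q^{(5n^2-4n-5)/4}\left[{n-1\atop 1}\right]_q\prod_{j=1}^{(n-1)/2}(q^{2j-1}-1)$, $B_3^-=q^{(n-1)^2/4}\prod_{j=1}^{(n-1)/2}(q^{2j}-1)$ (all evaluated at $(n,q)$). Codes: for $D=DC_i^{\pm}(n,q)$ with $N=|D|$, fix an ordering $g_1,\dots,g_N$ of $D$; the ternary code is $C(D)=\{u\in\mathbb F_3^N:\sum_{j=1}^N u_j\,\mathrm{Tr}(g_j)=0\text{ in }\mathbb F_q\}$, where $\mathrm{Tr}$ is the matrix trace. Its weight distribution $C_j$ is the number of codewords of Hamming weight $j$. *)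

theory Defs
  imports Complex_Main "Jordan_Normal_Form.Determinant" "HOL-Combinatorics.Stirling"
    "HOL-Library.FuncSet"
begin

text \<open>The field F_q is an arbitrary finite field type 'a with CARD('a) = 3^s.
  Field trace F_q to F_3 (with values in F_q, lying in the prime field).\<close>
definition fld_trace :: "nat \<Rightarrow> 'a::field \<Rightarrow> 'a" where
  "fld_trace s x = (\<Sum>k<s. x ^ (3 ^ k))"

definition abs_tr :: "nat \<Rightarrow> 'a::field \<Rightarrow> nat" where
  "abs_tr s x = (THE k. k < 3 \<and> of_nat k = fld_trace s x)"

definition can_char :: "nat \<Rightarrow> 'a::field \<Rightarrow> complex" where
  "can_char s x = cis (2 * pi * real (abs_tr s x) / 3)"

definition kloosterman :: "('a::{field,finite} \<Rightarrow> complex) \<Rightarrow> 'a \<Rightarrow> complex" where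
  "kloosterman psi a = (\<Sum>\<alpha>\<in>UNIV - {0}. psi (\<alpha> + a * inverse \<alpha>))"

definition nonzero_squares :: "'a::field set" where
  "nonzero_squares = {a. a \<noteq> 0 \<and> (\<exists>b. a = b ^ 2)}"

definition SK :: "nat \<Rightarrow> 'a::{field,finite} itself \<Rightarrow> nat \<Rightarrow> complex" where
  "SK s (_::'a itself) h = (\<Sum>a\<in>(nonzero_squares :: 'a set). kloosterman (can_char s) a ^ h)"

definition mat_trace :: "'a::comm_ring_1 mat \<Rightarrow> 'a" where
  "mat_trace M = (\<Sum>i<dim_row M. M $$ (i, i))"

definition delta_eps :: "'a::comm_ring_1 \<Rightarrow> 'a mat" where
  "delta_eps e = mat 2 2 (\<lambda>(i, j). if i = 0 \<and> j = 0 then 1 else if i = 1 \<and> j = 1 then - e else 0)"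

definition Jmat :: "nat \<Rightarrow> 'a::comm_ring_1 \<Rightarrow> 'a mat" where
  "Jmat n e = four_block_mat
     (four_block_mat (0\<^sub>m (n-1) (n-1)) (1\<^sub>m (n-1)) (1\<^sub>m (n-1)) (0\<^sub>m (n-1) (n-1)))
     (0\<^sub>m (2*(n-1)) 2) (0\<^sub>m 2 (2*(n-1))) (delta_eps e)"

definition Ominus :: "nat \<Rightarrow> 'a::field \<Rightarrow> 'a mat set" where
  "Ominus n e = {w \<in> carrier_mat (2*n) (2*n). det w \<noteq> 0 \<and>
       transpose_mat w * Jmat n e * w = Jmat n e}"

definition SOminus :: "nat \<Rightarrow> 'a::field \<Rightarrow> 'a mat set" where
  "SOminus n e = {w \<in> Ominus n e. det w = 1}"

definition levi_part :: "nat \<Rightarrow> 'a::comm_ring_1 mat \<Rightarrow> 'a mat \<Rightarrow> 'a mat \<Rightarrow> 'a mat" where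
  "levi_part n A Ainv i = four_block_mat
     (four_block_mat A (0\<^sub>m (n-1) (n-1)) (0\<^sub>m (n-1) (n-1)) (transpose_mat Ainv))
     (0\<^sub>m (2*(n-1)) 2) (0\<^sub>m 2 (2*(n-1))) i"

definition unip_part :: "nat \<Rightarrow> 'a::comm_ring_1 \<Rightarrow> 'a mat \<Rightarrow> 'a mat \<Rightarrow> 'a mat" where
  "unip_part n e B h = four_block_mat
     (four_block_mat (1\<^sub>m (n-1)) B (0\<^sub>m (n-1) (n-1)) (1\<^sub>m (n-1)))
     (four_block_mat (- (transpose_mat h * delta_eps e)) (0\<^sub>m (n-1) 0) (0\<^sub>m (n-1) 2) (0\<^sub>m (n-1) 0))
     (four_block_mat (0\<^sub>m 2 (n-1)) h (0\<^sub>m 0 (n-1)) (0\<^sub>m 0 (n-1)))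
     (1\<^sub>m 2)"

definition Qgrp :: "nat \<Rightarrow> 'a::field \<Rightarrow> 'a mat set" where
  "Qgrp n e = {levi_part n A Ainv i * unip_part n e B h | A Ainv i B h.
      A \<in> carrier_mat (n-1) (n-1) \<and> Ainv \<in> carrier_mat (n-1) (n-1) \<and>
      A * Ainv = 1\<^sub>m (n-1) \<and> Ainv * A = 1\<^sub>m (n-1) \<and>
      i \<in> SOminus 1 e \<and> B \<in> carrier_mat (n-1) (n-1) \<and> h \<in> carrier_mat 2 (n-1) \<and>
      transpose_mat B + B + transpose_mat h * delta_eps e * h = 0\<^sub>m (n-1) (n-1)}"

definition rho_mat :: "nat \<Rightarrow> 'a::comm_ring_1 mat" where
  "rho_mat n = mat (2*n) (2*n) (\<lambda>(i, j). if i = j then (if i = 2*n - 1 then -1 else 1) else 0)"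

definition sigma_perm :: "nat \<Rightarrow> nat \<Rightarrow> nat \<Rightarrow> nat" where
  "sigma_perm n r i = (if i < r then i + (n-1) else if n-1 \<le> i \<and> i < n-1+r then i - (n-1) else i)"

definition sigma_mat :: "nat \<Rightarrow> nat \<Rightarrow> 'a::comm_ring_1 mat" where
  "sigma_mat n r = mat (2*n) (2*n) (\<lambda>(i, j). if j = sigma_perm n r i then 1 else 0)"

definition dcoset :: "nat \<Rightarrow> 'a::field \<Rightarrow> nat \<Rightarrow> 'a mat set" where
  "dcoset n e r = {x * sigma_mat n r * y | x y. x \<in> Qgrp n e \<and> y \<in> Qgrp n e}"

definition rho_dcoset :: "nat \<Rightarrow> 'a::field \<Rightarrow> nat \<Rightarrow> 'a mat set" where
  "rho_dcoset n e r = {rho_mat n * x * sigma_mat n r * y | x y. x \<in> Qgrp n e \<and> y \<in> Qgrp n e}"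

text \<open>DC_i^eta(n,q), eta = 1 for sign +, eta = -1 for sign -.\<close>
definition DC :: "nat \<Rightarrow> int \<Rightarrow> nat \<Rightarrow> 'a::field \<Rightarrow> 'a mat set" where
  "DC i eta n e = (if i = 1 then dcoset n e (n-1)
                   else if i = 2 then dcoset n e (n-2)
                   else if i = 3 then rho_dcoset n e (n-2)
                   else rho_dcoset n e (n-3))"

text \<open>Coordinates indexed by D itself; F_3 = {0,1,2} embedded in F_q via of_nat.\<close>
definition code :: "'a::field mat set \<Rightarrow> ('a mat \<Rightarrow> nat) set" where
  "code D = {u \<in> D \<rightarrow>\<^sub>E {0,1,2}. (\<Sum>g\<in>D. of_nat (u g) * mat_trace g) = 0}"

definition weight_dist :: "'a::field mat set \<Rightarrow> nat \<Rightarrow> nat" where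
  "weight_dist D j = card {u \<in> code D. card {g \<in> D. u g \<noteq> 0} = j}"

definition qbinom :: "real \<Rightarrow> nat \<Rightarrow> nat \<Rightarrow> real" where
  "qbinom q n r = (\<Prod>j<r. (q ^ (n - j) - 1) / (q ^ (r - j) - 1))"

definition Aconst :: "nat \<Rightarrow> int \<Rightarrow> nat \<Rightarrow> real \<Rightarrow> real" where
  "Aconst i eta n q =
    (if i = 1 \<and> eta = 1 then q ^ ((5*n^2 - 2*n - 4) div 4) * (q ^ (n-1) - 1) *
        (\<Prod>j=1..(n-2) div 2. q ^ (2*j-1) - 1)
     else if i = 3 \<and> eta = 1 then (q+1) * q ^ ((5*n^2 - 2*n - 8) div 4) * qbinom q (n-1) 1 *
        (\<Prod>j=1..(n-2) div 2. q ^ (2*j-1) - 1)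
     else if i = 1 \<and> eta = -1 then q ^ ((5*(n^2-1)) div 4) *
        (\<Prod>j=1..(n-1) div 2. q ^ (2*j-1) - 1)
     else (q+1) * q ^ ((5*n^2 - 4*n - 5) div 4) * qbinom q (n-1) 1 *
        (\<Prod>j=1..(n-1) div 2. q ^ (2*j-1) - 1))"

definition Bconst :: "nat \<Rightarrow> int \<Rightarrow> nat \<Rightarrow> real \<Rightarrow> real" where
  "Bconst i eta n q =
    (if i = 1 \<and> eta = 1 then (q+1) * q ^ (n^2 div 4) * (\<Prod>j=1..(n-2) div 2. q ^ (2*j) - 1)
     else if i = 3 \<and> eta = 1 then q ^ ((n-2)^2 div 4) * (q ^ (n-1) - 1) *
        (\<Prod>j=1..(n-2) div 2. q ^ (2*j) - 1)
     else if i = 1 \<and> eta = -1 then (q+1) * q ^ ((n-1)^2 div 4) * (\<Prod>j=1..(n-1) div 2. q ^ (2*j) - 1)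
     else q ^ ((n-1)^2 div 4) * (\<Prod>j=1..(n-1) div 2. q ^ (2*j) - 1))"

definition admissible :: "nat \<Rightarrow> int \<Rightarrow> nat \<Rightarrow> bool" where
  "admissible i eta n \<longleftrightarrow>
     (i \<in> {1,3} \<and> eta = 1 \<and> n \<ge> 2 \<and> even n) \<or>
     (i = 1 \<and> eta = -1 \<and> n \<ge> 1 \<and> odd n) \<or>
     (i = 3 \<and> eta = -1 \<and> n \<ge> 3 \<and> odd n)"

end

theory Submission
  imports Defs
begin

text \<open>
  The \<open>h\<close>-th power moment of the numbers \<open>w\<^sub>\<beta> = (2/3) (N - E \<beta>)\<close> with
  \<open>E \<beta> = (\<Sum>g\<in>D. \<lambda> (\<beta> Tr g))\<close>, which up to averaging \<open>\<beta>\<close> and \<open>- \<beta>\<close> are the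
  weights of the words of the dual code, is expressed through the weights of the code by
  the Pless identities. The recursion follows once \<open>N = A B\<close> and
  \<open>E \<beta> = \<eta> A K (\<lambda>; \<beta>\<^sup>2)\<close> are known.

  A sum over the double coset \<open>Q \<sigma>\<^sub>r Q\<close> reduces, by cyclicity of the trace, to a sum over
  \<open>w \<sigma>\<^sub>r\<close> with \<open>w \<in> Q\<close>, up to the order of \<open>Q \<inter> \<sigma>\<^sub>r Q \<sigma>\<^sub>r\<close>. Summing over the
  skew-symmetric part of \<open>B\<close> forces the leading block of \<open>A\<close> to be symmetric; after
  diagonalising that block the sum over \<open>h\<close> becomes a product of sums of the anisotropic norm form,
  each equal to \<open>- q\<close>. The factor \<open>SO\<^sup>-(2, q)\<close> contributes \<open>- K (\<lambda>; \<beta>\<^sup>2)\<close>,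
  whereas its reflected coset consists of matrices of trace zero.
\<close>

section \<open>Characters in characteristic three\<close>

text \<open>The cases are those in which exactly one Kloosterman sum survives. For
  \<open>r = n - 1\<close> the complementary block of size \<open>k = n - 1 - r\<close> is empty,
  and the factor \<open>SO^-(2, q)\<close> supplies the sum. For \<open>r = n - 2\<close> that block
  has size one and supplies a Kloosterman sum of its own; the reflection then turns the orthogonal
  factor into the constant \<open>q + 1\<close>, whereas without it a product of two Kloosterman
  sums would appear. The sign \<open>\<eta>\<close> collects the sign of \<open>(- q) ^ r\<close>
  and, for \<open>r = n - 1\<close>, the minus sign of the orthogonal factor. The factorisation
  \<open>N = A B\<close> is read off the same computation: the character sum carries the number of
  symmetric matrices in \<open>GL(r, q)\<close> where the order of the double coset carries the
  order of a full linear group. \<open>A\<close> is the former count up to an explicit factor,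
  \<open>B\<close> is essentially the quotient of the two, and the factors
  \<open>q^(2j-1) - 1\<close> common to both product formulas cancel in it. Since
  \<open>E \<beta>\<close> depends on \<open>\<beta>\<close> through its square, the nonzero
  \<open>\<beta>\<close> fold two to one onto the squares in \<open>SK\<close>.\<close>

lemma of_nat_card_field: "of_nat (card (UNIV :: 'a set)) = (0 :: 'a::{field,finite})"
proof -
  have "(\<Sum>x\<in>(UNIV::'a set). x + 1) = (\<Sum>x\<in>(UNIV::'a set). x)"
    by (rule sum.reindex_bij_witness[of _ "\<lambda>x. x - 1" "\<lambda>x. x + 1"]) auto
  then show ?thesis by (simp add: sum.distrib)
qed

text \<open>Multiplication by a nonzero \<open>x\<close> permutes the nonzero elements, so their
  product absorbs one factor \<open>x\<close> for each of them.\<close>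

lemma finite_field_power_card: "x ^ card (UNIV :: 'a set) = (x :: 'a::{field,finite})"
proof (cases "x = 0")
  case True
  have "card (UNIV :: 'a set) > 0" by (simp add: finite_UNIV_card_ge_0)
  then show ?thesis using True by simp
next
  case False
  have "(\<Prod>y\<in>UNIV - {0::'a}. x * y) = (\<Prod>y\<in>UNIV - {0::'a}. y)"
    by (rule prod.reindex_bij_witness[of _ "\<lambda>y. y / x" "\<lambda>y. x * y"]) (use False in auto)
  then have "x ^ card (UNIV - {0::'a}) * (\<Prod>y\<in>UNIV - {0::'a}. y) = (\<Prod>y\<in>UNIV - {0::'a}. y)"
    by (simp add: prod.distrib)
  moreover have "(\<Prod>y\<in>UNIV - {0::'a}. y) \<noteq> 0" by simp
  ultimately have "x ^ card (UNIV - {0::'a}) = 1" by simp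
  moreover have "card (UNIV::'a set) = Suc (card (UNIV - {0::'a}))"
    using card.remove[of "UNIV::'a set" 0] by simp
  ultimately show ?thesis by (simp only: power_Suc mult_1_right)
qed

lemma card_three_power_imp_char:
  assumes "card (UNIV :: 'a::{field,finite} set) = 3 ^ s"
  shows "(3::'a) = 0"
proof -
  have "(3::'a) ^ s = 0" using of_nat_card_field[where 'a='a] assms by simp
  then show ?thesis by simp
qed

lemma cube_add:
  assumes "(3::'a::field) = 0"
  shows "((x::'a) + y) ^ 3 = x ^ 3 + y ^ 3"
proof -
  have "(x + y) ^ 3 = x ^ 3 + y ^ 3 + 3 * (x^2 * y + x * y^2)"
    by (simp add: power3_eq_cube power2_eq_square algebra_simps)
  then show ?thesis using assms by simp
qed

lemma power_three_power_add:
  assumes "(3::'a::field) = 0"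
  shows "((x::'a) + y) ^ (3 ^ k) = x ^ (3 ^ k) + y ^ (3 ^ k)"
proof (induction k)
  case (Suc k)
  have "(x + y) ^ (3 ^ Suc k) = ((x + y) ^ (3 ^ k)) ^ 3" by (simp add: power_mult[symmetric] mult.commute)
  also have "\<dots> = (x ^ (3 ^ k)) ^ 3 + (y ^ (3 ^ k)) ^ 3" by (simp add: Suc cube_add[OF assms])
  finally show ?case by (simp add: power_mult[symmetric] mult.commute)
qed simp

lemma fld_trace_add:
  assumes "(3::'a::field) = 0"
  shows "fld_trace s ((x::'a) + y) = fld_trace s x + fld_trace s y"
  by (simp add: fld_trace_def power_three_power_add[OF assms] sum.distrib)

text \<open>Cubing is additive and moves each term of the trace to the next one; the last returns to
  the first because \<open>x ^ (3 ^ s) = x\<close>. Hence the trace is a root of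
  \<open>X^3 - X\<close>, that is, it lies in the prime field.\<close>

lemma fld_trace_cube:
  assumes card: "card (UNIV :: 'a::{field,finite} set) = 3 ^ s"
  shows "fld_trace s (x::'a) ^ 3 = fld_trace s x"
proof -
  note three = card_three_power_imp_char[OF card]
  have cube_sum: "(\<Sum>k<n. f k) ^ 3 = (\<Sum>k<n. f k ^ 3)" for f :: "nat \<Rightarrow> 'a" and n
    by (induction n) (simp_all add: cube_add[OF three])
  have "fld_trace s x ^ 3 = (\<Sum>k<s. x ^ (3 ^ Suc k))"
    unfolding fld_trace_def cube_sum by (simp add: power_mult[symmetric] mult.commute)
  also have "\<dots> + x ^ (3 ^ 0) = (\<Sum>k<Suc s. x ^ (3 ^ k))" by (subst sum.lessThan_Suc_shift) simp
  also have "\<dots> = fld_trace s x + x"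
    using finite_field_power_card[of x] card by (simp add: fld_trace_def)
  finally show ?thesis by simp
qed

lemma fld_trace_values:
  assumes card: "card (UNIV :: 'a::{field,finite} set) = 3 ^ s"
  shows "\<exists>k<3. of_nat k = fld_trace s (x::'a)"
proof -
  note three = card_three_power_imp_char[OF card]
  define t where "t = fld_trace s x"
  have "t * ((t - 1) * (t + 1)) = t ^ 3 - t" by (simp add: algebra_simps power3_eq_cube)
  also have "\<dots> = 0" using fld_trace_cube[OF card] by (simp add: t_def)
  finally consider "t = 0" | "t = 1" | "t = -1" by (auto simp: eq_neg_iff_add_eq_0)
  moreover have "(-1::'a) = of_nat 2" using three by (simp add: neg_eq_iff_add_eq_0)
  ultimately show ?thesis unfolding t_def[symmetric]
    by cases (force intro: exI[of _ 0] exI[of _ 1] exI[of _ 2])+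
qed

lemma of_nat_less_three_inj:
  assumes "(3::'a::field) = 0" "k < 3" "l < 3" "of_nat k = (of_nat l :: 'a)"
  shows "k = l"
proof -
  have "(2::'a) \<noteq> 0"
  proof
    assume "(2::'a) = 0"
    then have "(3::'a) - 2 = 0" using assms(1) by simp
    then show False by simp
  qed
  moreover have two_eq_one_iff: "(2::'a) \<noteq> 1"
  proof
    assume "(2::'a) = 1"
    then have "(2::'a) - 1 = 0" by simp
    then show False by simp
  qed
  moreover have "k \<in> {0,1,2}" "l \<in> {0,1,2}" using assms by auto
  ultimately show ?thesis using assms(4) by auto
qed

lemma abs_tr:
  assumes card: "card (UNIV :: 'a::{field,finite} set) = 3 ^ s"
  shows "abs_tr s x < 3" "of_nat (abs_tr s x) = fld_trace s (x::'a)"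
proof -
  note three = card_three_power_imp_char[OF card]
  have "\<exists>!k. k < 3 \<and> of_nat k = fld_trace s x"
    using fld_trace_values[OF card, of x] of_nat_less_three_inj[OF three] by metis
  from theI'[OF this] show "abs_tr s x < 3" "of_nat (abs_tr s x) = fld_trace s x"
    unfolding abs_tr_def by auto
qed

text \<open>As a polynomial in \<open>x\<close> the trace has coefficient one at \<open>X\<close>
  and degree at most \<open>3 ^ (s - 1)\<close>, which is less than the number of field elements, so
  it cannot vanish everywhere.\<close>

lemma fld_trace_nontrivial:
  assumes card: "card (UNIV :: 'a::{field,finite} set) = 3 ^ s" and s: "s \<ge> 1"
  shows "\<exists>x::'a. fld_trace s x \<noteq> 0"
proof (rule ccontr)
  assume "\<not> ?thesis"
  then have all: "\<And>x::'a. fld_trace s x = 0" by blast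
  define p :: "'a poly" where "p = (\<Sum>k<s. monom 1 (3 ^ k))"
  have "poly p x = fld_trace s x" for x
    by (simp add: p_def fld_trace_def poly_sum poly_monom)
  then have roots: "{x. poly p x = 0} = UNIV" using all by auto
  have "coeff p 1 = (\<Sum>k<s. if k = 0 then 1 else 0)"
    unfolding p_def coeff_sum by (intro sum.cong) auto
  also have "\<dots> = 1" using s by simp
  finally have "p \<noteq> 0" by auto
  then have "card (UNIV :: 'a set) \<le> degree p" using card_poly_roots_bound[of p] roots by simp
  also have "degree p \<le> 3 ^ (s - 1)"
    unfolding p_def by (intro degree_sum_le) (auto intro!: order.trans[OF degree_monom_le] power_increasing)
  also have "\<dots> < (3::nat) ^ s" using s by (intro power_strict_increasing) auto
  finally show False using card by simp
qed

lemma cis_third_mod: "cis (2 * pi * real (k mod 3) / 3) = cis (2 * pi * real k / 3)"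
proof -
  have "cis (2 * pi * real k / 3) = cis (2 * pi * real (k mod 3) / 3) * cis (2 * pi * real (k div 3))"
    unfolding cis_mult
    by (subst div_mult_mod_eq[of k 3, symmetric], subst of_nat_add, subst of_nat_mult)
       (simp add: field_simps)
  also have "cis (2 * pi * real (k div 3)) = 1"
    by (metis cis_multiple_2pi Ints_of_nat)
  finally show ?thesis by simp
qed

lemma can_char_add:
  assumes card: "card (UNIV :: 'a::{field,finite} set) = 3 ^ s"
  shows "can_char s ((x::'a) + y) = can_char s x * can_char s y"
proof -
  note three = card_three_power_imp_char[OF card]
  have mod3: "of_nat (k mod 3) = (of_nat k :: 'a)" for k
    by (subst (2) div_mult_mod_eq[of k 3, symmetric], subst of_nat_add, subst of_nat_mult) (simp add: three)
  have "abs_tr s (x + y) = (abs_tr s x + abs_tr s y) mod 3"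
    by (rule of_nat_less_three_inj[OF three]) (auto simp: abs_tr[OF card] mod3 fld_trace_add[OF three])
  then have "can_char s (x + y) = cis (2 * pi * real (abs_tr s x + abs_tr s y) / 3)"
    unfolding can_char_def by (simp only: cis_third_mod)
  then show ?thesis unfolding can_char_def cis_mult by (simp add: field_simps)
qed

lemma can_char_zero:
  assumes card: "card (UNIV :: 'a::{field,finite} set) = 3 ^ s"
  shows "can_char s (0::'a) = 1"
proof -
  have "fld_trace s (0::'a) = 0" by (simp add: fld_trace_def power_0_left)
  then have "abs_tr s (0::'a) = 0"
    using of_nat_less_three_inj[OF card_three_power_imp_char[OF card], of "abs_tr s (0::'a)" 0] abs_tr[OF card, of 0]
    by simp
  then show ?thesis by (simp add: can_char_def)
qed

lemma cis_third_neq_1: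
  assumes "k < 3" "k \<noteq> 0"
  shows "cis (2 * pi * real k / 3) \<noteq> 1"
proof
  assume "cis (2 * pi * real k / 3) = 1"
  then have "cos (2 * pi * real k / 3) = 1" by (simp add: complex_eq_iff)
  then obtain n :: int where n: "2 * pi * real k / 3 = of_int n * 2 * pi" by (auto simp: cos_one_2pi_int)
  then have "real k = 3 * of_int n" by simp
  then have "int k = 3 * n" by linarith
  then show False using assms by presburger
qed

lemma can_char_nontrivial:
  assumes card: "card (UNIV :: 'a::{field,finite} set) = 3 ^ s" and s: "s \<ge> 1"
  shows "\<exists>x::'a. can_char s x \<noteq> 1"
proof -
  obtain x :: 'a where "fld_trace s x \<noteq> 0" using fld_trace_nontrivial[OF card s] by blast
  then have "abs_tr s x \<noteq> 0" using abs_tr(2)[OF card, of x] by (metis of_nat_0)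
  then show ?thesis
    using cis_third_neq_1[OF abs_tr(1)[OF card]] by (auto simp: can_char_def)
qed

text \<open>The later arguments see the canonical character only through these properties; the trace
  returns when the theorem interprets the locale.\<close>

locale char3_character =
  fixes lam :: "'a::{field,finite} \<Rightarrow> complex" and q :: nat
  assumes q_def: "q = card (UNIV :: 'a set)"
    and three_eq_0: "(3::'a) = 0"
    and lam_add: "lam (x + y) = lam x * lam y"
    and lam_0 [simp]: "lam 0 = 1"
    and lam_nontrivial: "\<exists>x. lam x \<noteq> 1"
begin

lemma two_neq_0: "(2::'a) \<noteq> 0"
proof
  assume "(2::'a) = 0"
  then have "(3::'a) - 2 = 0" using three_eq_0 by simp
  then show False by simp
qed

lemma two_eq_minus_1: "(2::'a) = -1"
  using three_eq_0 by (simp add: eq_neg_iff_add_eq_0)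

lemma double_eq_0_iff: "x + x = 0 \<longleftrightarrow> x = (0::'a)"
  using two_neq_0 by (simp flip: mult_2)

lemma lam_sum: "finite I \<Longrightarrow> lam (\<Sum>i\<in>I. f i) = (\<Prod>i\<in>I. lam (f i))"
  by (induction I rule: finite_induct) (simp_all add: lam_add)

lemma lam_cube: "lam x ^ 3 = 1"
proof -
  have "lam x ^ 3 = lam (x + (x + x))" by (simp only: lam_add power3_eq_cube) (simp add: mult.assoc)
  also have "x + (x + x) = 3 * x" by simp
  finally show ?thesis by (simp add: three_eq_0)
qed

text \<open>A shift of the variable by \<open>y / c\<close> with \<open>lam y \<noteq> 1\<close>
  multiplies the sum by \<open>lam y\<close>, so for \<open>c \<noteq> 0\<close> the sum is
  zero.\<close>

lemma sum_lam: "(\<Sum>x\<in>UNIV. lam (c * x)) = (if c = 0 then of_nat q else 0)"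
proof (cases "c = 0")
  case False
  obtain y where y: "lam y \<noteq> 1" using lam_nontrivial by blast
  have "(\<Sum>x\<in>UNIV. lam (c * x)) = (\<Sum>x\<in>UNIV. lam (c * (x + y / c)))"
    by (rule sum.reindex_bij_witness[of _ "\<lambda>x. x + y / c" "\<lambda>x. x - y / c"]) auto
  also have "\<dots> = (\<Sum>x\<in>UNIV. lam (c * x)) * lam y"
    using False by (simp add: distrib_left lam_add sum_distrib_right)
  finally have "(\<Sum>x\<in>UNIV. lam (c * x)) * (1 - lam y) = 0" by (simp add: algebra_simps)
  then show ?thesis using y False by simp
qed (simp add: q_def)

end

section \<open>Squares and nonsquares\<close>

lemma card_square_roots:
  assumes "(2::'a::{field,finite}) \<noteq> 0"
  shows "card {y::'a. y^2 = d} = (if d = 0 then 1 else if \<exists>b. d = b^2 then 2 else 0)"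
proof (cases "\<exists>b. d = b^2")
  case True
  then obtain b where b: "d = b^2" by blast
  have eq: "{y. y^2 = d} = {b, -b}" unfolding b by (auto simp: power2_eq_iff)
  have "b = -b \<longleftrightarrow> b = 0"
  proof
    assume "b = -b"
    then have "2 * b = 0" by (metis add.right_inverse mult_2)
    then show "b = 0" using assms by simp
  qed simp
  then show ?thesis unfolding eq using b True by (auto simp: card_insert_if)
next
  case False
  then have "{y. y^2 = d} = {}" by blast
  moreover have "d \<noteq> 0" using False by (metis zero_power2)
  ultimately show ?thesis using False by auto
qed

lemma card_square_fibres:
  assumes "(2::'a::{field,finite}) \<noteq> 0"
  shows "card (UNIV - {0::'a}) = 2 * card (nonzero_squares :: 'a set)"
proof -
  have "UNIV - {0::'a} = (\<Union>d\<in>nonzero_squares. {y. y^2 = d})"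
    by (auto simp: nonzero_squares_def)
  then have "card (UNIV - {0::'a}) = (\<Sum>d\<in>(nonzero_squares::'a set). card {y. y^2 = d})"
    by (simp only:, intro card_UN_disjoint) auto
  also have "\<dots> = (\<Sum>d\<in>(nonzero_squares::'a set). 2)"
    by (intro sum.cong) (auto simp: card_square_roots[OF assms] nonzero_squares_def)
  finally show ?thesis by simp
qed

text \<open>The squares and \<open>e\<close> times the squares are disjoint and each fill half of the nonzero elements.\<close>
lemma nonsquare_cases:
  assumes two: "(2::'a::{field,finite}) \<noteq> 0" and e: "e \<noteq> 0" "\<not> (\<exists>b::'a. e = b^2)" and d: "d \<noteq> 0"
  shows "(\<exists>b. d = e * b^2) \<longleftrightarrow> \<not> (\<exists>b. d = b^2)"
proof -
  let ?S = "nonzero_squares :: 'a set" and ?T = "(\<lambda>x. e * x) ` (nonzero_squares :: 'a set)"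
  have disj: "?S \<inter> ?T = {}"
  proof (rule ccontr)
    assume "?S \<inter> ?T \<noteq> {}"
    then obtain x where "x \<in> ?S" "x \<in> ?T" by blast
    then obtain a b where "x = a^2" "x = e * b^2" "b \<noteq> 0" by (auto simp: nonzero_squares_def)
    then have "e = (a / b)^2" by (simp add: power_divide field_simps)
    then show False using e by blast
  qed
  have "card ?T = card ?S" using e by (intro card_image inj_onI) auto
  then have "card (?S \<union> ?T) = card (UNIV - {0::'a})"
    using disj card_square_fibres[OF two] by (subst card_Un_disjoint) auto
  moreover have "?S \<union> ?T \<subseteq> UNIV - {0}" using e by (auto simp: nonzero_squares_def)
  ultimately have un: "?S \<union> ?T = UNIV - {0}" by (intro card_subset_eq) auto
  have "(\<exists>b. d = b^2) \<longleftrightarrow> d \<in> ?S" using d by (auto simp: nonzero_squares_def)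
  moreover have "(\<exists>b. d = e * b^2) \<longleftrightarrow> d \<in> ?T" using d e by (force simp: nonzero_squares_def image_iff)
  moreover have "d \<in> ?T \<longleftrightarrow> d \<notin> ?S" using un disj d by blast
  ultimately show ?thesis by simp
qed

text \<open>For \<open>d \<noteq> 0\<close> exactly one of \<open>d\<close> and \<open>d / e\<close>
  is a square, and it has two roots; for \<open>d = 0\<close> each has the single root zero. The
  constant total is what makes sums over \<open>y^2\<close> and \<open>e * y^2\<close> add up to
  complete sums.\<close>

lemma card_square_roots_nonsquare:
  assumes two: "(2::'a::{field,finite}) \<noteq> 0" and e: "e \<noteq> 0" "\<not> (\<exists>b::'a. e = b^2)"
  shows "card {y::'a. y^2 = d} + card {y. e * y^2 = d} = 2"
proof -
  have "{y. e * y^2 = d} = {y. y^2 = d / e}" using e by (auto simp: field_simps)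
  moreover have "(\<exists>b. d / e = b^2) \<longleftrightarrow> (\<exists>b. d = e * b^2)" using e by (auto simp: field_simps)
  ultimately show ?thesis
    using nonsquare_cases[OF two e, of d] e by (auto simp: card_square_roots[OF two])
qed

lemma sum_over_fibres:
  fixes f :: "'b::finite \<Rightarrow> 'c::finite"
  assumes "finite A"
  shows "(\<Sum>x\<in>A. g (f x)) = (\<Sum>t\<in>UNIV. of_nat (card {x\<in>A. f x = t}) * (g t :: 'd::semiring_1))"
proof -
  have "(\<Sum>t\<in>UNIV. of_nat (card {x\<in>A. f x = t}) * g t) = (\<Sum>t\<in>UNIV. \<Sum>x\<in>{x\<in>A. f x = t}. g (f x))"
    by (intro sum.cong) auto
  also have "\<dots> = (\<Sum>x\<in>A. g (f x))" by (rule sum.group) (use assms in auto)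
  finally show ?thesis by simp
qed

text \<open>Squaring is two to one on nonzero elements. This carries sums over
  \<open>\<beta>\<close> to sums over square arguments of the Kloosterman sum and is the source of a
  factor 2 in the recursion.\<close>

lemma (in char3_character) sum_over_nonzero_squares:
  "(\<Sum>b\<in>UNIV - {0::'a}. F (b^2)) = 2 * (\<Sum>a\<in>nonzero_squares. F a :: complex)"
proof -
  have "(\<Sum>a\<in>nonzero_squares. 2 * F a) = (\<Sum>a\<in>nonzero_squares. \<Sum>b\<in>{b\<in>UNIV - {0}. b^2 = a}. F (b^2))"
  proof (rule sum.cong[OF refl])
    fix a :: 'a assume a: "a \<in> nonzero_squares"
    then have "{b\<in>UNIV - {0}. b^2 = a} = {b. b^2 = a}" by (auto simp: nonzero_squares_def)
    then show "2 * F a = (\<Sum>b\<in>{b\<in>UNIV - {0}. b^2 = a}. F (b^2))"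
      using a card_square_roots[OF two_neq_0, of a] by (simp add: nonzero_squares_def)
  qed
  also have "\<dots> = (\<Sum>b\<in>UNIV - {0}. F (b^2))"
    by (rule sum.group) (auto simp: nonzero_squares_def)
  finally show ?thesis by (simp add: sum_distrib_left)
qed

section \<open>Quadratic Gauss sums and elements of norm one\<close>

locale nonsquare_setup = char3_character lam q for lam :: "'a::{field,finite} \<Rightarrow> complex" and q +
  fixes e :: 'a
  assumes e_neq_0: "e \<noteq> 0" and e_nonsquare: "\<not> (\<exists>b. e = b^2)"
begin

lemmas card_roots = card_square_roots_nonsquare[OF two_neq_0 e_neq_0 e_nonsquare]

definition gauss :: "'a \<Rightarrow> complex" where "gauss c = (\<Sum>x\<in>UNIV. lam (c * x^2))"

text \<open>The values \<open>x^2\<close> and \<open>e * x^2\<close> together meet every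
  \<open>d\<close> exactly twice, so the two Gauss sums add up to a complete character sum, which is
  zero.\<close>

lemma gauss_nonsquare:
  assumes "c \<noteq> 0"
  shows "gauss (c * e) = - gauss c"
proof -
  have "gauss c + gauss (c * e) = (\<Sum>x\<in>UNIV. lam (c * x^2)) + (\<Sum>x\<in>UNIV. lam (c * (e * x^2)))"
    by (simp add: gauss_def mult.assoc)
  also have "\<dots> = (\<Sum>d\<in>UNIV. of_nat (card {y. y^2 = d} + card {y. e * y^2 = d}) * lam (c * d))"
    using sum_over_fibres[of UNIV "\<lambda>d. lam (c * d)" "\<lambda>x. x^2"]
      sum_over_fibres[of UNIV "\<lambda>d. lam (c * d)" "\<lambda>x. e * x^2"]
    by (simp add: sum.distrib distrib_right)
  also have "\<dots> = 0" using sum_lam[of c] assms by (simp add: card_roots flip: sum_distrib_left)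
  finally show ?thesis by (simp add: add_eq_0_iff)
qed

text \<open>With \<open>x = z + y\<close> the quadratic terms in \<open>y\<close> cancel and the
  exponent becomes linear in \<open>y\<close>; only \<open>z = 0\<close> survives the sum over
  \<open>y\<close>.\<close>

lemma gauss_mult_neg:
  assumes "c \<noteq> 0"
  shows "gauss c * gauss (-c) = of_nat q"
proof -
  have "gauss c * gauss (-c) = (\<Sum>y\<in>UNIV. \<Sum>x\<in>UNIV. lam (c * x^2 - c * y^2))"
    unfolding gauss_def by (subst sum.swap) (simp add: sum_product flip: lam_add)
  also have "\<dots> = (\<Sum>y\<in>UNIV. \<Sum>z\<in>UNIV. lam (c * z^2 + (2 * c * z) * y))"
  proof (rule sum.cong[OF refl])
    fix y
    show "(\<Sum>x\<in>UNIV. lam (c * x^2 - c * y^2)) = (\<Sum>z\<in>UNIV. lam (c * z^2 + (2 * c * z) * y))"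
      by (rule sum.reindex_bij_witness[of _ "\<lambda>z. z + y" "\<lambda>x. x - y"])
         (auto simp: power2_eq_square algebra_simps)
  qed
  also have "\<dots> = (\<Sum>z\<in>UNIV. lam (c * z^2) * (\<Sum>y\<in>UNIV. lam ((2 * c * z) * y)))"
    by (subst sum.swap) (simp add: lam_add sum_distrib_left)
  also have "\<dots> = (\<Sum>z\<in>(UNIV::'a set). if z = 0 then of_nat q else 0)"
    by (rule sum.cong[OF refl]) (simp only: sum_lam, use assms two_neq_0 in simp)
  finally show ?thesis by simp
qed

text \<open>The form \<open>x^2 - e * y^2\<close> represents zero only trivially, which shows in the
  sign: with a nonzero square in place of \<open>e\<close> the sum would be
  \<open>+ q\<close>.\<close>

lemma sum_lam_norm_form:
  assumes "c \<noteq> 0"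
  shows "(\<Sum>x\<in>UNIV. \<Sum>y\<in>UNIV. lam (c * (x^2 - e * y^2))) = - of_nat q"
proof -
  have "(\<Sum>x\<in>UNIV. \<Sum>y\<in>UNIV. lam (c * (x^2 - e * y^2))) = gauss c * gauss ((-c) * e)"
    unfolding gauss_def sum_product
    by (simp add: right_diff_distrib algebra_simps flip: lam_add)
  also have "\<dots> = - (gauss c * gauss (-c))" using assms gauss_nonsquare[of "-c"] by simp
  finally show ?thesis using gauss_mult_neg[OF assms] by simp
qed

text \<open>Coordinates of the elements of norm one in the quadratic extension generated by a square
  root of \<open>e\<close>; they parametrise \<open>SO2 e\<close>.\<close>

definition norm1 :: "('a \<times> 'a) set" where "norm1 = {(a, b). a^2 - e * b^2 = 1}"

lemma kloosterman_square:
  assumes "c \<noteq> 0"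
  shows "kloosterman lam (c^2) = (\<Sum>x\<in>UNIV - {0}. lam (c * (x + inverse x)))"
  unfolding kloosterman_def
  by (rule sum.reindex_bij_witness[of _ "\<lambda>x. c * x" "\<lambda>x. x / c"])
     (use assms in \<open>auto simp: distrib_left power2_eq_square divide_inverse mult_ac\<close>)

text \<open>Both sums are sorted by a trace \<open>t\<close>: that of a pair \<open>x\<close>,
  \<open>inverse x\<close> in the field, or that of a conjugate pair of norm one in the extension.
  The first kind exists when \<open>t^2 - 4\<close> is a square, the second when it is
  \<open>e\<close> times a square, so together each \<open>t\<close> is met twice. Hence for
  \<open>c \<noteq> 0\<close> the norm-one sum is minus a Kloosterman sum.\<close>

lemma sum_lam_norm1:
  "(\<Sum>p\<in>norm1. lam (c * (2 * fst p))) + (\<Sum>x\<in>UNIV - {0}. lam (c * (x + inverse x))) =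
     (if c = 0 then 2 * of_nat q else 0)"
proof -
  have four: "(4::'a) \<noteq> 0"
  proof
    assume "(4::'a) = 0"
    moreover have "(2::'a) * 2 = 4" by simp
    ultimately show False using two_neq_0 by (metis mult_eq_0_iff)
  qed
  \<comment> \<open>\<open>x\<close> is a root of \<open>x^2 - t * x + 1\<close>, and
    \<open>2 * x - t\<close> is a square root of its discriminant.\<close>
  have c1: "card {x\<in>UNIV - {0}. x + inverse x = t} = card {y. y^2 = t^2 - 4}" for t :: 'a
  proof (rule bij_betw_same_card[of "\<lambda>x. 2 * x - t"], rule bij_betw_byWitness[of _ "\<lambda>y. (y + t) / 2"])
    show "(\<lambda>x. 2 * x - t) ` {x \<in> UNIV - {0}. x + inverse x = t} \<subseteq> {y. y\<^sup>2 = t\<^sup>2 - 4}"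
      by (auto simp: power2_eq_square field_simps)
    show "(\<lambda>y. (y + t) / 2) ` {y. y\<^sup>2 = t\<^sup>2 - 4} \<subseteq> {x \<in> UNIV - {0}. x + inverse x = t}"
    proof clarify
      fix y assume y: "y^2 = t^2 - 4"
      have "(y + t) / 2 * ((t - y) / 2) = (t^2 - y^2) / (2 * 2)"
        by (simp only: times_divide_times_eq) (simp add: power2_eq_square algebra_simps)
      also have "\<dots> = 1" using y four by simp
      finally have prod: "(y + t) / 2 * ((t - y) / 2) = 1" .
      then have "inverse ((y + t) / 2) = (t - y) / 2" by (rule inverse_unique)
      then have "(y + t) / 2 + inverse ((y + t) / 2) = (y + t) / 2 + (t - y) / 2" by simp
      also have "\<dots> = t" using two_neq_0 by (simp flip: add_divide_distrib mult_2)
      finally show "(y + t) / 2 \<in> UNIV - {0} \<and> (y + t) / 2 + inverse ((y + t) / 2) = t"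
        using prod by (metis DiffI UNIV_I mult_zero_left singletonD zero_neq_one)
    qed
  qed (use two_neq_0 in \<open>auto simp: field_simps\<close>)
  \<comment> \<open>The first coordinate is \<open>t / 2\<close>, and four times the norm equation
    says that \<open>e * (2 * b)^2\<close> is the same discriminant.\<close>
  have c2: "card {p\<in>norm1. 2 * fst p = t} = card {y. e * y^2 = t^2 - 4}" for t :: 'a
  proof (rule bij_betw_same_card[of "\<lambda>p. 2 * snd p"], rule bij_betw_byWitness[of _ "\<lambda>y. (t / 2, y / 2)"])
    show "(\<lambda>p. 2 * snd p) ` {p \<in> norm1. 2 * fst p = t} \<subseteq> {y. e * y\<^sup>2 = t\<^sup>2 - 4}"
    proof clarify
      fix a b assume "(a, b) \<in> norm1"
      then have "e * b^2 = a^2 - 1" by (simp add: norm1_def algebra_simps)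
      then have "4 * (e * b^2) = 4 * (a^2 - 1)" by simp
      then show "e * (2 * snd (a, b))^2 = (2 * fst (a, b))^2 - 4"
        by (simp add: power_mult_distrib algebra_simps)
    qed
    show "(\<lambda>y. (t / 2, y / 2)) ` {y. e * y\<^sup>2 = t\<^sup>2 - 4} \<subseteq> {p \<in> norm1. 2 * fst p = t}"
      using two_neq_0 four by (auto simp: norm1_def power_divide simp flip: diff_divide_distrib)
  qed (use two_neq_0 in \<open>auto simp: field_simps\<close>)
  have fin: "finite norm1" by simp
  have "(\<Sum>p\<in>norm1. lam (c * (2 * fst p))) + (\<Sum>x\<in>UNIV - {0}. lam (c * (x + inverse x))) =
    (\<Sum>t\<in>UNIV. of_nat (card {y. y^2 = t^2 - 4} + card {y. e * y^2 = t^2 - 4}) * lam (c * t))"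
    using sum_over_fibres[of norm1 "\<lambda>t. lam (c * t)" "\<lambda>p. 2 * fst p", OF fin]
      sum_over_fibres[of "UNIV - {0}" "\<lambda>t. lam (c * t)" "\<lambda>x. x + inverse x", OF finite]
    unfolding c1 c2 by (simp only: sum.distrib of_nat_add distrib_right add.commute)
  also have "\<dots> = 2 * (\<Sum>t\<in>UNIV. lam (c * t))" by (simp add: card_roots flip: sum_distrib_left)
  finally show ?thesis by (simp add: sum_lam)
qed

text \<open>At \<open>c = 0\<close> the preceding identity merely counts: the norm-one elements and
  the \<open>q - 1\<close> nonzero field elements number \<open>2 * q\<close> together.\<close>

lemma card_norm1: "card norm1 = q + 1"
proof -
  have "of_nat (card norm1) + of_nat (card (UNIV - {0::'a})) = (2 * of_nat q :: complex)"
    using sum_lam_norm1[of 0] by simp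
  then have "card norm1 + card (UNIV - {0::'a}) = 2 * q" by (metis of_nat_add of_nat_eq_iff of_nat_mult of_nat_numeral)
  moreover have "card (UNIV - {0::'a}) = q - 1" "q > 0"
    by (simp_all add: q_def card_Diff_singleton finite_UNIV_card_ge_0)
  ultimately show ?thesis by simp
qed

end

section \<open>Power moments of ternary codes\<close>

text \<open>The products \<open>fact t * (w choose t)\<close> are the falling factorials of
  \<open>w\<close>. Written in them, a power moment of weights reduces to counting
  \<open>t\<close>-subsets of supports.\<close>

lemma power_eq_sum_Stirling: "(w::nat) ^ h = (\<Sum>t\<le>h. fact t * Stirling h t * (w choose t))"
proof (induction h)
  case (Suc h)
  \<comment> \<open>Multiplying a falling factorial by \<open>w = (w - t) + t\<close> gives the next
    one plus \<open>t\<close> times itself, which matches the Stirling recurrence.\<close>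
  have abs: "w * (fact t * (w choose t)) = fact (Suc t) * (w choose Suc t) + t * (fact t * (w choose t))" for t
  proof (cases "t \<le> w")
    case True
    have "Suc t * (w choose Suc t) = (w - t) * (w choose t)"
      using binomial_absorb_comp[of w t] by (metis binomial_absorption mult.commute)
    then have "fact (Suc t) * (w choose Suc t) = fact t * ((w - t) * (w choose t))"
      by (simp only: fact_Suc of_nat_id) (metis mult.assoc mult.commute)
    also have "\<dots> + t * (fact t * (w choose t)) = ((w - t) + t) * (fact t * (w choose t))"
      by (simp only: distrib_right) (simp add: mult_ac)
    finally show ?thesis using True by simp
  qed (simp add: binomial_eq_0)
  let ?b = "\<lambda>t. fact t * (w choose t) :: nat"
  have "w ^ Suc h = (\<Sum>t\<le>h. Stirling h t * (w * ?b t))"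
    by (simp add: Suc sum_distrib_left mult_ac)
  also have "\<dots> = (\<Sum>t\<le>h. Stirling h t * ?b (Suc t)) + (\<Sum>t\<le>h. t * Stirling h t * ?b t)"
    by (simp only: abs distrib_left sum.distrib) (simp add: mult_ac)
  also have "(\<Sum>t\<le>h. t * Stirling h t * ?b t) = (\<Sum>t\<le>Suc h. t * Stirling h t * ?b t)"
    by simp
  also have "\<dots> = (\<Sum>t\<le>h. Suc t * Stirling h (Suc t) * ?b (Suc t))"
    by (subst sum.atMost_Suc_shift) simp
  also have "(\<Sum>t\<le>h. Stirling h t * ?b (Suc t)) + \<dots> = (\<Sum>t\<le>h. Stirling (Suc h) (Suc t) * ?b (Suc t))"
    by (simp only: Stirling.simps distrib_right sum.distrib add.commute)
  also have "\<dots> = (\<Sum>t\<le>Suc h. Stirling (Suc h) t * ?b t)"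
    by (subst sum.atMost_Suc_shift) simp
  finally show ?case by (simp only: mult_ac)
qed simp

text \<open>Complements turn supersets of \<open>S\<close> into subsets of \<open>D - S\<close>,
  hence the lower entry \<open>card D - t\<close>. The case \<open>t > card D\<close> is set apart
  because truncated subtraction would make the binomial coefficient one.\<close>

lemma card_supersets_of_size:
  assumes "finite D" "S \<subseteq> D"
  shows "card {T. S \<subseteq> T \<and> T \<subseteq> D \<and> card T = t} =
    (if card S \<le> t \<and> t \<le> card D then (card D - card S) choose (card D - t) else 0)"
proof -
  have "card {T. S \<subseteq> T \<and> T \<subseteq> D \<and> card T = t} = card {V. V \<subseteq> D - S \<and> card V = card D - t}"
    if "t \<le> card D"
  proof (rule bij_betw_same_card[of "\<lambda>T. D - T"], rule bij_betw_byWitness[of _ "\<lambda>V. D - V"])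
    show "(\<lambda>T. D - T) ` {T. S \<subseteq> T \<and> T \<subseteq> D \<and> card T = t} \<subseteq> {V. V \<subseteq> D - S \<and> card V = card D - t}"
      using assms by (auto simp: card_Diff_subset finite_subset)
    show "(\<lambda>V. D - V) ` {V. V \<subseteq> D - S \<and> card V = card D - t} \<subseteq> {T. S \<subseteq> T \<and> T \<subseteq> D \<and> card T = t}"
    proof clarify
      fix V assume V: "V \<subseteq> D - S" "card V = card D - t"
      then have "card (D - V) = card D - card V"
        using assms by (intro card_Diff_subset) (auto intro: finite_subset)
      then show "S \<subseteq> D - V \<and> D - V \<subseteq> D \<and> card (D - V) = t"
        using V assms that by auto
    qed
  qed (use assms in auto)
  moreover have "card {V. V \<subseteq> D - S \<and> card V = card D - t} = (card D - card S) choose (card D - t)"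
    using assms by (subst n_subsets) (auto simp: card_Diff_subset finite_subset)
  moreover have "{T. S \<subseteq> T \<and> T \<subseteq> D \<and> card T = t} = {}" if "\<not> (card S \<le> t \<and> t \<le> card D)"
  proof -
    have "card S \<le> card T \<and> card T \<le> card D" if "S \<subseteq> T" "T \<subseteq> D" for T
      using that assms by (meson card_mono finite_subset)
    then show ?thesis using that by blast
  qed
  ultimately show ?thesis by (smt (verit) card.empty)
qed

context char3_character
begin

text \<open>If \<open>lam x\<close> is a primitive cube root of unity, it and its square add up to
  -1; otherwise both are one.\<close>

lemma of_bool_lam_neq_1: "of_bool (lam x \<noteq> 1) = 2 / 3 - (lam x + lam x ^ 2) / 3"
proof (cases "lam x = 1")
  case False
  have "(lam x - 1) * (1 + (lam x + lam x ^ 2)) = lam x ^ 3 - 1"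
    by (simp add: algebra_simps power2_eq_square power3_eq_cube)
  then have "lam x + lam x ^ 2 = -1" using False by (simp add: lam_cube add_eq_0_iff)
  then show ?thesis using False by simp
qed simp

text \<open>Expands the indicator of \<open>T\<close> being contained in the support of the word
  \<open>\<beta> f\<close> into characters of all ternary words; summation over \<open>\<beta>\<close> then
  selects the words orthogonal to \<open>f\<close>.\<close>
lemma sum_indicator_support:
  fixes f :: "'b \<Rightarrow> 'a"
  assumes D: "finite D" and T: "T \<subseteq> D"
  defines "C \<equiv> {u \<in> D \<rightarrow>\<^sub>E {0,1,2}. (\<Sum>g\<in>D. of_nat (u g) * f g) = 0}"
  shows "(\<Sum>\<beta>\<in>UNIV. of_bool (\<forall>g\<in>T. lam (\<beta> * f g) \<noteq> 1) :: complex) =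
    of_nat q * (\<Sum>u\<in>{u\<in>C. {g\<in>D. u g \<noteq> 0} \<subseteq> T}.
      (-1) ^ card {g\<in>D. u g \<noteq> 0} * 2 ^ (card T - card {g\<in>D. u g \<noteq> 0}) / 3 ^ card T)"
proof -
  \<comment> \<open>On \<open>T\<close> these are the coefficients of the indicator of
    \<open>lam x \<noteq> 1\<close> in the characters \<open>1\<close>, \<open>lam x\<close> and
    \<open>lam (2 * x)\<close>. Off \<open>T\<close> they expand the constant one, so a word with a
    nonzero entry outside \<open>T\<close> gets coefficient zero.\<close>
  define a where "a g k = (if g \<in> T then if k = 0 then 2 / 3 else - 1 / 3 else if k = 0 then 1 else 0 :: complex)"
    for g and k :: nat
  let ?W = "D \<rightarrow>\<^sub>E {0,1,2::nat}"
  let ?supp = "\<lambda>u. {g\<in>D. u g \<noteq> 0}"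
  have finW: "finite ?W" using D by (intro finite_PiE) auto
  have lam2: "lam (x * 2) = lam x * lam x" for x by (metis lam_add mult_2_right)
  have expand: "(if g \<in> T then of_bool (lam x \<noteq> 1) else 1) = (\<Sum>k\<in>{0,1,2}. a g k * lam (of_nat k * x))" for g x
    by (simp add: of_bool_lam_neq_1 a_def lam2 lam_add power2_eq_square algebra_simps add_divide_distrib)
  have prod_a: "(\<Prod>g\<in>D. a g (u g)) =
      (if ?supp u \<subseteq> T then (-1) ^ card (?supp u) * 2 ^ (card T - card (?supp u)) / 3 ^ card T else 0)" for u
  proof (cases "?supp u \<subseteq> T")
    case True
    have fin: "finite T" using D T finite_subset by blast
    have "(\<Prod>g\<in>D. a g (u g)) = (\<Prod>g\<in>T. a g (u g)) * (\<Prod>g\<in>D - T. a g (u g))"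
      by (subst prod.subset_diff[OF T D]) (rule mult.commute)
    also have "(\<Prod>g\<in>D - T. a g (u g)) = 1" using True by (intro prod.neutral) (auto simp: a_def)
    also have "(\<Prod>g\<in>T. a g (u g)) = (\<Prod>g\<in>?supp u. a g (u g)) * (\<Prod>g\<in>T - ?supp u. a g (u g))"
      by (subst prod.subset_diff[OF True fin]) (rule mult.commute)
    also have "(\<Prod>g\<in>?supp u. a g (u g)) = (\<Prod>g\<in>?supp u. - 1 / 3)"
      using True by (intro prod.cong) (auto simp: a_def)
    also have "(\<Prod>g\<in>T - ?supp u. a g (u g)) = (\<Prod>g\<in>T - ?supp u. 2 / 3)"
      using T by (intro prod.cong) (auto simp: a_def)
    also have "(\<Prod>g\<in>?supp u. - 1 / 3) * (\<Prod>g\<in>T - ?supp u. 2 / 3) * 1 =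
        (- 1 / 3) ^ card (?supp u) * (2 / 3 :: complex) ^ (card T - card (?supp u))"
      using True D by (simp add: card_Diff_subset)
    also have "\<dots> = (-1) ^ card (?supp u) * 2 ^ (card T - card (?supp u)) / 3 ^ card T"
    proof -
      obtain k where "card T = card (?supp u) + k" using card_mono[OF fin True] le_Suc_ex by blast
      then show ?thesis
        by (simp only: power_divide[of "-1" 3] power_divide[of 2 3] diff_add_inverse power_add times_divide_times_eq)
    qed
    finally show ?thesis using True by simp
  next
    case False
    then obtain g where "g \<in> D" "u g \<noteq> 0" "g \<notin> T" by blast
    then have "\<exists>g\<in>D. a g (u g) = 0" by (auto simp: a_def)
    then show ?thesis using False D by (simp add: prod_zero)
  qed
  have ind: "of_bool (\<forall>g\<in>T. lam (\<beta> * f g) \<noteq> 1) =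
      (\<Sum>u\<in>?W. (\<Prod>g\<in>D. a g (u g)) * lam ((\<Sum>g\<in>D. of_nat (u g) * f g) * \<beta>))" for \<beta>
  proof -
    have "of_bool (\<forall>g\<in>T. lam (\<beta> * f g) \<noteq> 1) = (\<Prod>g\<in>T. of_bool (lam (\<beta> * f g) \<noteq> 1) :: complex)"
      using finite_subset[OF T D] by (induction T rule: finite_induct) auto
    also have "\<dots> = (\<Prod>g\<in>D. if g \<in> T then of_bool (lam (\<beta> * f g) \<noteq> 1) else 1)"
      using T D by (simp add: prod.If_cases Int_absorb1)
    also have "\<dots> = (\<Prod>g\<in>D. \<Sum>k\<in>{0,1,2}. a g k * lam (of_nat k * (\<beta> * f g)))"
      by (simp only: expand)
    also have "\<dots> = (\<Sum>u\<in>?W. \<Prod>g\<in>D. a g (u g) * lam (of_nat (u g) * (\<beta> * f g)))"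
      by (rule prod_sum_PiE) (use D in auto)
    also have "\<dots> = (\<Sum>u\<in>?W. (\<Prod>g\<in>D. a g (u g)) * lam ((\<Sum>g\<in>D. of_nat (u g) * f g) * \<beta>))"
      by (simp only: prod.distrib lam_sum[OF D] sum_distrib_right, simp only: mult_ac)
    finally show ?thesis .
  qed
  have "(\<Sum>\<beta>\<in>UNIV. of_bool (\<forall>g\<in>T. lam (\<beta> * f g) \<noteq> 1)) =
      (\<Sum>u\<in>?W. (\<Prod>g\<in>D. a g (u g)) * (\<Sum>\<beta>\<in>UNIV. lam ((\<Sum>g\<in>D. of_nat (u g) * f g) * \<beta>)))"
    unfolding ind sum_distrib_left by (rule sum.swap)
  also have "\<dots> = (\<Sum>u\<in>?W. if u \<in> {u\<in>C. ?supp u \<subseteq> T}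
      then of_nat q * ((-1) ^ card (?supp u) * 2 ^ (card T - card (?supp u)) / 3 ^ card T) else 0)"
    by (intro sum.cong refl) (simp add: sum_lam prod_a C_def)
  also have "\<dots> = (\<Sum>u\<in>{u\<in>C. ?supp u \<subseteq> T}.
      of_nat q * ((-1) ^ card (?supp u) * 2 ^ (card T - card (?supp u)) / 3 ^ card T))"
    by (rule sum.mono_neutral_cong_right) (use finW in \<open>auto simp: C_def\<close>)
  finally show ?thesis by (simp only: sum_distrib_left)
qed

text \<open>The binomial moment of order \<open>t\<close> counts pairs of a \<open>\<beta>\<close>
  and a \<open>t\<close>-subset \<open>T\<close> of the support of its word. Summing over
  \<open>\<beta>\<close> for fixed \<open>T\<close> and then exchanging sums leaves, for every code
  word, the number of \<open>t\<close>-sets containing its support. As the sum runs over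
  \<open>\<beta>\<close>, a dual word counts once for each \<open>\<beta>\<close> that produces
  it.\<close>

lemma pless_power_moment:
  fixes f :: "'b \<Rightarrow> 'a"
  assumes D: "finite D"
  defines "C \<equiv> {u \<in> D \<rightarrow>\<^sub>E {0,1,2}. (\<Sum>g\<in>D. of_nat (u g) * f g) = 0}" and "N \<equiv> card D"
  shows "(\<Sum>\<beta>\<in>UNIV. of_nat (card {g\<in>D. lam (\<beta> * f g) \<noteq> 1}) ^ h :: complex) =
    of_nat q * (\<Sum>j=0..min N h. (-1) ^ j * of_nat (card {u\<in>C. card {g\<in>D. u g \<noteq> 0} = j}) *
      (\<Sum>t=j..h. of_nat (fact t * Stirling h t) * (2 ^ (t - j) / 3 ^ t) *
         of_nat (if t \<le> N then (N - j) choose (N - t) else 0)))"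
proof -
  let ?supp = "\<lambda>u. {g\<in>D. u g \<noteq> (0::nat)}"
  let ?w = "\<lambda>\<beta>. {g\<in>D. lam (\<beta> * f g) \<noteq> 1}"
  \<comment> \<open>Contribution of a code word of weight \<open>j\<close> to the binomial moment of
    order \<open>t\<close>, up to the factor \<open>q\<close>; it is zero unless
    \<open>j \<le> t\<close>, since the support has to fit into \<open>T\<close>.\<close>
  define c where "c t j = (if j \<le> t then (-1) ^ j * (2 ^ (t - j) / 3 ^ t) *
      of_nat (if t \<le> N then (N - j) choose (N - t) else 0) else 0 :: complex)" for t j
  have finC: "finite C"
    unfolding C_def using D by (intro finite_subset[OF _ finite_PiE[of D "\<lambda>_. {0,1,2::nat}"]]) auto
  have choose: "(\<Sum>\<beta>\<in>UNIV. of_nat (card (?w \<beta>) choose t)) = of_nat q * (\<Sum>u\<in>C. c t (card (?supp u)))" for t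
  proof -
    let ?P = "{T. T \<subseteq> D \<and> card T = t}"
    have finP: "finite ?P" using D by simp
    have "of_nat (card (?w \<beta>) choose t) = (\<Sum>T\<in>?P. of_bool (\<forall>g\<in>T. lam (\<beta> * f g) \<noteq> 1) :: complex)" for \<beta>
    proof -
      have "card (?w \<beta>) choose t = card {T. T \<subseteq> ?w \<beta> \<and> card T = t}"
        using D by (subst n_subsets) auto
      also have "{T. T \<subseteq> ?w \<beta> \<and> card T = t} = {T \<in> ?P. \<forall>g\<in>T. lam (\<beta> * f g) \<noteq> 1}" by auto
      finally show ?thesis using finP by (simp add: sum.If_cases of_bool_def Int_def)
    qed
    then have "(\<Sum>\<beta>\<in>UNIV. of_nat (card (?w \<beta>) choose t)) =
        (\<Sum>T\<in>?P. \<Sum>\<beta>\<in>UNIV. of_bool (\<forall>g\<in>T. lam (\<beta> * f g) \<noteq> 1) :: complex)"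
      by (subst sum.swap) simp
    also have "\<dots> = (\<Sum>T\<in>?P. of_nat q * (\<Sum>u\<in>{u\<in>C. ?supp u \<subseteq> T}.
        (-1) ^ card (?supp u) * 2 ^ (card T - card (?supp u)) / 3 ^ card T))"
      unfolding C_def by (intro sum.cong refl sum_indicator_support[OF D]) auto
    also have "\<dots> = of_nat q * (\<Sum>T\<in>?P. \<Sum>u\<in>{u\<in>C. ?supp u \<subseteq> T}.
        (-1) ^ card (?supp u) * 2 ^ (t - card (?supp u)) / 3 ^ t)"
      by (simp add: sum_distrib_left)
    \<comment> \<open>For a fixed word the sets \<open>T\<close> are now the
      \<open>t\<close>-supersets of its support, all with the same summand.\<close>
    also have "\<dots> = of_nat q * (\<Sum>u\<in>C. \<Sum>T\<in>{T\<in>?P. ?supp u \<subseteq> T}.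
        (-1) ^ card (?supp u) * 2 ^ (t - card (?supp u)) / 3 ^ t)"
      by (subst sum.swap_restrict[OF finP finC]) simp
    also have "\<dots> = of_nat q * (\<Sum>u\<in>C. c t (card (?supp u)))"
    proof (intro arg_cong[of _ _ "\<lambda>x. of_nat q * x"] sum.cong refl)
      fix u
      have "{T\<in>?P. ?supp u \<subseteq> T} = {T. ?supp u \<subseteq> T \<and> T \<subseteq> D \<and> card T = t}" by auto
      then have "card {T\<in>?P. ?supp u \<subseteq> T} = (if card (?supp u) \<le> t \<and> t \<le> card D
          then (card D - card (?supp u)) choose (card D - t) else 0)"
        by (simp only: card_supersets_of_size[OF D, of "?supp u" t, OF Collect_restrict])
      then show "(\<Sum>T\<in>{T\<in>?P. ?supp u \<subseteq> T}. (-1) ^ card (?supp u) * 2 ^ (t - card (?supp u)) / 3 ^ t) =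
          c t (card (?supp u))"
        by (simp add: c_def N_def)
    qed
    finally show ?thesis .
  qed
  have weights: "(\<Sum>u\<in>C. c t (card (?supp u))) = (\<Sum>j=0..N. of_nat (card {u\<in>C. card (?supp u) = j}) * c t j)" for t
  proof -
    have "(\<Sum>u\<in>C. c t (card (?supp u))) = (\<Sum>j=0..N. \<Sum>u\<in>{u\<in>C. card (?supp u) = j}. c t (card (?supp u)))"
      by (rule sum.group[symmetric]) (use finC D in \<open>auto simp: N_def intro!: card_mono\<close>)
    also have "\<dots> = (\<Sum>j=0..N. of_nat (card {u\<in>C. card (?supp u) = j}) * c t j)"
      by (intro sum.cong) auto
    finally show ?thesis .
  qed
  have "(\<Sum>\<beta>\<in>UNIV. of_nat (card (?w \<beta>)) ^ h :: complex) =
      (\<Sum>\<beta>\<in>UNIV. \<Sum>t\<le>h. of_nat (fact t * Stirling h t) * of_nat (card (?w \<beta>) choose t))"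
    by (simp flip: of_nat_power add: power_eq_sum_Stirling[of _ h])
  also have "\<dots> = (\<Sum>t\<le>h. of_nat (fact t * Stirling h t) * (\<Sum>\<beta>\<in>UNIV. of_nat (card (?w \<beta>) choose t)))"
    by (subst sum.swap) (simp add: sum_distrib_left)
  also have "\<dots> = of_nat q * (\<Sum>t\<le>h. \<Sum>j=0..N. of_nat (fact t * Stirling h t) *
      (of_nat (card {u\<in>C. card (?supp u) = j}) * c t j))"
    by (simp only: choose weights sum_distrib_left) (simp add: mult_ac)
  also have "(\<Sum>t\<le>h. \<Sum>j=0..N. of_nat (fact t * Stirling h t) *
      (of_nat (card {u\<in>C. card (?supp u) = j}) * c t j)) =
    (\<Sum>j=0..N. of_nat (card {u\<in>C. card (?supp u) = j}) * (\<Sum>t\<le>h. of_nat (fact t * Stirling h t) * c t j))"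
    by (subst sum.swap) (simp only: sum_distrib_left, simp only: mult_ac)
  \<comment> \<open>Weights above \<open>h\<close> drop out: \<open>c t j\<close> vanishes for
    \<open>j > t\<close>, and here \<open>t \<le> h\<close>.\<close>
  also have "\<dots> = (\<Sum>j=0..min N h. of_nat (card {u\<in>C. card (?supp u) = j}) *
      (\<Sum>t\<le>h. of_nat (fact t * Stirling h t) * c t j))"
  proof (rule sum.mono_neutral_right)
    show "\<forall>j\<in>{0..N} - {0..min N h}. of_nat (card {u\<in>C. card (?supp u) = j}) *
      (\<Sum>t\<le>h. of_nat (fact t * Stirling h t) * c t j) = 0"
      by (auto simp: c_def intro!: sum.neutral)
  qed auto
  also have "\<dots> = (\<Sum>j=0..min N h. (-1) ^ j * of_nat (card {u\<in>C. card (?supp u) = j}) *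
      (\<Sum>t=j..h. of_nat (fact t * Stirling h t) * (2 ^ (t - j) / 3 ^ t) *
         of_nat (if t \<le> N then (N - j) choose (N - t) else 0)))"
  proof (rule sum.cong[OF refl])
    fix j
    have "(\<Sum>t\<le>h. of_nat (fact t * Stirling h t) * c t j) = (\<Sum>t=j..h. of_nat (fact t * Stirling h t) * c t j)"
      by (rule sum.mono_neutral_right) (auto simp: c_def)
    also have "\<dots> = (-1) ^ j * (\<Sum>t=j..h. of_nat (fact t * Stirling h t) * (2 ^ (t - j) / 3 ^ t) *
         of_nat (if t \<le> N then (N - j) choose (N - t) else 0))"
      unfolding sum_distrib_left by (rule sum.cong[OF refl]) (simp add: c_def mult_ac)
    finally show "of_nat (card {u\<in>C. card (?supp u) = j}) * (\<Sum>t\<le>h. of_nat (fact t * Stirling h t) * c t j) =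
      (-1) ^ j * of_nat (card {u\<in>C. card (?supp u) = j}) *
      (\<Sum>t=j..h. of_nat (fact t * Stirling h t) * (2 ^ (t - j) / 3 ^ t) *
         of_nat (if t \<le> N then (N - j) choose (N - t) else 0))"
      by (simp only: mult_ac)
  qed
  finally show ?thesis .
qed

end

section \<open>General linear, skew and symmetric matrices\<close>

lemma carrier_mat_0: "carrier_mat 0 n = {0\<^sub>m 0 n}" "carrier_mat n 0 = {0\<^sub>m n 0}"
  by (auto intro!: eq_matI)

lemma bij_betw_carrier_mat_fun:
  "bij_betw (\<lambda>A. \<lambda>p\<in>{..<m} \<times> {..<n}. A $$ p) (carrier_mat m n) ({..<m} \<times> {..<n} \<rightarrow>\<^sub>E UNIV)"
  by (rule bij_betw_byWitness[of _ "\<lambda>f. mat m n f"])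
     (auto intro!: eq_matI ext simp: PiE_def extensional_def restrict_def)

lemma finite_carrier_mat [simp]: "finite (carrier_mat m n :: 'a::finite mat set)"
  using bij_betw_finite[OF bij_betw_carrier_mat_fun[of m n]] by (auto intro!: finite_PiE)

lemma card_carrier_mat: "card (carrier_mat m n :: 'a::finite mat set) = card (UNIV::'a set) ^ (m * n)"
  using bij_betw_same_card[OF bij_betw_carrier_mat_fun[of m n, where 'a='a]]
  by (simp add: card_funcsetE card_cartesian_product)

lemma four_block_mat_inject:
  assumes "A \<in> carrier_mat a c" "B \<in> carrier_mat a d" "C \<in> carrier_mat b c" "D \<in> carrier_mat b d"
    and "A' \<in> carrier_mat a c" "B' \<in> carrier_mat a d" "C' \<in> carrier_mat b c" "D' \<in> carrier_mat b d"
  shows "four_block_mat A B C D = four_block_mat A' B' C' D' \<longleftrightarrow> A = A' \<and> B = B' \<and> C = C' \<and> D = D'"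
proof
  assume eq: "four_block_mat A B C D = four_block_mat A' B' C' D'"
  have *: "four_block_mat A B C D $$ (i, j) = four_block_mat A' B' C' D' $$ (i, j)" for i j
    by (simp only: eq)
  have "A = A'"
  proof (rule eq_matI)
    fix i j assume "i < dim_row A'" "j < dim_col A'"
    then show "A $$ (i, j) = A' $$ (i, j)" using assms *[of i j] by auto
  qed (use assms in auto)
  moreover have "B = B'"
  proof (rule eq_matI)
    fix i j assume "i < dim_row B'" "j < dim_col B'"
    then show "B $$ (i, j) = B' $$ (i, j)" using assms *[of i "c + j"] by auto
  qed (use assms in auto)
  moreover have "C = C'"
  proof (rule eq_matI)
    fix i j assume "i < dim_row C'" "j < dim_col C'"
    then show "C $$ (i, j) = C' $$ (i, j)" using assms *[of "a + i" j] by auto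
  qed (use assms in auto)
  moreover have "D = D'"
  proof (rule eq_matI)
    fix i j assume "i < dim_row D'" "j < dim_col D'"
    then show "D $$ (i, j) = D' $$ (i, j)" using assms *[of "a + i" "c + j"] by auto
  qed (use assms in auto)
  ultimately show "A = A' \<and> B = B' \<and> C = C' \<and> D = D'" by simp
qed auto

lemma carrier_mat_blocks:
  assumes "X \<in> carrier_mat (a + b) (c + d)"
  obtains A B C D where "A \<in> carrier_mat a c" "B \<in> carrier_mat a d" "C \<in> carrier_mat b c" "D \<in> carrier_mat b d"
    "X = four_block_mat A B C D"
proof (rule that)
  let ?s = "\<lambda>r s m n. mat m n (\<lambda>(i, j). X $$ (i + r, j + s))"
  show "X = four_block_mat (?s 0 0 a c) (?s 0 c a d) (?s a 0 b c) (?s a c b d)"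
    using assms by (intro eq_matI) auto
qed auto

lemma sum_carrier_mat_blocks:
  "(\<Sum>X\<in>carrier_mat (a + b) (c + d). F X) =
    (\<Sum>A\<in>carrier_mat a c. \<Sum>B\<in>carrier_mat a d. \<Sum>C\<in>carrier_mat b c. \<Sum>D\<in>carrier_mat b d.
      F (four_block_mat A B C D :: 'a::finite mat))"
proof -
  let ?f = "\<lambda>(A, B, C, D). four_block_mat A B C D :: 'a mat"
  let ?S = "carrier_mat a c \<times> carrier_mat a d \<times> carrier_mat b c \<times> carrier_mat b d"
  have "inj_on ?f ?S"
    by (rule inj_onI) (auto simp: four_block_mat_inject[of _ a c _ d _ b])
  moreover have "?f ` ?S = carrier_mat (a + b) (c + d)"
  proof (intro equalityI subsetI)
    fix X :: "'a mat" assume "X \<in> carrier_mat (a + b) (c + d)"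
    then obtain A B C D where "A \<in> carrier_mat a c" "B \<in> carrier_mat a d" "C \<in> carrier_mat b c"
      "D \<in> carrier_mat b d" "X = four_block_mat A B C D" by (rule carrier_mat_blocks)
    then show "X \<in> ?f ` ?S" by (intro image_eqI[of _ _ "(A, B, C, D)"]) simp_all
  qed auto
  ultimately have "(\<Sum>X\<in>carrier_mat (a + b) (c + d). F X) = (\<Sum>x\<in>?S. F (?f x))"
    using sum.reindex[of ?f ?S F] by simp
  then show ?thesis by (simp add: sum.cartesian_product split_def)
qed

lemma mat_trace_mult:
  assumes "A \<in> carrier_mat m n" "B \<in> carrier_mat n m"
  shows "mat_trace (A * B) = (\<Sum>i<m. \<Sum>j<n. A $$ (i, j) * B $$ (j, i))"
  using assms by (auto simp: mat_trace_def scalar_prod_def lessThan_atLeast0 intro!: sum.cong)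

lemma mat_trace_commute:
  assumes "A \<in> carrier_mat m n" "B \<in> carrier_mat n m"
  shows "mat_trace (A * B) = mat_trace (B * A)"
  unfolding mat_trace_mult[OF assms] mat_trace_mult[OF assms(2,1)]
  by (subst sum.swap) (simp add: mult.commute)

lemma mat_trace_transpose: "A \<in> carrier_mat m m \<Longrightarrow> mat_trace (transpose_mat A) = mat_trace A"
  by (auto simp: mat_trace_def intro!: sum.cong)

lemma mat_trace_add:
  "A \<in> carrier_mat m m \<Longrightarrow> B \<in> carrier_mat m m \<Longrightarrow> mat_trace (A + B) = mat_trace A + mat_trace B"
  by (auto simp: mat_trace_def sum.distrib)

lemma mat_trace_uminus: "A \<in> carrier_mat m m \<Longrightarrow> mat_trace (- A) = - mat_trace A"
  by (auto simp: mat_trace_def sum_negf)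

lemma mat_trace_smult: "A \<in> carrier_mat m m \<Longrightarrow> mat_trace (c \<cdot>\<^sub>m A) = c * mat_trace A"
  by (auto simp: mat_trace_def sum_distrib_left)

lemma sum_lessThan_add: "(\<Sum>i<a + b::nat. f i) = (\<Sum>i<a. f i) + (\<Sum>i<b. f (a + i) :: 'a::comm_monoid_add)"
  by (induction b) (simp_all add: add.assoc)

lemma mat_trace_four_block:
  assumes "A \<in> carrier_mat a a" "D \<in> carrier_mat d d"
  shows "mat_trace (four_block_mat A B C D) = mat_trace A + mat_trace D"
  using assms by (auto simp: mat_trace_def sum_lessThan_add)

lemma obtain_inverse_mat:
  assumes "(A :: 'a::field mat) \<in> carrier_mat n n" "det A \<noteq> 0"
  obtains B where "B \<in> carrier_mat n n" "A * B = 1\<^sub>m n" "B * A = 1\<^sub>m n"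
  using det_non_zero_imp_unit[OF assms, of "()"] by (auto simp: Units_def ring_mat_def)

lemma det_neq_0_if_inverse:
  assumes "(A :: 'a::field mat) \<in> carrier_mat n n" "B \<in> carrier_mat n n" "A * B = 1\<^sub>m n"
  shows "det A \<noteq> 0"
  using det_mult[OF assms(1,2)] assms(3) by auto

section \<open>The order of the general linear group\<close>

definition GL :: "nat \<Rightarrow> 'a::field mat set" where
  "GL n = {A \<in> carrier_mat n n. det A \<noteq> 0}"

lemma finite_GL [simp]: "finite (GL n :: 'a::{field,finite} mat set)"
  by (simp add: GL_def)

lemma GL_mult: "A \<in> GL n \<Longrightarrow> B \<in> GL n \<Longrightarrow> A * B \<in> GL n"
  by (auto simp: GL_def det_mult)

lemma GL_inverse:
  assumes "A \<in> GL n"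
  obtains B where "B \<in> GL n" "A * B = 1\<^sub>m n" "B * A = 1\<^sub>m n"
proof -
  from assms have A: "A \<in> carrier_mat n n" "det A \<noteq> 0" by (auto simp: GL_def)
  from obtain_inverse_mat[OF A] obtain B where B: "B \<in> carrier_mat n n" "A * B = 1\<^sub>m n" "B * A = 1\<^sub>m n" .
  then have "det B \<noteq> 0" using det_neq_0_if_inverse[OF B(1) A(1) B(3)] by simp
  then show ?thesis using that B by (auto simp: GL_def)
qed

lemma GL_transpose: "A \<in> GL n \<Longrightarrow> transpose_mat A \<in> GL n"
  by (auto simp: GL_def det_transpose)

lemma GL_row_extension:
  assumes "v \<in> carrier_vec n" "v \<noteq> 0\<^sub>v n" "n > 0"
  obtains P where "P \<in> GL n" "row P 0 = (v :: 'a::field vec)"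
proof -
  obtain k where k: "k < n" "v $ k \<noteq> 0" using assms by (metis eq_vecI carrier_vecD index_zero_vec)
  \<comment> \<open>\<open>v\<close> is completed by unit vectors; row \<open>k\<close> takes the
    unit vector at 0 because \<open>v\<close> already accounts for coordinate \<open>k\<close>. The
    other rows force a kernel vector to vanish off \<open>k\<close>, and row 0 then forces it to
    vanish at \<open>k\<close>.\<close>
  define P where "P = mat n n (\<lambda>(i, j). if i = 0 then v $ j else if j = (if i = k then 0 else i) then 1 else 0)"
  have P: "P \<in> carrier_mat n n" by (simp add: P_def)
  have "det P \<noteq> 0"
  proof
    assume "det P = 0"
    then obtain w where w: "w \<in> carrier_vec n" "w \<noteq> 0\<^sub>v n" "P *\<^sub>v w = 0\<^sub>v n"
      using det_0_iff_vec_prod_zero_field[OF P] by blast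
    have Pw: "(\<Sum>j = 0..<n. P $$ (i, j) * w $ j) = 0" if "i < n" for i
    proof -
      have "row P i \<bullet> w = (P *\<^sub>v w) $ i" using P that by simp
      also have "\<dots> = 0" using w that by simp
      finally show ?thesis using that P w by (simp add: scalar_prod_def)
    qed
    have unit: "w $ (if i = k then 0 else i) = 0" if "i < n" "i \<noteq> 0" for i
    proof -
      have "(\<Sum>j = 0..<n. P $$ (i, j) * w $ j) = (\<Sum>j = 0..<n. if j = (if i = k then 0 else i) then w $ j else 0)"
        using that by (intro sum.cong) (auto simp: P_def)
      also have "\<dots> = w $ (if i = k then 0 else i)" using that by auto
      finally show ?thesis using Pw[OF that(1)] by simp
    qed
    have wj: "w $ j = 0" if "j < n" "j \<noteq> k" for j
      using unit[of j] unit[of k] that k by (cases "j = 0") auto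
    have "(\<Sum>j = 0..<n. P $$ (0, j) * w $ j) = (\<Sum>j = 0..<n. if j = k then v $ k * w $ k else 0)"
      using assms(3) wj by (intro sum.cong) (auto simp: P_def)
    then have "w $ k = 0" using Pw[OF assms(3)] k by simp
    then have "w = 0\<^sub>v n" using wj w(1) by (intro eq_vecI) auto
    then show False using w by simp
  qed
  moreover have "row P 0 = v" using assms by (intro eq_vecI) (auto simp: P_def)
  ultimately show ?thesis using that P by (auto simp: GL_def)
qed

lemma row_mult_unit:
  assumes "(A :: 'a::field mat) \<in> carrier_mat n n" "B \<in> carrier_mat n n" "n > 0" "row A 0 = unit_vec n 0"
  shows "row (A * B) 0 = row B 0"
proof (rule eq_vecI)
  fix j assume "j < dim_vec (row B 0)"
  then have j: "j < n" using assms by simp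
  then have "row (A * B) 0 $ j = unit_vec n 0 \<bullet> col B j" using assms by simp
  also have "\<dots> = col B j $ 0" by (rule scalar_prod_left_unit[of _ n]) (use assms in auto)
  finally show "row (A * B) 0 $ j = row B 0 $ j" using assms j by simp
qed (use assms in auto)

lemma row_mult_cong:
  assumes "A \<in> carrier_mat m n" "B \<in> carrier_mat m n" "C \<in> carrier_mat n k" "i < m" "row A i = row B i"
  shows "row (A * C) i = row (B * C) i"
  using assms by (intro eq_vecI) auto

lemma GL_carrier: "A \<in> GL n \<Longrightarrow> A \<in> carrier_mat n n"
  by (simp add: GL_def)

text \<open>Right multiplication by an invertible matrix with first row \<open>v\<close> carries
  first row \<open>unit_vec n 0\<close> to first row \<open>v\<close>, so all nonzero first rows
  occur equally often.\<close>

lemma card_GL_row: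
  assumes v: "(v :: 'a::field vec) \<in> carrier_vec n" "v \<noteq> 0\<^sub>v n" and n: "n > 0"
  shows "card {A \<in> GL n. row A 0 = v} = card {A \<in> (GL n :: 'a mat set). row A 0 = unit_vec n 0}"
proof -
  obtain P where P: "P \<in> GL n" "row P 0 = v" by (rule GL_row_extension[OF v n])
  obtain R where R: "R \<in> GL n" "P * R = 1\<^sub>m n" "R * P = 1\<^sub>m n" using GL_inverse[OF P(1)] .
  note car = GL_carrier[OF P(1)] GL_carrier[OF R(1)]
  have fwd: "A * P \<in> {A \<in> GL n. row A 0 = v}" if "A \<in> {A \<in> GL n. row A 0 = unit_vec n 0}" for A
    using that P GL_mult[of A n P] row_mult_unit[OF GL_carrier car(1) n, of A] by auto
  have bwd: "A * R \<in> {A \<in> GL n. row A 0 = unit_vec n 0}" if "A \<in> {A \<in> GL n. row A 0 = v}" for A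
    using that P R n GL_mult[of A n R] row_mult_cong[OF GL_carrier car(1,2) n, of A] by auto
  have canc: "A * P * R = A" "A * R * P = A" if "A \<in> GL n" for A
    using GL_carrier[OF that] car R by (simp_all add: assoc_mult_mat[of _ n n _ n _ n])
  have "bij_betw (\<lambda>A. A * P) {A \<in> GL n. row A 0 = unit_vec n 0} {A \<in> GL n. row A 0 = v}"
    by (rule bij_betw_byWitness[of _ "\<lambda>A. A * R"]) (use fwd bwd canc in blast)+
  then show ?thesis by (rule bij_betw_same_card[symmetric])
qed

lemma card_carrier_vec: "card (carrier_vec n :: 'a::finite vec set) = card (UNIV::'a set) ^ n"
proof -
  have "bij_betw (\<lambda>v. mat 1 n (\<lambda>(i, j). v $ j)) (carrier_vec n :: 'a vec set) (carrier_mat 1 n)"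
    by (rule bij_betw_byWitness[of _ "\<lambda>A. row A 0"]) (auto intro!: eq_matI eq_vecI)
  from bij_betw_same_card[OF this] show ?thesis by (simp add: card_carrier_mat)
qed

lemma finite_carrier_vec: "finite (carrier_vec n :: 'a::finite vec set)"
  by (rule card_ge_0_finite) (simp add: card_carrier_vec finite_UNIV_card_ge_0)

text \<open>The first factor counts the nonzero first rows, all equally frequent. For the unit
  vector the matrix is block lower triangular: \<open>n\<close> free entries below the corner and an
  invertible block of size \<open>n\<close>.\<close>

lemma card_GL_Suc:
  "card (GL (Suc n) :: 'a::{field,finite} mat set) =
     (card (UNIV::'a set) ^ Suc n - 1) * card (UNIV::'a set) ^ n * card (GL n :: 'a mat set)"
proof -
  let ?G = "GL (Suc n) :: 'a mat set" and ?q = "card (UNIV::'a set)"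
  have nz: "row A 0 \<noteq> 0\<^sub>v (Suc n)" if AG: "A \<in> ?G" for A
  proof
    assume zero: "row A 0 = 0\<^sub>v (Suc n)"
    obtain B where B: "B \<in> GL (Suc n)" "A * B = 1\<^sub>m (Suc n)" using GL_inverse[OF AG] by blast
    have "(A * B) $$ (0, 0) = row A 0 \<bullet> col B 0" using GL_carrier[OF AG] GL_carrier[OF B(1)] by simp
    also have "\<dots> = 0" unfolding zero by (rule scalar_prod_left_zero) (use GL_carrier[OF B(1)] in \<open>auto intro: carrier_vecI\<close>)
    finally show False unfolding B(2) by simp
  qed
  have "bij_betw (\<lambda>(C, D). four_block_mat (1\<^sub>m 1) (0\<^sub>m 1 n) C D) (carrier_mat n 1 \<times> GL n)
    {A \<in> ?G. row A 0 = unit_vec (Suc n) 0}"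
    unfolding bij_betw_def
  proof
    show "inj_on (\<lambda>(C, D). four_block_mat (1\<^sub>m 1) (0\<^sub>m 1 n) C D) (carrier_mat n 1 \<times> (GL n :: 'a mat set))"
      by (rule inj_onI) (auto simp: GL_def four_block_mat_inject[of _ 1 1 _ n _ n])
    have det: "det (four_block_mat (1\<^sub>m 1) (0\<^sub>m 1 n) C D) = det D"
      if "C \<in> carrier_mat n 1" "D \<in> carrier_mat n n" for C D :: "'a mat"
      using det_four_block_mat_upper_right_zero[OF _ refl that, of "1\<^sub>m 1"] by simp
    show "(\<lambda>(C, D). four_block_mat (1\<^sub>m 1) (0\<^sub>m 1 n) C D) ` (carrier_mat n 1 \<times> GL n) =
      {A \<in> ?G. row A 0 = unit_vec (Suc n) 0}"
    proof (intro equalityI subsetI)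
      fix A :: "'a mat" assume "A \<in> (\<lambda>(C, D). four_block_mat (1\<^sub>m 1) (0\<^sub>m 1 n) C D) ` (carrier_mat n 1 \<times> GL n)"
      then obtain C D :: "'a mat" where CD: "C \<in> carrier_mat n 1" "D \<in> GL n"
        "A = four_block_mat (1\<^sub>m 1) (0\<^sub>m 1 n) C D" by auto
      then have "row A 0 = unit_vec (Suc n) 0" by (intro eq_vecI) (auto simp: GL_def)
      moreover have "A \<in> carrier_mat (1 + n) (1 + n)" unfolding CD(3)
        by (rule four_block_carrier_mat) (use CD in \<open>auto simp: GL_def\<close>)
      ultimately show "A \<in> {A \<in> ?G. row A 0 = unit_vec (Suc n) 0}"
        using CD det[of C D] by (auto simp: GL_def)
    next
      fix A assume A: "A \<in> {A \<in> ?G. row A 0 = unit_vec (Suc n) 0}"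
      then have "A \<in> carrier_mat (1 + n) (1 + n)" by (simp add: GL_def)
      then obtain a B C D where *: "a \<in> carrier_mat 1 1" "B \<in> carrier_mat 1 n" "C \<in> carrier_mat n 1"
        "D \<in> carrier_mat n n" "A = four_block_mat a B C D" by (rule carrier_mat_blocks)
      have r: "A $$ (0, j) = (if j = 0 then 1 else 0)" if "j < Suc n" for j
      proof -
        have "row A 0 $ j = A $$ (0, j)" by (rule index_row(1)) (use A that in \<open>auto simp: GL_def\<close>)
        then show ?thesis using A that by simp
      qed
      have "a = 1\<^sub>m 1" using r[of 0] * by (intro eq_matI) auto
      moreover have "B = 0\<^sub>m 1 n" using r[of "Suc j" for j] * by (intro eq_matI) auto
      ultimately show "A \<in> (\<lambda>(C, D). four_block_mat (1\<^sub>m 1) (0\<^sub>m 1 n) C D) ` (carrier_mat n 1 \<times> GL n)"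
        using * A det[of C D] by (auto simp: GL_def image_iff)
    qed
  qed
  from bij_betw_same_card[OF this]
  have unit: "card {A \<in> ?G. row A 0 = unit_vec (Suc n) 0} = ?q ^ n * card (GL n :: 'a mat set)"
    by (simp add: card_cartesian_product card_carrier_mat)
  have row_car: "row A 0 \<in> carrier_vec (Suc n)" if "A \<in> ?G" for A
    using GL_carrier[OF that] by (auto intro!: carrier_vecI)
  have "card ?G = (\<Sum>v\<in>carrier_vec (Suc n) - {0\<^sub>v (Suc n)}. card {A \<in> ?G. row A 0 = v})"
  proof -
    have "?G = (\<Union>v\<in>carrier_vec (Suc n) - {0\<^sub>v (Suc n)}. {A \<in> ?G. row A 0 = v})"
      using nz row_car by blast
    then have "card ?G = card (\<Union>v\<in>carrier_vec (Suc n) - {0\<^sub>v (Suc n)}. {A \<in> ?G. row A 0 = v})"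
      by (rule arg_cong)
    also have "\<dots> = (\<Sum>v\<in>carrier_vec (Suc n) - {0\<^sub>v (Suc n)}. card {A \<in> ?G. row A 0 = v})"
      by (rule card_UN_disjoint) (auto simp: finite_carrier_vec)
    finally show ?thesis .
  qed
  also have "\<dots> = (\<Sum>v\<in>carrier_vec (Suc n) - {0\<^sub>v (Suc n) :: 'a vec}. ?q ^ n * card (GL n :: 'a mat set))"
    by (intro sum.cong refl, subst card_GL_row) (auto simp: unit)
  also have "\<dots> = (?q ^ Suc n - 1) * (?q ^ n * card (GL n :: 'a mat set))"
    by (simp add: card_Diff_singleton card_carrier_vec)
  finally show ?thesis by (simp only: mult.assoc)
qed

lemma GL_0: "GL 0 = {1\<^sub>m 0 :: 'a::field mat}"
  by (auto simp: GL_def intro!: eq_matI)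

lemma uminus_four_block_mat:
  assumes "A \<in> carrier_mat a c" "B \<in> carrier_mat a d" "C \<in> carrier_mat b c" "D \<in> carrier_mat b d"
  shows "- four_block_mat A B C D = four_block_mat (- A) (- B) (- C) (- D)"
  using assms by (intro eq_matI) auto

section \<open>Skew-symmetric matrices\<close>

definition Skew :: "nat \<Rightarrow> 'a::comm_ring_1 mat set" where
  "Skew n = {S \<in> carrier_mat n n. transpose_mat S = - S}"

lemma Skew_carrier: "S \<in> Skew n \<Longrightarrow> S \<in> carrier_mat n n"
  by (simp add: Skew_def)

lemma finite_Skew [simp]: "finite (Skew n :: 'a::{comm_ring_1,finite} mat set)"
  by (simp add: Skew_def)

lemma four_block_mat_Skew_iff:
  assumes "A \<in> carrier_mat a a" "B \<in> carrier_mat a b" "C \<in> carrier_mat b a" "D \<in> carrier_mat b b"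
  shows "four_block_mat A B C D \<in> Skew (a + b) \<longleftrightarrow> A \<in> Skew a \<and> B = - transpose_mat C \<and> D \<in> Skew b"
proof -
  have "transpose_mat (four_block_mat A B C D) = - four_block_mat A B C D \<longleftrightarrow>
    transpose_mat A = - A \<and> transpose_mat C = - B \<and> transpose_mat B = - C \<and> transpose_mat D = - D"
    unfolding transpose_four_block_mat[OF assms] uminus_four_block_mat[OF assms]
    using assms by (intro four_block_mat_inject) auto
  moreover have "transpose_mat C = - B \<longleftrightarrow> B = - transpose_mat C" by auto
  moreover have "transpose_mat B = - C" if "B = - transpose_mat C"
    unfolding that transpose_uminus by simp
  ultimately show ?thesis using assms unfolding Skew_def by auto
qed

lemma bij_betw_Skew_blocks:
  "bij_betw (\<lambda>(A, C, D). four_block_mat A (- transpose_mat C) C D)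
    (Skew a \<times> carrier_mat b a \<times> Skew b) (Skew (a + b) :: 'a::comm_ring_1 mat set)"
  unfolding bij_betw_def
proof
  show "inj_on (\<lambda>(A, C, D). four_block_mat A (- transpose_mat C) C D)
     (Skew a \<times> carrier_mat b a \<times> (Skew b :: 'a mat set))"
    by (rule inj_onI) (auto simp: four_block_mat_inject[of _ a a _ b _ b] Skew_carrier)
  show "(\<lambda>(A, C, D). four_block_mat A (- transpose_mat C) C D) ` (Skew a \<times> carrier_mat b a \<times> Skew b) =
    (Skew (a + b) :: 'a mat set)"
  proof (intro equalityI subsetI)
    fix X :: "'a mat" assume X: "X \<in> Skew (a + b)"
    obtain A B C D where *: "A \<in> carrier_mat a a" "B \<in> carrier_mat a b" "C \<in> carrier_mat b a" "D \<in> carrier_mat b b"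
      "X = four_block_mat A B C D" using carrier_mat_blocks[OF Skew_carrier[OF X]] .
    with X four_block_mat_Skew_iff[OF *(1-4)] have "A \<in> Skew a" "B = - transpose_mat C" "D \<in> Skew b" by auto
    with * show "X \<in> (\<lambda>(A, C, D). four_block_mat A (- transpose_mat C) C D) ` (Skew a \<times> carrier_mat b a \<times> Skew b)"
      by (intro image_eqI[of _ _ "(A, C, D)"]) simp_all
  qed (auto simp: four_block_mat_Skew_iff Skew_carrier)
qed

lemma Skew_0: "Skew 0 = {0\<^sub>m 0 0}"
  by (auto simp: Skew_def intro!: eq_matI)

context char3_character
begin

lemma eq_uminus_iff: "x = - x \<longleftrightarrow> x = (0::'a)"
  using double_eq_0_iff[of x] by (metis add.right_inverse minus_zero)

lemma Skew_1: "Skew 1 = {0\<^sub>m 1 1 :: 'a mat}"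
proof (intro equalityI subsetI)
  fix S :: "'a mat" assume "S \<in> Skew 1"
  then have S: "S \<in> carrier_mat 1 1" "transpose_mat S = - S" by (auto simp: Skew_def)
  have "transpose_mat S $$ (0, 0) = - S $$ (0, 0)" unfolding S(2) using S(1) by simp
  then have "S $$ (0, 0) = 0" using S(1) eq_uminus_iff by simp
  then show "S \<in> {0\<^sub>m 1 1}" using S(1) by (auto intro!: eq_matI)
qed (auto simp: Skew_def intro!: eq_matI)

lemma card_Skew_add:
  "card (Skew (a + b) :: 'a mat set) = card (Skew a :: 'a mat set) * (q ^ (b * a) * card (Skew b :: 'a mat set))"
  using bij_betw_same_card[OF bij_betw_Skew_blocks[of a b, where 'a='a]]
  by (simp add: card_cartesian_product card_carrier_mat q_def)

text \<open>Bordering by one row adds \<open>n\<close> free entries; the new diagonal entry is zero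
  because the characteristic is not two.\<close>

lemma card_Skew: "card (Skew n :: 'a mat set) = q ^ (n * (n - 1) div 2)"
proof (induction n)
  case (Suc n)
  have "card (Skew (Suc n) :: 'a mat set) = q ^ (n * (n - 1) div 2) * q ^ n"
    using card_Skew_add[of n 1] by (simp add: Suc Skew_1[unfolded One_nat_def])
  also have "\<dots> = q ^ (n * (n - 1) div 2 + n)" by (simp add: power_add)
  also have "n * (n - 1) div 2 + n = Suc n * n div 2"
    by (cases n) (simp_all add: algebra_simps)
  finally show ?case by simp
qed (simp add: Skew_0)

text \<open>Under the trace pairing the symmetric matrices are the annihilator of the skew ones, so
  this is character orthogonality on \<open>Skew n\<close>: if \<open>M\<close> is not symmetric,
  some skew shift pairs with it to a value where \<open>lam\<close> differs from one.\<close>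

lemma sum_lam_Skew:
  assumes M: "M \<in> carrier_mat n n"
  shows "(\<Sum>S\<in>Skew n. lam (mat_trace (M * S))) =
    (if transpose_mat M = M then of_nat (card (Skew n :: 'a mat set)) else 0)"
proof (cases "transpose_mat M = M")
  case True
  have "mat_trace (M * S) = 0" if S: "S \<in> Skew n" for S
  proof -
    note SC = Skew_carrier[OF S]
    have "mat_trace (M * S) = mat_trace (transpose_mat (M * S))" using M SC by (subst mat_trace_transpose) auto
    also have "\<dots> = mat_trace (- (S * M))" using M SC True S by (simp add: transpose_mult Skew_def)
    also have "\<dots> = - mat_trace (M * S)"
      using M SC by (subst mat_trace_uminus) (auto simp: mat_trace_commute[of S n n M])
    finally show ?thesis by (simp add: eq_uminus_iff)
  qed
  then show ?thesis using True by simp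
next
  case False
  obtain i j where ij: "i < n" "j < n" "M $$ (i, j) \<noteq> M $$ (j, i)"
  proof (rule ccontr)
    assume "\<not> thesis"
    then have "transpose_mat M = M" using that M by (intro eq_matI) auto
    then show False using False by simp
  qed
  obtain y where y: "lam y \<noteq> 1" using lam_nontrivial by blast
  \<comment> \<open>Scaled so that \<open>T\<close>, which is \<open>x\<close> times the elementary
    skew matrix at \<open>i\<close>, \<open>j\<close>, satisfies
    \<open>mat_trace (M * T) = y\<close>.\<close>
  define x where "x = y / (M $$ (j, i) - M $$ (i, j))"
  define T where "T = mat n n (\<lambda>(a, b). (if a = i \<and> b = j then x else 0) - (if a = j \<and> b = i then x else 0))"
  have T: "T \<in> carrier_mat n n" "T \<in> Skew n"
  proof -
    show T: "T \<in> carrier_mat n n" by (simp add: T_def)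
    have "transpose_mat T = - T" by (rule eq_matI) (simp_all add: T_def conj_commute)
    then show "T \<in> Skew n" using T by (simp add: Skew_def)
  qed
  have "mat_trace (M * T) = (\<Sum>a<n. \<Sum>b<n. M $$ (a, b) * T $$ (b, a))"
    by (rule mat_trace_mult[OF M T(1)])
  also have "\<dots> = (\<Sum>a<n. \<Sum>b<n. (if b = i then if a = j then M $$ (a, b) * x else 0 else 0)
      - (if b = j then if a = i then M $$ (a, b) * x else 0 else 0))"
    by (intro sum.cong refl) (auto simp: T_def algebra_simps)
  also have "\<dots> = M $$ (j, i) * x - M $$ (i, j) * x"
    using ij by (simp add: sum_subtractf)
  also have "\<dots> = (M $$ (j, i) - M $$ (i, j)) * x" by (simp only: left_diff_distrib)
  also have "\<dots> = y" using ij by (simp add: x_def)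
  finally have tr: "mat_trace (M * T) = y" .
  have "(\<Sum>S\<in>Skew n. lam (mat_trace (M * S))) = (\<Sum>S\<in>Skew n. lam (mat_trace (M * (S + T))))"
  proof (rule sum.reindex_bij_witness[of _ "\<lambda>S. S + T" "\<lambda>S. S - T"])
    fix S :: "'a mat" assume S: "S \<in> Skew n"
    show *: "S - T + T = S" "S + T - T = S" using Skew_carrier[OF S] T(1) by (auto intro!: eq_matI)
    show "S - T \<in> Skew n" "S + T \<in> Skew n"
      using Skew_carrier[OF S] T S by (auto simp: Skew_def transpose_minus transpose_add intro!: eq_matI)
    show "lam (mat_trace (M * (S - T + T))) = lam (mat_trace (M * S))" by (simp only: *)
  qed
  also have "\<dots> = (\<Sum>S\<in>Skew n. lam (mat_trace (M * S)) * lam y)"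
  proof (rule sum.cong[OF refl])
    fix S :: "'a mat" assume S: "S \<in> Skew n"
    have "mat_trace (M * (S + T)) = mat_trace (M * S + M * T)"
      using mult_add_distrib_mat[OF M Skew_carrier[OF S] T(1)] by simp
    also have "\<dots> = mat_trace (M * S) + y"
      using mat_trace_add[of "M * S" n "M * T"] M T(1) Skew_carrier[OF S] tr by simp
    finally show "lam (mat_trace (M * (S + T))) = lam (mat_trace (M * S)) * lam y" by (simp add: lam_add)
  qed
  also have "\<dots> = (\<Sum>S\<in>Skew n. lam (mat_trace (M * S))) * lam y" by (simp only: sum_distrib_right)
  finally have "(\<Sum>S\<in>Skew n. lam (mat_trace (M * S))) * (1 - lam y) = 0" by (simp add: right_diff_distrib)
  then show ?thesis using y False by simp
qed

end

section \<open>Invertible symmetric matrices\<close>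

definition SymGL :: "nat \<Rightarrow> 'a::field mat set" where
  "SymGL n = {A \<in> GL n. transpose_mat A = A}"

lemma SymGL_carrier: "A \<in> SymGL n \<Longrightarrow> A \<in> carrier_mat n n"
  by (simp add: SymGL_def GL_def)

lemma finite_SymGL [simp]: "finite (SymGL n :: 'a::{field,finite} mat set)"
  by (simp add: SymGL_def)

text \<open>One step of symmetric elimination: the pivot \<open>c\<close> clears the rest of its row
  and column. It serves both the count of invertible symmetric matrices and their
  diagonalisation.\<close>

lemma schur_complement:
  fixes v Y :: "'a::field mat"
  assumes c: "c \<noteq> 0" and v: "v \<in> carrier_mat 1 n" and Y: "Y \<in> carrier_mat n n"
  defines "L \<equiv> four_block_mat (1\<^sub>m 1) (0\<^sub>m 1 n) (- (inverse c \<cdot>\<^sub>m transpose_mat v)) (1\<^sub>m n)"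
  shows "L * four_block_mat (c \<cdot>\<^sub>m 1\<^sub>m 1) v (transpose_mat v) Y * transpose_mat L =
      four_block_mat (c \<cdot>\<^sub>m 1\<^sub>m 1) (0\<^sub>m 1 n) (0\<^sub>m n 1) (Y - inverse c \<cdot>\<^sub>m (transpose_mat v * v))"
    and "L \<in> GL (1 + n)" and "det L = 1"
proof -
  have LT: "transpose_mat L = four_block_mat (1\<^sub>m 1) (- (inverse c \<cdot>\<^sub>m v)) (0\<^sub>m n 1) (1\<^sub>m n)"
    unfolding L_def using v by (subst transpose_four_block_mat[of _ 1 1 _ n _ n]) (auto intro!: eq_matI)
  have vv: "(inverse c \<cdot>\<^sub>m transpose_mat v) * v = inverse c \<cdot>\<^sub>m (transpose_mat v * v)"
    using v by (subst mult_smult_assoc_mat[of _ n 1]) auto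
  have "L * four_block_mat (c \<cdot>\<^sub>m 1\<^sub>m 1) v (transpose_mat v) Y =
    four_block_mat (c \<cdot>\<^sub>m 1\<^sub>m 1) v (0\<^sub>m n 1) (Y - inverse c \<cdot>\<^sub>m (transpose_mat v * v))"
  proof -
    have "L * four_block_mat (c \<cdot>\<^sub>m 1\<^sub>m 1) v (transpose_mat v) Y = four_block_mat
      (1\<^sub>m 1 * (c \<cdot>\<^sub>m 1\<^sub>m 1) + 0\<^sub>m 1 n * transpose_mat v) (1\<^sub>m 1 * v + 0\<^sub>m 1 n * Y)
      (- (inverse c \<cdot>\<^sub>m transpose_mat v) * (c \<cdot>\<^sub>m 1\<^sub>m 1) + 1\<^sub>m n * transpose_mat v)
      (- (inverse c \<cdot>\<^sub>m transpose_mat v) * v + 1\<^sub>m n * Y)"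
      unfolding L_def by (rule mult_four_block_mat) (use v Y in auto)
    also have "\<dots> = four_block_mat (c \<cdot>\<^sub>m 1\<^sub>m 1) v (0\<^sub>m n 1) (Y - inverse c \<cdot>\<^sub>m (transpose_mat v * v))"
    proof (rule cong_four_block_mat)
      show "- (inverse c \<cdot>\<^sub>m transpose_mat v) * (c \<cdot>\<^sub>m 1\<^sub>m 1) + 1\<^sub>m n * transpose_mat v = 0\<^sub>m n 1"
        using v c by (intro eq_matI) (auto simp: scalar_prod_def)
      show "- (inverse c \<cdot>\<^sub>m transpose_mat v) * v + 1\<^sub>m n * Y = Y - inverse c \<cdot>\<^sub>m (transpose_mat v * v)"
        unfolding uminus_mult_left_mat vv using v Y by (intro eq_matI) auto
    qed (use v Y in auto)
    finally show ?thesis .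
  qed
  then have "L * four_block_mat (c \<cdot>\<^sub>m 1\<^sub>m 1) v (transpose_mat v) Y * transpose_mat L = four_block_mat
      ((c \<cdot>\<^sub>m 1\<^sub>m 1) * 1\<^sub>m 1 + v * 0\<^sub>m n 1) ((c \<cdot>\<^sub>m 1\<^sub>m 1) * (- (inverse c \<cdot>\<^sub>m v)) + v * 1\<^sub>m n)
      (0\<^sub>m n 1 * 1\<^sub>m 1 + (Y - inverse c \<cdot>\<^sub>m (transpose_mat v * v)) * 0\<^sub>m n 1)
      (0\<^sub>m n 1 * (- (inverse c \<cdot>\<^sub>m v)) + (Y - inverse c \<cdot>\<^sub>m (transpose_mat v * v)) * 1\<^sub>m n)"
    unfolding LT by (simp only:, intro mult_four_block_mat) (use v Y in auto)
  also have "\<dots> = four_block_mat (c \<cdot>\<^sub>m 1\<^sub>m 1) (0\<^sub>m 1 n) (0\<^sub>m n 1) (Y - inverse c \<cdot>\<^sub>m (transpose_mat v * v))"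
  proof (rule cong_four_block_mat)
    show "(c \<cdot>\<^sub>m 1\<^sub>m 1) * (- (inverse c \<cdot>\<^sub>m v)) + v * 1\<^sub>m n = 0\<^sub>m 1 n"
      using v c by (intro eq_matI) (auto simp: scalar_prod_def)
  qed (use v Y in auto)
  finally show "L * four_block_mat (c \<cdot>\<^sub>m 1\<^sub>m 1) v (transpose_mat v) Y * transpose_mat L =
      four_block_mat (c \<cdot>\<^sub>m 1\<^sub>m 1) (0\<^sub>m 1 n) (0\<^sub>m n 1) (Y - inverse c \<cdot>\<^sub>m (transpose_mat v * v))" .
  show "det L = 1" unfolding L_def
    by (subst det_four_block_mat_upper_right_zero[of _ 1 _ n]) (use v in auto)
  moreover have "L \<in> carrier_mat (1 + n) (1 + n)" unfolding L_def by (rule four_block_carrier_mat) auto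
  ultimately show "L \<in> GL (1 + n)" by (simp add: GL_def)
qed

lemma det_schur_complement:
  fixes v Y :: "'a::field mat"
  assumes c: "c \<noteq> 0" and v: "v \<in> carrier_mat 1 n" and Y: "Y \<in> carrier_mat n n"
  shows "det (four_block_mat (c \<cdot>\<^sub>m 1\<^sub>m 1) v (transpose_mat v) Y) = c * det (Y - inverse c \<cdot>\<^sub>m (transpose_mat v * v))"
proof -
  define L where "L = four_block_mat (1\<^sub>m 1) (0\<^sub>m 1 n) (- (inverse c \<cdot>\<^sub>m transpose_mat v)) (1\<^sub>m n)"
  define M where "M = four_block_mat (c \<cdot>\<^sub>m 1\<^sub>m 1) v (transpose_mat v) Y"
  note schur = schur_complement[OF assms, folded L_def M_def]
  have M: "M \<in> carrier_mat (1 + n) (1 + n)" unfolding M_def using v Y by (intro four_block_carrier_mat) auto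
  note L = GL_carrier[OF schur(2)]
  have "det (L * M * transpose_mat L) = det M"
    using M L schur(3) by (simp add: det_mult[of _ "1 + n"] det_transpose[of _ "1 + n"] del: plus_1_eq_Suc)
  moreover have "det (L * M * transpose_mat L) = c * det (Y - inverse c \<cdot>\<^sub>m (transpose_mat v * v))"
    unfolding schur(1)
    by (subst det_four_block_mat_upper_right_zero[of _ 1 _ n]) (use v Y in \<open>auto simp: det_single\<close>)
  ultimately show ?thesis by (simp add: M_def)
qed

lemma one_by_one_mat: "(A :: 'a::field mat) \<in> carrier_mat 1 1 \<longleftrightarrow> (\<exists>c. A = c \<cdot>\<^sub>m 1\<^sub>m (1::nat))"
proof
  assume "A \<in> carrier_mat 1 1"
  then have "A = (A $$ (0, 0)) \<cdot>\<^sub>m 1\<^sub>m 1" by (intro eq_matI) auto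
  then show "\<exists>c. A = c \<cdot>\<^sub>m 1\<^sub>m 1" ..
qed auto

lemma symmetric_blocks:
  assumes "X \<in> carrier_mat (1 + n) (1 + n)" "transpose_mat X = (X :: 'a::field mat)"
  obtains c v Y where "v \<in> carrier_mat 1 n" "Y \<in> carrier_mat n n" "transpose_mat Y = Y"
    "X = four_block_mat (c \<cdot>\<^sub>m 1\<^sub>m 1) v (transpose_mat v) Y"
proof -
  obtain a v w Y where *: "a \<in> carrier_mat 1 1" "v \<in> carrier_mat 1 n" "w \<in> carrier_mat n 1" "Y \<in> carrier_mat n n"
    "X = four_block_mat a v w Y" using carrier_mat_blocks[OF assms(1)] .
  then have "four_block_mat (transpose_mat a) (transpose_mat w) (transpose_mat v) (transpose_mat Y) = four_block_mat a v w Y"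
    using assms(2) transpose_four_block_mat[OF *(1-4)] by simp
  then have "transpose_mat v = w" "transpose_mat Y = Y"
    using * by (subst (asm) four_block_mat_inject[of _ 1 1 _ n _ n]; simp)+
  moreover obtain c where "a = c \<cdot>\<^sub>m 1\<^sub>m 1" using *(1) one_by_one_mat by auto
  ultimately show ?thesis using that * by blast
qed

lemma transpose_symmetric_blocks:
  assumes "v \<in> carrier_mat 1 n" "Y \<in> carrier_mat n n"
  shows "transpose_mat (four_block_mat (c \<cdot>\<^sub>m 1\<^sub>m 1) v (transpose_mat v) Y) =
    four_block_mat (c \<cdot>\<^sub>m 1\<^sub>m (1::nat)) v (transpose_mat v) (transpose_mat Y :: 'a::field mat)"
  using assms by (subst transpose_four_block_mat[of _ 1 1 _ n _ n]) (auto intro!: cong_four_block_mat eq_matI)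

text \<open>Counts the invertible symmetric matrices with first row \<open>(c, v)\<close>. Only
  three cases have to be told apart: \<open>c \<noteq> 0\<close>, then \<open>c = 0\<close> with
  \<open>v \<noteq> 0\<close>, and the zero row.\<close>

definition border_count :: "nat \<Rightarrow> 'a::field \<Rightarrow> 'a mat \<Rightarrow> nat" where
  "border_count n c v = card {Y \<in> carrier_mat n n. transpose_mat Y = Y \<and>
     det (four_block_mat (c \<cdot>\<^sub>m 1\<^sub>m 1) v (transpose_mat v) Y) \<noteq> 0}"

lemma card_SymGL_border:
  "card (SymGL (1 + n) :: 'a::{field,finite} mat set) =
    (\<Sum>c\<in>(UNIV::'a set). \<Sum>v\<in>carrier_mat 1 n. border_count n c v)"
proof -
  let ?M = "\<lambda>c v (Y :: 'a mat). four_block_mat (c \<cdot>\<^sub>m 1\<^sub>m 1) v (transpose_mat v) Y"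
  let ?Y = "\<lambda>c v. {Y \<in> carrier_mat n n. transpose_mat Y = Y \<and> det (?M c v Y) \<noteq> 0}"
  let ?S = "SIGMA c:UNIV. SIGMA v:carrier_mat 1 n. ?Y c v"
  have "bij_betw (\<lambda>(c, v, Y). ?M c v Y) ?S (SymGL (1 + n))"
    unfolding bij_betw_def
  proof
    show "inj_on (\<lambda>(c, v, Y). ?M c v Y) ?S"
    proof (rule inj_onI)
      fix p p' assume p: "p \<in> ?S" "p' \<in> ?S" "(\<lambda>(c, v, Y). ?M c v Y) p = (\<lambda>(c, v, Y). ?M c v Y) p'"
      obtain c v Y c' v' Y' where pp: "p = (c, v, Y)" "p' = (c', v', Y')" by (cases p; cases p') auto
      then have *: "v \<in> carrier_mat 1 n" "Y \<in> carrier_mat n n" "v' \<in> carrier_mat 1 n" "Y' \<in> carrier_mat n n"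
        "?M c v Y = ?M c' v' Y'" using p by auto
      then have **: "c \<cdot>\<^sub>m 1\<^sub>m 1 = c' \<cdot>\<^sub>m (1\<^sub>m 1 :: 'a mat)" "v = v'" "Y = Y'"
        by (subst (asm) four_block_mat_inject[of _ 1 1 _ n _ n]; simp)+
      then have "(c \<cdot>\<^sub>m 1\<^sub>m 1) $$ (0, 0) = (c' \<cdot>\<^sub>m (1\<^sub>m 1 :: 'a mat)) $$ (0, 0)" by simp
      then show "p = p'" using ** pp by simp
    qed
    show "(\<lambda>(c, v, Y). ?M c v Y) ` ?S = SymGL (1 + n)"
    proof (intro equalityI subsetI)
      fix X assume "X \<in> (\<lambda>(c, v, Y). ?M c v Y) ` ?S"
      then obtain c v Y where *: "v \<in> carrier_mat 1 n" "Y \<in> carrier_mat n n" "transpose_mat Y = Y"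
        "det (?M c v Y) \<noteq> 0" "X = ?M c v Y" by auto
      have "?M c v Y \<in> carrier_mat (1 + n) (1 + n)" by (rule four_block_carrier_mat) (use * in auto)
      then show "X \<in> SymGL (1 + n)"
        using * transpose_symmetric_blocks[OF *(1,2)] by (simp add: SymGL_def GL_def)
    next
      fix X :: "'a mat" assume X: "X \<in> SymGL (1 + n)"
      then have "X \<in> carrier_mat (1 + n) (1 + n)" "transpose_mat X = X" by (auto simp: SymGL_def GL_def)
      from symmetric_blocks[OF this] obtain c v Y where *: "v \<in> carrier_mat 1 n" "Y \<in> carrier_mat n n"
        "transpose_mat Y = Y" "X = ?M c v Y" .
      have "det (?M c v Y) \<noteq> 0" using X unfolding *(4) by (simp add: SymGL_def GL_def)
      then have "(c, v, Y) \<in> ?S" using *(1-3) by simp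
      then show "X \<in> (\<lambda>(c, v, Y). ?M c v Y) ` ?S" unfolding *(4) by (rule rev_image_eqI) simp
    qed
  qed
  from bij_betw_same_card[OF this] show ?thesis by (simp add: border_count_def)
qed

text \<open>The determinant is \<open>c\<close> times that of the Schur complement, and
  \<open>Y\<close> differs from this complement by the fixed symmetric matrix
  \<open>W\<close>.\<close>

lemma border_count_neq_0:
  assumes "c \<noteq> (0::'a::field)" "v \<in> carrier_mat 1 n"
  shows "border_count n c v = card (SymGL n :: 'a mat set)"
proof -
  define W where "W = inverse c \<cdot>\<^sub>m (transpose_mat v * v)"
  have W: "W \<in> carrier_mat n n" "transpose_mat W = W"
    unfolding W_def using assms by (auto intro!: eq_matI simp: scalar_prod_def mult.commute)
  note schur = det_schur_complement[OF assms, folded W_def]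
  have "bij_betw (\<lambda>Y. Y - W) {Y \<in> carrier_mat n n. transpose_mat Y = Y \<and>
     det (four_block_mat (c \<cdot>\<^sub>m 1\<^sub>m 1) v (transpose_mat v) Y) \<noteq> 0} (SymGL n)"
  proof (rule bij_betw_byWitness[of _ "\<lambda>Y. Y + W"])
    have canc: "Y + W - W = Y" "Y - W + W = Y" if "Y \<in> carrier_mat n n" for Y
      using that W(1) by (intro eq_matI; simp)+
    have sym: "transpose_mat (Y + W) = transpose_mat Y + W" "transpose_mat (Y - W) = transpose_mat Y - W"
      if "Y \<in> carrier_mat n n" for Y
      using that W by (simp_all add: transpose_add[of _ n n] transpose_minus[of _ n n])
    show "(\<lambda>Y. Y - W) ` {Y \<in> carrier_mat n n. transpose_mat Y = Y \<and>
       det (four_block_mat (c \<cdot>\<^sub>m 1\<^sub>m 1) v (transpose_mat v) Y) \<noteq> 0} \<subseteq> SymGL n"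
      using assms W(1) by (auto simp: SymGL_def GL_def sym schur[unfolded One_nat_def] minus_carrier_mat)
    show "(\<lambda>Y. Y + W) ` SymGL n \<subseteq> {Y \<in> carrier_mat n n. transpose_mat Y = Y \<and>
       det (four_block_mat (c \<cdot>\<^sub>m 1\<^sub>m 1) v (transpose_mat v) Y) \<noteq> 0}"
    proof clarify
      fix Y :: "'a mat" assume Y: "Y \<in> SymGL n"
      then have YC: "Y \<in> carrier_mat n n" "Y + W \<in> carrier_mat n n" using W by (auto simp: SymGL_def GL_def)
      show "Y + W \<in> carrier_mat n n \<and> transpose_mat (Y + W) = Y + W \<and>
         det (four_block_mat (c \<cdot>\<^sub>m 1\<^sub>m 1) v (transpose_mat v) (Y + W)) \<noteq> 0"
        unfolding schur[OF YC(2)] sym(1)[OF YC(1)] canc(1)[OF YC(1)]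
        using Y YC assms by (simp add: SymGL_def GL_def)
    qed
    show "\<forall>Y\<in>SymGL n. Y + W - W = Y" using canc by (simp add: SymGL_def GL_def)
  qed (use assms W(1) in \<open>auto intro!: eq_matI\<close>)
  then show ?thesis unfolding border_count_def by (rule bij_betw_same_card)
qed

lemma border_count_0_0: "border_count n 0 (0\<^sub>m 1 n :: 'a::field mat) = 0"
proof -
  have "det (four_block_mat (0 \<cdot>\<^sub>m 1\<^sub>m 1) (0\<^sub>m 1 n) (transpose_mat (0\<^sub>m 1 n)) Y) = 0"
    if "Y \<in> carrier_mat n n" for Y :: "'a mat"
    by (subst det_four_block_mat_upper_right_zero[of _ 1 _ n]) (use that in \<open>auto simp: det_single\<close>)
  then have "{Y \<in> carrier_mat n n. transpose_mat Y = Y \<and>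
     det (four_block_mat (0 \<cdot>\<^sub>m 1\<^sub>m 1) (0\<^sub>m 1 n) (transpose_mat (0\<^sub>m 1 n)) Y) \<noteq> (0::'a)} = {}" by blast
  then show ?thesis unfolding border_count_def by (simp only: card.empty)
qed

text \<open>Congruence by the block diagonal matrix of \<open>1\<close> and \<open>P\<close> maps
  the completions for \<open>v\<close> to those for \<open>v * P\<close> and scales the determinant
  by a nonzero square. Hence every nonzero \<open>v\<close> can be reduced to a unit vector.\<close>

lemma border_count_congruence:
  assumes v: "(v :: 'a::field mat) \<in> carrier_mat 1 n" and P: "P \<in> GL n"
  shows "border_count n c (v * P) = border_count n c v"
proof -
  note PC = GL_carrier[OF P]
  obtain R where R: "R \<in> GL n" "P * R = 1\<^sub>m n" "R * P = 1\<^sub>m n" using GL_inverse[OF P] .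
  note RC = GL_carrier[OF R(1)]
  let ?M = "\<lambda>v (Y :: 'a mat). four_block_mat (c \<cdot>\<^sub>m 1\<^sub>m 1) v (transpose_mat v) Y"
  have det_eq: "det (?M (v * P) (transpose_mat P * Y * P)) = det P * det P * det (?M v Y)"
    if v: "v \<in> carrier_mat 1 n" and Y: "Y \<in> carrier_mat n n" and P: "P \<in> carrier_mat n n" for v Y P
  proof -
    define D where "D = four_block_mat (1\<^sub>m 1) (0\<^sub>m 1 n) (0\<^sub>m n 1) P"
    have DT: "transpose_mat D = four_block_mat (1\<^sub>m 1) (0\<^sub>m 1 n) (0\<^sub>m n 1) (transpose_mat P)"
      unfolding D_def using P by (subst transpose_four_block_mat[of _ 1 1 _ n _ n]) auto
    have D: "D \<in> carrier_mat (1 + n) (1 + n)" unfolding D_def using P by (intro four_block_carrier_mat) auto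
    have detD: "det D = det P" unfolding D_def
      by (subst det_four_block_mat_upper_right_zero[of _ 1 _ n]) (use P in auto)
    have M: "?M v Y \<in> carrier_mat (1 + n) (1 + n)" using v Y by (intro four_block_carrier_mat) auto
    have "?M v Y * D = four_block_mat ((c \<cdot>\<^sub>m 1\<^sub>m 1) * 1\<^sub>m 1 + v * 0\<^sub>m n 1) ((c \<cdot>\<^sub>m 1\<^sub>m 1) * 0\<^sub>m 1 n + v * P)
      (transpose_mat v * 1\<^sub>m 1 + Y * 0\<^sub>m n 1) (transpose_mat v * 0\<^sub>m 1 n + Y * P)"
      unfolding D_def by (rule mult_four_block_mat) (use v Y P in auto)
    also have "\<dots> = four_block_mat (c \<cdot>\<^sub>m 1\<^sub>m 1) (v * P) (transpose_mat v) (Y * P)"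
      using v Y P by (intro cong_four_block_mat) auto
    finally have "transpose_mat D * (?M v Y * D) = four_block_mat
      (1\<^sub>m 1 * (c \<cdot>\<^sub>m 1\<^sub>m 1) + 0\<^sub>m 1 n * transpose_mat v) (1\<^sub>m 1 * (v * P) + 0\<^sub>m 1 n * (Y * P))
      (0\<^sub>m n 1 * (c \<cdot>\<^sub>m 1\<^sub>m 1) + transpose_mat P * transpose_mat v) (0\<^sub>m n 1 * (v * P) + transpose_mat P * (Y * P))"
      unfolding DT by (simp only:, intro mult_four_block_mat) (use v Y P in auto)
    also have "\<dots> = ?M (v * P) (transpose_mat P * Y * P)"
      using v Y P by (intro cong_four_block_mat) (auto simp: transpose_mult[of _ 1 n _ n] assoc_mult_mat[of _ n n _ n _ n])
    finally have "det (?M (v * P) (transpose_mat P * Y * P)) = det (transpose_mat D * (?M v Y * D))" by simp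
    also have "\<dots> = det P * det P * det (?M v Y)"
      using D M detD by (simp add: det_mult[of _ "1 + n"] det_transpose[of _ "1 + n"] del: plus_1_eq_Suc)
    finally show ?thesis .
  qed
  have inv: "transpose_mat R * (transpose_mat P * Y * P) * R = Y" "transpose_mat P * (transpose_mat R * Y * R) * P = Y"
    if "Y \<in> carrier_mat n n" for Y
  proof -
    have *: "transpose_mat B * (transpose_mat A * Y * A) * B = Y"
      if "A \<in> carrier_mat n n" "B \<in> carrier_mat n n" "A * B = 1\<^sub>m n" for A B
    proof -
      have "transpose_mat B * (transpose_mat A * Y * A) * B = (transpose_mat B * transpose_mat A) * Y * (A * B)"
        using that \<open>Y \<in> carrier_mat n n\<close> by (simp add: assoc_mult_mat[of _ n n _ n _ n])
      also have "transpose_mat B * transpose_mat A = transpose_mat (A * B)"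
        using that by (subst transpose_mult[of _ n n _ n]) auto
      finally show ?thesis using that \<open>Y \<in> carrier_mat n n\<close> by simp
    qed
    show "transpose_mat R * (transpose_mat P * Y * P) * R = Y" "transpose_mat P * (transpose_mat R * Y * R) * P = Y"
      using *[OF PC RC R(2)] *[OF RC PC R(3)] by auto
  qed
  have sym: "transpose_mat (transpose_mat A * Y * A) = transpose_mat A * Y * A"
    if "A \<in> carrier_mat n n" "Y \<in> carrier_mat n n" "transpose_mat Y = Y" for A Y :: "'a mat"
    using that by (simp add: transpose_mult[of _ n n _ n] assoc_mult_mat[of _ n n _ n _ n])
  have vPR: "v * P * R = v" using v PC RC R by (simp add: assoc_mult_mat[of _ 1 n _ n _ n])
  let ?Y = "\<lambda>v. {Y \<in> carrier_mat n n. transpose_mat Y = Y \<and> det (?M v Y) \<noteq> 0}"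
  have vP: "v * P \<in> carrier_mat 1 n" using v PC by simp
  have image: "(\<lambda>Y. transpose_mat A * Y * A) ` ?Y v \<subseteq> ?Y (v * A)" if "v \<in> carrier_mat 1 n" "A \<in> GL n" for v A
    using that det_eq sym by (auto simp: GL_def)
  have "bij_betw (\<lambda>Y. transpose_mat P * Y * P) (?Y v) (?Y (v * P))"
  proof (rule bij_betw_byWitness[of _ "\<lambda>Y. transpose_mat R * Y * R"])
    show "(\<lambda>Y. transpose_mat P * Y * P) ` ?Y v \<subseteq> ?Y (v * P)" by (rule image[OF v P])
    show "(\<lambda>Y. transpose_mat R * Y * R) ` ?Y (v * P) \<subseteq> ?Y v"
      using image[OF vP R(1)] unfolding vPR .
  qed (use inv in auto)
  then show ?thesis unfolding border_count_def by (rule bij_betw_same_card[symmetric])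
qed

text \<open>The first two coordinates split off as a hyperbolic plane: the corner \<open>b\<close>
  and the row \<open>u\<close> of the remaining matrix are free, with \<open>Suc n\<close> entries
  in all, and only the block \<open>X\<close> must be invertible.\<close>

lemma border_count_unit:
  "border_count (Suc n) 0 (mat 1 (Suc n) (\<lambda>(i, j). if j = 0 then 1 else 0 :: 'a::{field,finite})) =
    card (UNIV::'a set) ^ Suc n * card (SymGL n :: 'a mat set)"
proof -
  define v :: "'a mat" where "v = mat 1 (Suc n) (\<lambda>(i, j). if j = 0 then 1 else 0)"
  let ?N = "\<lambda>c u (X :: 'a mat). four_block_mat (c \<cdot>\<^sub>m 1\<^sub>m 1) u (transpose_mat u) X"
  let ?M = "\<lambda>Y. four_block_mat (0 \<cdot>\<^sub>m 1\<^sub>m 1) v (transpose_mat v) Y"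
  have det: "det (?M (?N b u X)) = - det X" if u: "u \<in> carrier_mat 1 n" and X: "X \<in> carrier_mat n n" for b u X
  proof -
    define M where "M = ?M (?N b u X)"
    have M: "M \<in> carrier_mat (2 + n) (2 + n)" unfolding M_def carrier_mat_def using u X by (auto simp: v_def)
    define K where "K = four_block_mat (1\<^sub>m 1) u (0\<^sub>m n 1) X"
    have K: "K \<in> carrier_mat (1 + n) (1 + n)" unfolding K_def using u X by (intro four_block_carrier_mat) auto
    define w where "w = mat (1 + n) 1 (\<lambda>(i, j). if i = 0 then b else u $$ (0, i - 1))"
    \<comment> \<open>After the swap the first row is a unit vector, so the determinant is that of
      \<open>K\<close>, and \<open>K\<close> is block upper triangular with diagonal blocks
      \<open>1\<close> and \<open>X\<close>.\<close>
    have "swapcols 0 1 M = four_block_mat (1\<^sub>m 1) (0\<^sub>m 1 (1 + n)) w K"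
    proof (rule eq_matI)
      fix i j assume "i < dim_row (four_block_mat (1\<^sub>m 1) (0\<^sub>m 1 (1 + n)) w K)"
        "j < dim_col (four_block_mat (1\<^sub>m 1) (0\<^sub>m 1 (1 + n)) w K)"
      then have ij: "i < 2 + n" "j < 2 + n" using K by auto
      consider "i = 0" | "i = 1" | k where "i = Suc (Suc k)" by (metis One_nat_def not0_implies_Suc)
      moreover consider "j = 0" | "j = 1" | k where "j = Suc (Suc k)" by (metis One_nat_def not0_implies_Suc)
      ultimately show "swapcols 0 1 M $$ (i, j) = four_block_mat (1\<^sub>m 1) (0\<^sub>m 1 (1 + n)) w K $$ (i, j)"
        using ij M u X unfolding M_def K_def w_def v_def by cases (cases, auto)+
    qed (use M K in auto)
    moreover have "det (swapcols 0 1 M) = - det M" by (rule det_swapcols[of _ "2 + n"]) (use M in auto)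
    moreover have "det (four_block_mat (1\<^sub>m 1) (0\<^sub>m 1 (1 + n)) w K) = det K"
      by (subst det_four_block_mat_upper_right_zero[of _ 1 _ "1 + n"]) (use K in \<open>auto simp: w_def\<close>)
    moreover have "det K = det X" unfolding K_def
      by (subst det_four_block_mat_lower_left_zero[of _ 1 _ n]) (use u X in auto)
    ultimately have "- det M = det X" by simp
    then show ?thesis unfolding M_def by (metis minus_minus)
  qed
  let ?S = "(UNIV :: 'a set) \<times> carrier_mat 1 n \<times> (SymGL n :: 'a mat set)"
  let ?T = "{Y \<in> carrier_mat (Suc n) (Suc n). transpose_mat Y = Y \<and> det (?M Y) \<noteq> 0}"
  have "bij_betw (\<lambda>(b, u, X). ?N b u X) ?S ?T"
    unfolding bij_betw_def
  proof
    show "inj_on (\<lambda>(b, u, X). ?N b u X) ?S"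
    proof (rule inj_onI)
      fix p p' assume p: "p \<in> ?S" "p' \<in> ?S" "(\<lambda>(b, u, X). ?N b u X) p = (\<lambda>(b, u, X). ?N b u X) p'"
      obtain c v Y c' v' Y' where pp: "p = (c, v, Y)" "p' = (c', v', Y')" by (cases p; cases p') auto
      then have *: "v \<in> carrier_mat 1 n" "Y \<in> carrier_mat n n" "v' \<in> carrier_mat 1 n" "Y' \<in> carrier_mat n n"
        "?N c v Y = ?N c' v' Y'" using p by (auto simp: SymGL_carrier)
      then have **: "c \<cdot>\<^sub>m 1\<^sub>m 1 = c' \<cdot>\<^sub>m (1\<^sub>m 1 :: 'a mat)" "v = v'" "Y = Y'"
        by (subst (asm) four_block_mat_inject[of _ 1 1 _ n _ n]; simp)+
      then have "(c \<cdot>\<^sub>m 1\<^sub>m 1) $$ (0, 0) = (c' \<cdot>\<^sub>m (1\<^sub>m 1 :: 'a mat)) $$ (0, 0)" by simp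
      then show "p = p'" using ** pp by simp
    qed
    show "(\<lambda>(b, u, X). ?N b u X) ` ?S = ?T"
    proof (intro equalityI subsetI)
      fix Y assume "Y \<in> (\<lambda>(b, u, X). ?N b u X) ` ?S"
      then obtain b u X where *: "u \<in> carrier_mat 1 n" "X \<in> SymGL n" "Y = ?N b u X" by auto
      note XC = SymGL_carrier[OF *(2)]
      have "Y \<in> carrier_mat (1 + n) (1 + n)" unfolding *(3) by (rule four_block_carrier_mat) (use * XC in auto)
      then show "Y \<in> ?T"
        using * det[OF *(1) XC] transpose_symmetric_blocks[OF *(1) XC] by (simp add: SymGL_def GL_def)
    next
      fix Y assume Y: "Y \<in> ?T"
      then have "Y \<in> carrier_mat (1 + n) (1 + n)" "transpose_mat Y = Y" by auto
      from symmetric_blocks[OF this] obtain b u X where *: "u \<in> carrier_mat 1 n" "X \<in> carrier_mat n n"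
        "transpose_mat X = X" "Y = ?N b u X" .
      have "det (?M (?N b u X)) \<noteq> 0" using Y unfolding *(4) by simp
      then have "(b, u, X) \<in> ?S" using det[OF *(1,2)] *(2,3) *(1) by (simp add: SymGL_def GL_def)
      then show "Y \<in> (\<lambda>(b, u, X). ?N b u X) ` ?S" unfolding *(4) by (rule rev_image_eqI) simp
    qed
  qed
  from bij_betw_same_card[OF this] show ?thesis
    unfolding border_count_def v_def[symmetric] by (simp add: card_cartesian_product card_carrier_mat)
qed

lemma border_count_0:
  assumes v: "(v :: 'a::{field,finite} mat) \<in> carrier_mat 1 (Suc n)" "v \<noteq> 0\<^sub>m 1 (Suc n)"
  shows "border_count (Suc n) 0 v = card (UNIV::'a set) ^ Suc n * card (SymGL n :: 'a mat set)"
proof -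
  define u :: "'a mat" where "u = mat 1 (Suc n) (\<lambda>(i, j). if j = 0 then 1 else 0)"
  have "row v 0 \<noteq> 0\<^sub>v (Suc n)"
  proof
    assume eq: "row v 0 = 0\<^sub>v (Suc n)"
    have "v $$ (0, j) = row v 0 $ j" if "j < Suc n" for j using v that by simp
    then have "v = 0\<^sub>m 1 (Suc n)" using v(1) unfolding eq by (intro eq_matI) auto
    then show False using v by simp
  qed
  moreover have "row v 0 \<in> carrier_vec (Suc n)" using v by (auto intro!: carrier_vecI)
  ultimately obtain P where P: "P \<in> GL (Suc n)" "row P 0 = row v 0" using GL_row_extension by blast
  have "u * P = v"
  proof (rule eq_matI)
    fix i j assume "i < dim_row v" "j < dim_col v"
    then have ij: "i = 0" "j < Suc n" using v by auto
    have "(u * P) $$ (i, j) = (\<Sum>k = 0..<Suc n. u $$ (0, k) * P $$ (k, j))"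
      using ij GL_carrier[OF P(1)] by (simp add: u_def scalar_prod_def del: sum.op_ivl_Suc)
    also have "\<dots> = (\<Sum>k = 0..<Suc n. (if k = 0 then P $$ (k, j) else 0))"
      by (intro sum.cong) (auto simp: u_def)
    also have "\<dots> = P $$ (0, j)" by (simp del: sum.op_ivl_Suc)
    also have "\<dots> = row P 0 $ j" using ij GL_carrier[OF P(1)] by simp
    also have "\<dots> = v $$ (i, j)" unfolding P(2) using ij v by simp
    finally show "(u * P) $$ (i, j) = v $$ (i, j)" .
  qed (use v GL_carrier[OF P(1)] in \<open>auto simp: u_def\<close>)
  then have "border_count (Suc n) 0 v = border_count (Suc n) 0 u"
    using border_count_congruence[OF _ P(1), of u 0] by (simp add: u_def)
  then show ?thesis using border_count_unit[of n, where 'a='a] by (simp add: u_def)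
qed

lemma card_SymGL_0: "card (SymGL 0 :: 'a::field mat set) = 1"
proof -
  have "SymGL 0 = {1\<^sub>m 0 :: 'a mat}" unfolding SymGL_def GL_0 by auto
  then show ?thesis by simp
qed

lemma sum_split_0: "(\<Sum>x\<in>(UNIV::'a::{zero,finite} set). F x) = F 0 + (\<Sum>x\<in>UNIV - {0}. F x)"
  by (rule sum.remove) auto

lemma card_SymGL_1: "card (SymGL 1 :: 'a::{field,finite} mat set) = card (UNIV::'a set) - 1"
proof -
  have "card (SymGL (1 + 0) :: 'a mat set) = (\<Sum>c\<in>UNIV - {0::'a}. \<Sum>v\<in>carrier_mat 1 0. border_count 0 c v)"
    unfolding card_SymGL_border by (subst sum_split_0) (simp add: carrier_mat_0 border_count_0_0[of 0, unfolded One_nat_def])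
  also have "\<dots> = (\<Sum>c\<in>UNIV - {0::'a}. 1)"
    by (intro sum.cong refl) (simp add: carrier_mat_0 border_count_neq_0[of _ _ 0, unfolded One_nat_def] card_SymGL_0)
  also have "\<dots> = card (UNIV::'a set) - 1" by (simp add: card_Diff_singleton)
  finally show ?thesis by simp
qed

text \<open>Sorted by the first row \<open>(c, v)\<close>: for \<open>c = 0\<close> every nonzero
  \<open>v\<close> leaves a symmetric block two sizes smaller, while for \<open>c \<noteq> 0\<close>
  the Schur complement is one size smaller and \<open>v\<close> is arbitrary.\<close>

lemma card_SymGL_Suc_Suc:
  fixes q :: nat
  assumes q: "q = card (UNIV :: 'a::{field,finite} set)"
  shows "card (SymGL (Suc (Suc n)) :: 'a mat set) =
    (q ^ Suc n - 1) * (q ^ Suc n * card (SymGL n :: 'a mat set)) +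
    (q - 1) * (q ^ Suc n * card (SymGL (Suc n) :: 'a mat set))"
proof -
  have "(\<Sum>v\<in>carrier_mat 1 (Suc n). border_count (Suc n) 0 (v :: 'a mat)) =
    border_count (Suc n) 0 (0\<^sub>m 1 (Suc n) :: 'a mat) +
    (\<Sum>v\<in>carrier_mat 1 (Suc n) - {0\<^sub>m 1 (Suc n)}. border_count (Suc n) 0 (v :: 'a mat))"
    by (rule sum.remove) auto
  also have "\<dots> = (\<Sum>v\<in>carrier_mat 1 (Suc n) - {0\<^sub>m 1 (Suc n) :: 'a mat}. q ^ Suc n * card (SymGL n :: 'a mat set))"
    by (simp only: border_count_0_0 add_0, intro sum.cong refl) (auto simp: border_count_0 q simp del: power_Suc)
  also have "\<dots> = (q ^ Suc n - 1) * (q ^ Suc n * card (SymGL n :: 'a mat set))"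
    by (simp add: card_Diff_singleton card_carrier_mat q del: power_Suc)
  finally have 1: "(\<Sum>v\<in>carrier_mat 1 (Suc n). border_count (Suc n) 0 (v :: 'a mat)) =
    (q ^ Suc n - 1) * (q ^ Suc n * card (SymGL n :: 'a mat set))" .
  have 2: "(\<Sum>c\<in>UNIV - {0::'a}. \<Sum>v\<in>carrier_mat 1 (Suc n). border_count (Suc n) c v) =
    (q - 1) * (q ^ Suc n * card (SymGL (Suc n) :: 'a mat set))"
  proof -
    have "(\<Sum>c\<in>UNIV - {0::'a}. \<Sum>v\<in>carrier_mat 1 (Suc n). border_count (Suc n) c v) =
      (\<Sum>c\<in>UNIV - {0::'a}. \<Sum>v\<in>(carrier_mat 1 (Suc n) :: 'a mat set). card (SymGL (Suc n) :: 'a mat set))"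
      by (intro sum.cong refl border_count_neq_0) auto
    then show ?thesis by (simp add: card_carrier_mat card_Diff_singleton q del: power_Suc)
  qed
  show ?thesis
    using card_SymGL_border[of "Suc n", where 'a='a] unfolding sum_split_0 1 2 by simp
qed

section \<open>Gram matrices of the norm form\<close>

lemma delta_eps_carrier [simp]: "delta_eps e \<in> carrier_mat 2 2"
  by (simp add: delta_eps_def)

lemma delta_eps_transpose [simp]: "transpose_mat (delta_eps e) = delta_eps e"
  by (rule eq_matI) (auto simp: delta_eps_def)

definition gram :: "'a::comm_ring_1 \<Rightarrow> 'a mat \<Rightarrow> 'a mat" where
  "gram e h = transpose_mat h * delta_eps e * h"

lemma gram_carrier [simp]: "h \<in> carrier_mat 2 m \<Longrightarrow> gram e h \<in> carrier_mat m m"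
  unfolding gram_def by (meson delta_eps_carrier mult_carrier_mat transpose_carrier_mat)

lemma gram_index:
  assumes h: "h \<in> carrier_mat 2 m" and ij: "i < m" "j < m"
  shows "gram e h $$ (i, j) = h $$ (0, i) * h $$ (0, j) - e * h $$ (1, i) * h $$ (1, j)"
  using assms unfolding gram_def
  by (simp add: scalar_prod_def delta_eps_def numeral_2_eq_2 algebra_simps)

lemma gram_mult:
  assumes "h \<in> carrier_mat 2 m" "P \<in> carrier_mat m n"
  shows "gram e (h * P) = transpose_mat P * gram e h * P"
proof -
  have hd: "transpose_mat h * delta_eps e \<in> carrier_mat m 2" "gram e h \<in> carrier_mat m m"
    using assms by auto
  have "gram e (h * P) = transpose_mat P * transpose_mat h * delta_eps e * (h * P)"
    unfolding gram_def using assms by (simp add: transpose_mult[of _ 2 m _ n])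
  also have "\<dots> = transpose_mat P * (transpose_mat h * delta_eps e) * (h * P)"
    using assms by (simp add: assoc_mult_mat[of _ n m _ 2 _ 2])
  also have "\<dots> = transpose_mat P * (transpose_mat h * delta_eps e * (h * P))"
    using assms hd by (intro assoc_mult_mat[of _ n m _ 2 _ n]) auto
  also have "transpose_mat h * delta_eps e * (h * P) = gram e h * P"
    unfolding gram_def using assms hd by (intro assoc_mult_mat[symmetric, of _ m 2 _ m _ n]) auto
  also have "transpose_mat P * (gram e h * P) = transpose_mat P * gram e h * P"
    using assms hd by (intro assoc_mult_mat[symmetric, of _ n m _ m]) auto
  finally show ?thesis .
qed

lemma mat_trace_mult_gram:
  assumes "X \<in> carrier_mat m m" "h \<in> carrier_mat 2 m"
  shows "mat_trace (X * gram e h) =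
    (\<Sum>i<m. \<Sum>j<m. X $$ (i, j) * (h $$ (0, j) * h $$ (0, i) - e * h $$ (1, j) * h $$ (1, i)))"
  unfolding mat_trace_mult[OF assms(1) gram_carrier[OF assms(2)]]
  using assms(2) by (intro sum.cong refl) (auto simp: gram_index)

lemma scalar_prod_unit_mult:
  assumes "A \<in> carrier_mat n n" "i < n" "j < n"
  shows "unit_vec n i \<bullet> (A *\<^sub>v unit_vec n j) = (A $$ (i, j) :: 'a::field)"
proof -
  have "unit_vec n i \<bullet> (A *\<^sub>v unit_vec n j) = (A *\<^sub>v unit_vec n j) $ i"
    by (rule scalar_prod_left_unit[of _ n]) (use assms in auto)
  also have "\<dots> = row A i \<bullet> unit_vec n j" using assms by simp
  also have "\<dots> = row A i $ j" by (rule scalar_prod_right_unit) (use assms in auto)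
  finally show ?thesis using assms by simp
qed

section \<open>Diagonalisation by congruence\<close>

context char3_character
begin

text \<open>Polarisation: a form vanishing on all vectors has
  \<open>A $$ (i, j) + A $$ (j, i) = 0\<close>, so by symmetry and odd characteristic
  \<open>A = 0\<close>, which is not invertible in positive size.\<close>

lemma exists_anisotropic_vec:
  assumes A: "A \<in> SymGL n" and n: "n > 0"
  obtains v :: "'a vec" where "v \<in> carrier_vec n" "v \<bullet> (A *\<^sub>v v) \<noteq> 0"
proof (rule ccontr)
  note obt = that
  assume no: "\<not> thesis"
  note AC = SymGL_carrier[OF A]
  have 0: "v \<bullet> (A *\<^sub>v v) = 0" if "v \<in> carrier_vec n" for v :: "'a vec" using no obt[OF that] by blast
  have "A $$ (i, j) = 0" if ij: "i < n" "j < n" for i j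
  proof -
    let ?u = "unit_vec n i :: 'a vec" and ?w = "unit_vec n j :: 'a vec"
    have uw: "?u \<in> carrier_vec n" "?w \<in> carrier_vec n" "A *\<^sub>v ?u \<in> carrier_vec n" "A *\<^sub>v ?w \<in> carrier_vec n"
      using AC by auto
    have "0 = (?u + ?w) \<bullet> (A *\<^sub>v (?u + ?w))" using 0[of "?u + ?w"] uw by simp
    also have "A *\<^sub>v (?u + ?w) = A *\<^sub>v ?u + A *\<^sub>v ?w" by (rule mult_add_distrib_mat_vec[OF AC uw(1,2)])
    also have "(?u + ?w) \<bullet> (A *\<^sub>v ?u + A *\<^sub>v ?w) =
        ?u \<bullet> (A *\<^sub>v ?u) + ?u \<bullet> (A *\<^sub>v ?w) + (?w \<bullet> (A *\<^sub>v ?u) + ?w \<bullet> (A *\<^sub>v ?w))"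
      using uw by (simp add: add_scalar_prod_distrib[of _ n] scalar_prod_add_distrib[of _ n])
    also have "\<dots> = A $$ (i, j) + A $$ (j, i)"
      using 0[OF uw(1)] 0[OF uw(2)] by (simp add: scalar_prod_unit_mult[OF AC] ij)
    also have "A $$ (j, i) = transpose_mat A $$ (i, j)" using AC ij by simp
    also have "transpose_mat A = A" using A by (simp add: SymGL_def)
    finally show ?thesis using double_eq_0_iff by simp
  qed
  then have "A = 0\<^sub>m n n" using AC by (intro eq_matI) auto
  then show False using A n by (simp add: SymGL_def GL_def)
qed

text \<open>An anisotropic vector taken as first row of \<open>P\<close> makes the corner of
  \<open>P * A * transpose_mat P\<close> nonzero, and elimination with this pivot splits it
  off.\<close>

lemma SymGL_congruent_split:
  assumes A: "A \<in> SymGL (1 + n)"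
  obtains P c B where "P \<in> GL (1 + n)" "c \<noteq> (0::'a)" "B \<in> SymGL n"
    "P * A * transpose_mat P = four_block_mat (c \<cdot>\<^sub>m 1\<^sub>m 1) (0\<^sub>m 1 n) (0\<^sub>m n 1) B"
proof -
  let ?n = "1 + n"
  note AC = SymGL_carrier[OF A]
  have AT: "transpose_mat A = A" using A by (simp add: SymGL_def)
  obtain p :: "'a vec" where p: "p \<in> carrier_vec ?n" "p \<bullet> (A *\<^sub>v p) \<noteq> 0"
    by (rule exists_anisotropic_vec[OF A]) auto
  have "p \<noteq> 0\<^sub>v ?n"
  proof
    assume "p = 0\<^sub>v ?n"
    then have "p \<bullet> (A *\<^sub>v p) = 0" using AC by (simp only:, intro scalar_prod_left_zero) auto
    then show False using p by simp
  qed
  then obtain P where P: "P \<in> GL ?n" "row P 0 = p" by (rule GL_row_extension[OF p(1)]) auto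
  note PC = GL_carrier[OF P(1)]
  define M where "M = P * A * transpose_mat P"
  have M: "M \<in> carrier_mat ?n ?n" using PC AC by (simp add: M_def)
  have "M \<in> GL ?n" unfolding M_def using P A by (intro GL_mult GL_transpose) (auto simp: SymGL_def)
  have MT: "transpose_mat M = M"
    unfolding M_def using PC AC AT
    by (simp add: transpose_mult[of _ ?n ?n _ ?n] assoc_mult_mat[of _ ?n ?n _ ?n _ ?n] del: plus_1_eq_Suc)
  obtain c v Y where *: "v \<in> carrier_mat 1 n" "Y \<in> carrier_mat n n" "transpose_mat Y = Y"
    "M = four_block_mat (c \<cdot>\<^sub>m 1\<^sub>m 1) v (transpose_mat v) Y" using symmetric_blocks[OF M MT] .
  have "c = M $$ (0, 0)" unfolding *(4) using * by simp
  also have "M = P * (A * transpose_mat P)" unfolding M_def using PC AC by (intro assoc_mult_mat) auto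
  also have "\<dots> $$ (0, 0) = row P 0 \<bullet> col (A * transpose_mat P) 0" using PC AC by simp
  also have "col (A * transpose_mat P) 0 = A *\<^sub>v col (transpose_mat P) 0"
    by (rule col_mult2[of _ ?n ?n _ ?n]) (use PC AC in auto)
  also have "col (transpose_mat P) 0 = row P 0" using PC by simp
  finally have c: "c \<noteq> 0" using p P by simp
  define L where "L = four_block_mat (1\<^sub>m 1) (0\<^sub>m 1 n) (- (inverse c \<cdot>\<^sub>m transpose_mat v)) (1\<^sub>m n)"
  define B where "B = Y - inverse c \<cdot>\<^sub>m (transpose_mat v * v)"
  note schur = schur_complement[OF c *(1,2), folded L_def B_def *(4)]
  note LC = GL_carrier[OF schur(2)]
  have LP: "L * P \<in> GL ?n" by (rule GL_mult[OF schur(2) P(1)])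
  have "L * P * A * transpose_mat (L * P) = L * M * transpose_mat L"
    unfolding M_def using LC PC AC
    by (simp add: transpose_mult[of _ ?n ?n _ ?n] assoc_mult_mat[of _ ?n ?n _ ?n _ ?n] del: plus_1_eq_Suc)
  then have eq: "L * P * A * transpose_mat (L * P) = four_block_mat (c \<cdot>\<^sub>m 1\<^sub>m 1) (0\<^sub>m 1 n) (0\<^sub>m n 1) B"
    using schur(1) by simp
  have BC: "B \<in> carrier_mat n n" unfolding B_def by (rule minus_carrier_mat) (use * in auto)
  have "det M = c * det B" using det_schur_complement[OF c *(1,2)] by (simp only: *(4)[symmetric] B_def)
  then have "det B \<noteq> 0" using \<open>M \<in> GL ?n\<close> by (auto simp: GL_def)
  moreover have "transpose_mat B = B"
  proof -
    have "transpose_mat (inverse c \<cdot>\<^sub>m (transpose_mat v * v)) = inverse c \<cdot>\<^sub>m (transpose_mat v * v)"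
      using *(1) by (auto intro!: eq_matI simp: scalar_prod_def mult.commute)
    then show ?thesis unfolding B_def using * by (simp add: transpose_minus[of _ n n])
  qed
  ultimately have "B \<in> SymGL n" using BC by (simp add: SymGL_def GL_def)
  then show ?thesis using that LP c eq by blast
qed

end

section \<open>Character sums over Gram matrices\<close>

context nonsquare_setup
begin

definition gram_sum :: "'a mat \<Rightarrow> complex" where
  "gram_sum X = (\<Sum>h\<in>carrier_mat 2 (dim_row X). lam (mat_trace (X * gram e h)))"

text \<open>Cyclicity of the trace moves \<open>P\<close> onto the Gram matrix, where it becomes the
  bijective substitution of \<open>h * P\<close> for \<open>h\<close>.\<close>

lemma gram_sum_congruence:
  assumes X: "X \<in> carrier_mat m m" and P: "P \<in> GL m"
  shows "gram_sum (P * X * transpose_mat P) = gram_sum X"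
proof -
  note PC = GL_carrier[OF P]
  obtain R where R: "R \<in> GL m" "P * R = 1\<^sub>m m" "R * P = 1\<^sub>m m" using GL_inverse[OF P] .
  note RC = GL_carrier[OF R(1)]
  have tr: "mat_trace (P * X * transpose_mat P * gram e h) = mat_trace (X * gram e (h * P))"
    if h: "h \<in> carrier_mat 2 m" for h
  proof -
    note G = gram_carrier[OF h, of e]
    have "P * X * transpose_mat P * gram e h = P * (X * transpose_mat P * gram e h)"
      using PC X G by (simp add: assoc_mult_mat[of _ m m _ m _ m])
    also have "mat_trace \<dots> = mat_trace (X * transpose_mat P * gram e h * P)"
      using PC X G by (intro mat_trace_commute[of _ m m]) auto
    also have "X * transpose_mat P * gram e h * P = X * (transpose_mat P * gram e h * P)"
      using PC X G by (simp add: assoc_mult_mat[of _ m m _ m _ m])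
    also have "transpose_mat P * gram e h * P = gram e (h * P)" by (rule gram_mult[OF h PC, symmetric])
    finally show ?thesis .
  qed
  have "gram_sum (P * X * transpose_mat P) = (\<Sum>h\<in>carrier_mat 2 m. lam (mat_trace (X * gram e (h * P))))"
    unfolding gram_sum_def using PC by (intro sum.cong) (auto simp: tr)
  also have "\<dots> = (\<Sum>h\<in>carrier_mat 2 m. lam (mat_trace (X * gram e h)))"
    by (rule sum.reindex_bij_witness[of _ "\<lambda>h. h * R" "\<lambda>h. h * P"])
       (use PC RC R in \<open>auto simp: assoc_mult_mat[of _ 2 m _ m _ m]\<close>)
  finally show ?thesis using X by (simp add: gram_sum_def)
qed

lemma gram_sum_block_diag:
  assumes X: "X \<in> carrier_mat a a" and Y: "Y \<in> carrier_mat b b"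
  shows "gram_sum (four_block_mat X (0\<^sub>m a b) (0\<^sub>m b a) Y) = gram_sum X * gram_sum Y"
proof -
  let ?Z = "four_block_mat X (0\<^sub>m a b) (0\<^sub>m b a) Y"
  have Z: "?Z \<in> carrier_mat (a + b) (a + b)" by (rule four_block_carrier_mat[OF X Y])
  \<comment> \<open>The blocks without rows make this the horizontal concatenation of
    \<open>h\<close> and \<open>k\<close>; the zero off-diagonal blocks of \<open>?Z\<close> remove
    the mixed terms.\<close>
  have tr: "mat_trace (?Z * gram e (four_block_mat h k (0\<^sub>m 0 a) (0\<^sub>m 0 b))) =
      mat_trace (X * gram e h) + mat_trace (Y * gram e k)"
    if h: "h \<in> carrier_mat 2 a" and k: "k \<in> carrier_mat 2 b" for h k
  proof -
    have H: "four_block_mat h k (0\<^sub>m 0 a) (0\<^sub>m 0 b) \<in> carrier_mat 2 (a + b)"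
      using four_block_carrier_mat[of h 2 a "0\<^sub>m 0 b" 0 b] h by simp
    show ?thesis
      unfolding mat_trace_mult_gram[OF Z H] mat_trace_mult_gram[OF X h] mat_trace_mult_gram[OF Y k] sum_lessThan_add
      using X Y h k by (simp add: sum.distrib)
  qed
  have "gram_sum ?Z = (\<Sum>h\<in>carrier_mat (2 + 0) (a + b). lam (mat_trace (?Z * gram e h)))"
    by (simp only: gram_sum_def carrier_matD[OF Z] add_0_right)
  also have "\<dots> = (\<Sum>h\<in>carrier_mat 2 a. \<Sum>k\<in>carrier_mat 2 b. lam (mat_trace (X * gram e h)) * lam (mat_trace (Y * gram e k)))"
    unfolding sum_carrier_mat_blocks by (intro sum.cong refl) (simp add: carrier_mat_0 tr lam_add)
  also have "\<dots> = gram_sum X * gram_sum Y" using X Y by (simp add: gram_sum_def sum_product)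
  finally show ?thesis .
qed

lemma gram_sum_zero: "gram_sum (0\<^sub>m n n) = of_nat q ^ (2 * n)"
proof -
  have "gram_sum (0\<^sub>m n n) = (\<Sum>h\<in>(carrier_mat 2 n :: 'a mat set). 1)"
    unfolding gram_sum_def by (intro sum.cong) (auto simp: mat_trace_def left_mult_zero_mat[of _ n n])
  then show ?thesis by (simp add: card_carrier_mat q_def)
qed

lemma gram_sum_scalar:
  assumes "c \<noteq> 0"
  shows "gram_sum (c \<cdot>\<^sub>m 1\<^sub>m 1) = - of_nat q"
proof -
  have "gram_sum (c \<cdot>\<^sub>m 1\<^sub>m 1) = (\<Sum>h\<in>carrier_mat 2 1. lam (c * ((h $$ (0, 0))^2 - e * (h $$ (1, 0))^2)))"
    unfolding gram_sum_def
    by (intro sum.cong) (auto simp: mat_trace_mult_gram[of _ 1] power2_eq_square mult.assoc)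
  also have "\<dots> = (\<Sum>(x, y)\<in>UNIV \<times> UNIV. lam (c * (x^2 - e * y^2)))"
    by (rule sum.reindex_bij_witness[of _ "\<lambda>(x, y). mat 2 1 (\<lambda>(i, j). if i = 0 then x else y)"
          "\<lambda>h. (h $$ (0, 0), h $$ (1, 0))"])
       (auto intro!: eq_matI simp: less_2_cases_iff)
  also have "\<dots> = - of_nat q"
    using sum_lam_norm_form[OF assms] by (simp add: sum.cartesian_product)
  finally show ?thesis .
qed

text \<open>Each diagonal entry split off contributes \<open>- q\<close> whatever its square class,
  because the sum of the norm form is the same for all its nonzero multiples. So the sum depends on
  the size of \<open>A\<close> alone.\<close>

lemma gram_sum_SymGL:
  assumes "A \<in> SymGL n"
  shows "gram_sum A = (- of_nat q) ^ n"
  using assms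
proof (induction n arbitrary: A)
  case 0
  from SymGL_carrier[OF this] have "A = 0\<^sub>m 0 0" by (simp add: carrier_mat_0)
  then show ?case using gram_sum_zero[of 0] by simp
next
  case (Suc n)
  then have A: "A \<in> SymGL (1 + n)" by simp
  obtain P c B where *: "P \<in> GL (1 + n)" "c \<noteq> (0::'a)" "B \<in> SymGL n"
    "P * A * transpose_mat P = four_block_mat (c \<cdot>\<^sub>m 1\<^sub>m 1) (0\<^sub>m 1 n) (0\<^sub>m n 1) B"
    using SymGL_congruent_split[OF A] .
  have "gram_sum A = gram_sum (c \<cdot>\<^sub>m 1\<^sub>m 1) * gram_sum B"
    using gram_sum_congruence[OF SymGL_carrier[OF A] *(1)]
      gram_sum_block_diag[of "c \<cdot>\<^sub>m 1\<^sub>m 1" 1 B n] SymGL_carrier[OF *(3)] *(4) by simp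
  then show ?case using Suc.IH[OF *(3)] gram_sum_scalar[OF *(2)] by simp
qed

end

section \<open>The parabolic subgroup in block form\<close>

text \<open>Matrices are cut into blocks of sizes \<open>m\<close>, \<open>m\<close> and 2. Since
  the first two have size \<open>m\<close>, block \<open>p\<close> starts at index
  \<open>m * p\<close>, which is why a position inside a block is written
  \<open>i - m * blk_idx m i\<close>.\<close>

definition blk_idx :: "nat \<Rightarrow> nat \<Rightarrow> nat" where
  "blk_idx m i = (if i < m then 0 else if i < 2 * m then 1 else 2)"

definition blk_dim :: "nat \<Rightarrow> nat \<Rightarrow> nat" where
  "blk_dim m p = (if p < 2 then m else 2)"

definition blk_mat :: "nat \<Rightarrow> (nat \<Rightarrow> nat \<Rightarrow> 'a mat) \<Rightarrow> 'a mat" where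
  "blk_mat m X = mat (2 * m + 2) (2 * m + 2)
     (\<lambda>(i, j). X (blk_idx m i) (blk_idx m j) $$ (i - m * blk_idx m i, j - m * blk_idx m j))"

definition blk_carrier :: "nat \<Rightarrow> (nat \<Rightarrow> nat \<Rightarrow> 'a mat) set" where
  "blk_carrier m = {X. \<forall>p<3. \<forall>q<3. X p q \<in> carrier_mat (blk_dim m p) (blk_dim m q)}"

lemma blk_mat_carrier [simp]: "blk_mat m X \<in> carrier_mat (2 * m + 2) (2 * m + 2)"
  by (simp add: blk_mat_def)

lemma blk_idx_bounds:
  assumes "i < 2 * m + 2"
  shows "blk_idx m i < 3" "i - m * blk_idx m i < blk_dim m (blk_idx m i)"
  using assms by (auto simp: blk_idx_def blk_dim_def)

lemma sum_blk:
  "(\<Sum>k<2 * m + 2. F (blk_idx m k) (k - m * blk_idx m k)) = (\<Sum>p<3. \<Sum>k<blk_dim m p. F p k :: 'a::comm_monoid_add)"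
proof -
  have "2 * m + 2 = (m + m) + (2::nat)" by simp
  moreover have "(\<Sum>k<m. F (blk_idx m k) (k - m * blk_idx m k)) = (\<Sum>k<m. F 0 k)"
    by (intro sum.cong) (auto simp: blk_idx_def)
  moreover have "(\<Sum>k<m. F (blk_idx m (m + k)) (m + k - m * blk_idx m (m + k))) = (\<Sum>k<m. F 1 k)"
    by (intro sum.cong) (auto simp: blk_idx_def)
  moreover have "(\<Sum>k<2. F (blk_idx m (m + m + k)) (m + m + k - m * blk_idx m (m + m + k))) = (\<Sum>k<2. F 2 k)"
    by (intro sum.cong) (auto simp: blk_idx_def)
  ultimately show ?thesis
    by (simp only: sum_lessThan_add) (simp add: blk_dim_def numeral_3_eq_3 numeral_2_eq_2 add.assoc)
qed

lemma blk_mat_cong: "(\<And>p q. p < 3 \<Longrightarrow> q < 3 \<Longrightarrow> X p q = Y p q) \<Longrightarrow> blk_mat m X = blk_mat m Y"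
  unfolding blk_mat_def by (intro eq_matI) (auto simp: blk_idx_bounds)

lemma blk_mat_mult:
  assumes X: "X \<in> blk_carrier m" and Y: "Y \<in> blk_carrier m"
  shows "blk_mat m X * blk_mat m Y = blk_mat m (\<lambda>p q. X p 0 * Y 0 q + X p 1 * Y 1 q + X p 2 * Y 2 q :: 'a::comm_ring_1 mat)"
proof (rule eq_matI)
  fix i j assume "i < dim_row (blk_mat m (\<lambda>p q. X p 0 * Y 0 q + X p 1 * Y 1 q + X p 2 * Y 2 q))"
    "j < dim_col (blk_mat m (\<lambda>p q. X p 0 * Y 0 q + X p 1 * Y 1 q + X p 2 * Y 2 q))"
  then have ij: "i < 2 * m + 2" "j < 2 * m + 2" by (auto simp: blk_mat_def)
  define p q where "p = blk_idx m i" and "q = blk_idx m j"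
  define a b where "a = i - m * p" and "b = j - m * q"
  have pq: "p < 3" "q < 3" and ab: "a < blk_dim m p" "b < blk_dim m q"
    using blk_idx_bounds[OF ij(1)] blk_idx_bounds[OF ij(2)] by (auto simp: p_def q_def a_def b_def)
  have car: "X p r \<in> carrier_mat (blk_dim m p) (blk_dim m r)" "Y r q \<in> carrier_mat (blk_dim m r) (blk_dim m q)"
    if "r < 3" for r using X Y pq that by (auto simp: blk_carrier_def)
  have prod: "(X p r * Y r q) $$ (a, b) = (\<Sum>k<blk_dim m r. X p r $$ (a, k) * Y r q $$ (k, b))" if "r < 3" for r
    using car[OF that] ab by (simp add: scalar_prod_def lessThan_atLeast0)
  have "(blk_mat m X * blk_mat m Y) $$ (i, j) =
      (\<Sum>k<2 * m + 2. X p (blk_idx m k) $$ (a, k - m * blk_idx m k) * Y (blk_idx m k) q $$ (k - m * blk_idx m k, b))"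
    using ij by (simp add: blk_mat_def scalar_prod_def lessThan_atLeast0 p_def q_def a_def b_def del: sum.op_ivl_Suc)
  also have "\<dots> = (\<Sum>r<3. \<Sum>k<blk_dim m r. X p r $$ (a, k) * Y r q $$ (k, b))"
    by (rule sum_blk[where F = "\<lambda>r k. X p r $$ (a, k) * Y r q $$ (k, b)"])
  also have "\<dots> = (\<Sum>r<3. (X p r * Y r q) $$ (a, b))" by (intro sum.cong refl) (simp add: prod)
  also have "\<dots> = (X p 0 * Y 0 q + X p 1 * Y 1 q + X p 2 * Y 2 q) $$ (a, b)"
    using car[of 0] car[of 1] car[of 2] ab by (simp add: numeral_3_eq_3 numeral_2_eq_2)
  finally show "(blk_mat m X * blk_mat m Y) $$ (i, j) =
      blk_mat m (\<lambda>p q. X p 0 * Y 0 q + X p 1 * Y 1 q + X p 2 * Y 2 q) $$ (i, j)"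
    using ij by (simp add: blk_mat_def p_def q_def a_def b_def)
qed (auto simp: blk_mat_def)

lemma blk_mat_transpose:
  assumes X: "X \<in> blk_carrier m"
  shows "transpose_mat (blk_mat m X) = blk_mat m (\<lambda>p q. transpose_mat (X q p))"
proof (rule eq_matI)
  fix i j assume "i < dim_row (blk_mat m (\<lambda>p q. transpose_mat (X q p)))" "j < dim_col (blk_mat m (\<lambda>p q. transpose_mat (X q p)))"
  then have ij: "i < 2 * m + 2" "j < 2 * m + 2" by (auto simp: blk_mat_def)
  have "X (blk_idx m j) (blk_idx m i) \<in> carrier_mat (blk_dim m (blk_idx m j)) (blk_dim m (blk_idx m i))"
    using X blk_idx_bounds[OF ij(1)] blk_idx_bounds[OF ij(2)] by (auto simp: blk_carrier_def)
  then show "transpose_mat (blk_mat m X) $$ (i, j) = blk_mat m (\<lambda>p q. transpose_mat (X q p)) $$ (i, j)"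
    using ij blk_idx_bounds[OF ij(1)] blk_idx_bounds[OF ij(2)] by (auto simp: blk_mat_def)
qed (auto simp: blk_mat_def)

lemma blk_mat_index:
  assumes "p < 3" "q < 3" "a < blk_dim m p" "b < blk_dim m q"
  shows "blk_mat m X $$ (m * p + a, m * q + b) = X p q $$ (a, b)"
proof -
  have *: "blk_idx m (m * p + a) = p \<and> m * p + a < 2 * m + 2" if "p < 3" "a < blk_dim m p" for p a
  proof -
    have "p \<in> {0, 1, 2}" using that by auto
    then show ?thesis using that by (auto simp: blk_idx_def blk_dim_def)
  qed
  show ?thesis using *[OF assms(1,3)] *[OF assms(2,4)] by (simp add: blk_mat_def)
qed

lemma blk_mat_inject:
  assumes X: "X \<in> blk_carrier m" and Y: "Y \<in> blk_carrier m" and eq: "blk_mat m X = blk_mat m Y"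
    and pq: "p < 3" "q < 3"
  shows "X p q = Y p q"
proof (rule eq_matI)
  have car: "X p q \<in> carrier_mat (blk_dim m p) (blk_dim m q)" "Y p q \<in> carrier_mat (blk_dim m p) (blk_dim m q)"
    using X Y pq by (auto simp: blk_carrier_def)
  show "X p q $$ (a, b) = Y p q $$ (a, b)" if "a < dim_row (Y p q)" "b < dim_col (Y p q)" for a b
    using blk_mat_index[OF pq, of a m b X] blk_mat_index[OF pq, of a m b Y] that car by (simp add: eq)
  show "dim_row (X p q) = dim_row (Y p q)" "dim_col (X p q) = dim_col (Y p q)" using car by auto
qed

lemma mat_trace_blk_mat:
  assumes X: "X \<in> blk_carrier m"
  shows "mat_trace (blk_mat m X) = mat_trace (X 0 0) + mat_trace (X 1 1) + mat_trace (X 2 2)"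
proof -
  have car: "X p p \<in> carrier_mat (blk_dim m p) (blk_dim m p)" if "p < 3" for p
    using X that by (auto simp: blk_carrier_def)
  have "mat_trace (blk_mat m X) = (\<Sum>k<2 * m + 2. X (blk_idx m k) (blk_idx m k) $$ (k - m * blk_idx m k, k - m * blk_idx m k))"
    unfolding mat_trace_def by (intro sum.cong) (auto simp: blk_mat_def)
  also have "\<dots> = (\<Sum>p<3. \<Sum>k<blk_dim m p. X p p $$ (k, k))"
    by (rule sum_blk[where F = "\<lambda>p k. X p p $$ (k, k)"])
  also have "\<dots> = (\<Sum>p<3. mat_trace (X p p))"
    unfolding mat_trace_def by (intro sum.cong refl) (simp add: carrier_matD[OF car])
  finally show ?thesis by (simp add: numeral_3_eq_3 numeral_2_eq_2)
qed

definition tri :: "'a \<Rightarrow> 'a \<Rightarrow> 'a \<Rightarrow> nat \<Rightarrow> 'a" where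
  "tri a b c p = (if p = 0 then a else if p = 1 then b else c)"

lemma tri_simps [simp]: "tri a b c 0 = a" "tri a b c (Suc 0) = b" "tri a b c 1 = b" "tri a b c 2 = c"
  by (simp_all add: tri_def)

lemma less_three_cases: "(\<forall>p<3. P p) \<longleftrightarrow> P 0 \<and> P (Suc 0) \<and> P (2::nat)"
  by (auto simp: numeral_3_eq_3 numeral_2_eq_2 less_Suc_eq)

definition blk3 where
  "blk3 m a b c d e f g h i = blk_mat m (tri (tri a b c) (tri d e f) (tri g h i))"

definition blk3_dims where
  "blk3_dims m a b c d e f g h i \<longleftrightarrow>
    a \<in> carrier_mat m m \<and> b \<in> carrier_mat m m \<and> c \<in> carrier_mat m 2 \<and>
    d \<in> carrier_mat m m \<and> e \<in> carrier_mat m m \<and> f \<in> carrier_mat m 2 \<and>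
    g \<in> carrier_mat 2 m \<and> h \<in> carrier_mat 2 m \<and> i \<in> carrier_mat 2 2"

lemma blk3_dims: "blk3_dims m a b c d e f g h i \<longleftrightarrow> tri (tri a b c) (tri d e f) (tri g h i) \<in> blk_carrier m"
  by (auto simp: blk3_dims_def blk_carrier_def less_three_cases blk_dim_def)

lemma blk3_carrier [simp]: "blk3 m a b c d e f g h i \<in> carrier_mat (2 * m + 2) (2 * m + 2)"
  unfolding blk3_def by (rule blk_mat_carrier)

lemma blk3_mult:
  assumes "blk3_dims m a b c d e f g h i" "blk3_dims m a' b' c' d' e' f' g' h' i'"
  shows "blk3 m a b c d e f g h i * blk3 m a' b' c' d' e' f' g' h' i' =
    blk3 m (a * a' + b * d' + c * g') (a * b' + b * e' + c * h') (a * c' + b * f' + c * i')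
      (d * a' + e * d' + f * g') (d * b' + e * e' + f * h') (d * c' + e * f' + f * i')
      (g * a' + h * d' + i * g') (g * b' + h * e' + i * h') (g * c' + h * f' + i * i' :: 'a::comm_ring_1 mat)"
proof -
  have "\<forall>p<3. \<forall>q<3. tri (tri a b c) (tri d e f) (tri g h i) p 0 * tri (tri a' b' c') (tri d' e' f') (tri g' h' i') 0 q +
      tri (tri a b c) (tri d e f) (tri g h i) p 1 * tri (tri a' b' c') (tri d' e' f') (tri g' h' i') 1 q +
      tri (tri a b c) (tri d e f) (tri g h i) p 2 * tri (tri a' b' c') (tri d' e' f') (tri g' h' i') 2 q =
      tri (tri (a * a' + b * d' + c * g') (a * b' + b * e' + c * h') (a * c' + b * f' + c * i'))
       (tri (d * a' + e * d' + f * g') (d * b' + e * e' + f * h') (d * c' + e * f' + f * i'))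
       (tri (g * a' + h * d' + i * g') (g * b' + h * e' + i * h') (g * c' + h * f' + i * i')) p q"
    by (simp add: less_three_cases)
  then show ?thesis
    unfolding blk3_def blk_mat_mult[OF assms[unfolded blk3_dims]] by (intro blk_mat_cong) blast
qed

lemma blk3_transpose:
  assumes "blk3_dims m a b c d e f g h i"
  shows "transpose_mat (blk3 m a b c d e f g h i) =
    blk3 m (transpose_mat a) (transpose_mat d) (transpose_mat g) (transpose_mat b) (transpose_mat e) (transpose_mat h)
      (transpose_mat c) (transpose_mat f) (transpose_mat i)"
proof -
  have "\<forall>p<3. \<forall>q<3. transpose_mat (tri (tri a b c) (tri d e f) (tri g h i) q p) =
    tri (tri (transpose_mat a) (transpose_mat d) (transpose_mat g)) (tri (transpose_mat b) (transpose_mat e) (transpose_mat h))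
      (tri (transpose_mat c) (transpose_mat f) (transpose_mat i)) p q"
    by (simp add: less_three_cases)
  then show ?thesis
    unfolding blk3_def blk_mat_transpose[OF assms[unfolded blk3_dims]] by (intro blk_mat_cong) blast
qed

lemma blk3_inject:
  assumes "blk3_dims m a b c d e f g h i" "blk3_dims m a' b' c' d' e' f' g' h' i'"
  shows "blk3 m a b c d e f g h i = blk3 m a' b' c' d' e' f' g' h' i' \<longleftrightarrow>
    a = a' \<and> b = b' \<and> c = c' \<and> d = d' \<and> e = e' \<and> f = f' \<and> g = g' \<and> h = h' \<and> i = i'"
proof
  assume "blk3 m a b c d e f g h i = blk3 m a' b' c' d' e' f' g' h' i'"
  note inj = blk_mat_inject[OF assms[unfolded blk3_dims] this[unfolded blk3_def]]
  show "a = a' \<and> b = b' \<and> c = c' \<and> d = d' \<and> e = e' \<and> f = f' \<and> g = g' \<and> h = h' \<and> i = i'"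
    using inj[of 0 0] inj[of 0 1] inj[of 0 2] inj[of 1 0] inj[of 1 1] inj[of 1 2] inj[of 2 0] inj[of 2 1] inj[of 2 2]
    by simp
qed auto

lemma blk3_trace:
  assumes "blk3_dims m a b c d e f g h i"
  shows "mat_trace (blk3 m a b c d e f g h i) = mat_trace a + mat_trace e + mat_trace i"
  unfolding blk3_def mat_trace_blk_mat[OF assms[unfolded blk3_dims]] by simp

lemma blk3_eqI:
  assumes "M \<in> carrier_mat (2 * m + 2) (2 * m + 2)" "blk3_dims m a b c d e f g h i"
    and "\<And>p q k l. p < 3 \<Longrightarrow> q < 3 \<Longrightarrow> k < blk_dim m p \<Longrightarrow> l < blk_dim m q \<Longrightarrow>
      M $$ (m * p + k, m * q + l) = tri (tri a b c) (tri d e f) (tri g h i) p q $$ (k, l)"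
  shows "M = blk3 m a b c d e f g h i"
proof (rule eq_matI)
  fix i' j assume "i' < dim_row (blk3 m a b c d e f g h i)" "j < dim_col (blk3 m a b c d e f g h i)"
  then have ij: "i' < 2 * m + 2" "j < 2 * m + 2" by (auto simp: blk3_def blk_mat_def)
  have "m * blk_idx m k \<le> k" for k by (auto simp: blk_idx_def)
  then show "M $$ (i', j) = blk3 m a b c d e f g h i $$ (i', j)"
    using assms(3)[OF blk_idx_bounds(1)[OF ij(1)] blk_idx_bounds(1)[OF ij(2)] blk_idx_bounds(2)[OF ij(1)] blk_idx_bounds(2)[OF ij(2)]] ij
    by (simp add: blk3_def blk_mat_def)
qed (use assms(1) in \<open>auto simp: blk3_def blk_mat_def\<close>)

text \<open>The given matrices are nested two-by-two block matrices padded by blocks without rows or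
  columns; this translates the nesting into the three-by-three form.\<close>

lemma blk3_four_block:
  assumes "blk3_dims m a b c d e f g h i"
  shows "four_block_mat (four_block_mat a b d e) (four_block_mat c (0\<^sub>m m 0) f (0\<^sub>m m 0))
      (four_block_mat g h (0\<^sub>m 0 m) (0\<^sub>m 0 m)) i = blk3 m a b c d e f g h i" (is "?M = _")
proof (rule blk3_eqI[OF _ assms])
  note D = assms[unfolded blk3_dims_def]
  have "?M \<in> carrier_mat ((m + m) + 2) ((m + m) + 2)"
    by (intro four_block_carrier_mat) (use D in auto)
  then show "?M \<in> carrier_mat (2 * m + 2) (2 * m + 2)" by (simp only: mult_2)
  fix p q k l assume *: "p < 3" "q < (3::nat)" "k < blk_dim m p" "l < blk_dim m q"
  then have "p \<in> {0, 1, 2}" "q \<in> {0, 1, 2}" by auto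
  then show "?M $$ (m * p + k, m * q + l) = tri (tri a b c) (tri d e f) (tri g h i) p q $$ (k, l)"
    using * D by (elim insertE emptyE) (auto simp: blk_dim_def)
qed

lemma zero_mat_four_block:
  "0\<^sub>m (2 * m) 2 = four_block_mat (0\<^sub>m m 2) (0\<^sub>m m 0) (0\<^sub>m m 2) (0\<^sub>m m 0)"
  "0\<^sub>m 2 (2 * m) = four_block_mat (0\<^sub>m 2 m) (0\<^sub>m 2 m) (0\<^sub>m 0 m) (0\<^sub>m 0 m)"
  by (auto intro!: eq_matI)

lemma Jmat_blk3:
  "Jmat (Suc m) e = blk3 m (0\<^sub>m m m) (1\<^sub>m m) (0\<^sub>m m 2) (1\<^sub>m m) (0\<^sub>m m m) (0\<^sub>m m 2)
     (0\<^sub>m 2 m) (0\<^sub>m 2 m) (delta_eps e)"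
  unfolding Jmat_def diff_Suc_1 zero_mat_four_block by (rule blk3_four_block) (simp add: blk3_dims_def)

lemma levi_part_blk3:
  assumes "A \<in> carrier_mat m m" "B \<in> carrier_mat m m" "i \<in> carrier_mat 2 2"
  shows "levi_part (Suc m) A B i = blk3 m A (0\<^sub>m m m) (0\<^sub>m m 2) (0\<^sub>m m m) (transpose_mat B) (0\<^sub>m m 2)
     (0\<^sub>m 2 m) (0\<^sub>m 2 m) i"
  unfolding levi_part_def diff_Suc_1 zero_mat_four_block
  by (rule blk3_four_block) (use assms in \<open>simp add: blk3_dims_def\<close>)

lemma unip_part_blk3:
  assumes "B \<in> carrier_mat m m" "h \<in> carrier_mat 2 m"
  shows "unip_part (Suc m) e B h = blk3 m (1\<^sub>m m) B (- (transpose_mat h * delta_eps e)) (0\<^sub>m m m) (1\<^sub>m m) (0\<^sub>m m 2)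
     (0\<^sub>m 2 m) h (1\<^sub>m 2)"
  unfolding unip_part_def diff_Suc_1
  by (rule blk3_four_block) (use assms in \<open>simp add: blk3_dims_def\<close>)

lemma rho_mat_blk3:
  "rho_mat (Suc m) = blk3 m (1\<^sub>m m) (0\<^sub>m m m) (0\<^sub>m m 2) (0\<^sub>m m m) (1\<^sub>m m) (0\<^sub>m m 2)
     (0\<^sub>m 2 m) (0\<^sub>m 2 m) (delta_eps 1)"
proof (rule blk3_eqI)
  fix p q k l assume *: "p < 3" "q < (3::nat)" "k < blk_dim m p" "l < blk_dim m q"
  then have "p \<in> {0, 1, 2}" "q \<in> {0, 1, 2}" by auto
  then show "rho_mat (Suc m) $$ (m * p + k, m * q + l) =
    tri (tri (1\<^sub>m m) (0\<^sub>m m m) (0\<^sub>m m 2)) (tri (0\<^sub>m m m) (1\<^sub>m m) (0\<^sub>m m 2))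
      (tri (0\<^sub>m 2 m) (0\<^sub>m 2 m) (delta_eps 1)) p q $$ (k, l)"
    using * by (elim insertE emptyE) (auto simp: blk_dim_def rho_mat_def delta_eps_def)
qed (auto simp: rho_mat_def blk3_dims_def)

text \<open>In terms of these projections \<open>sigma_mat\<close> has \<open>tail_proj\<close> on
  and \<open>head_proj\<close> off the diagonal of its first two block rows, so the
  \<open>m\<close>-blocks need no further splitting until \<open>A\<close> itself is
  analysed.\<close>

definition head_proj :: "nat \<Rightarrow> nat \<Rightarrow> 'a::comm_ring_1 mat" where
  "head_proj r k = four_block_mat (1\<^sub>m r) (0\<^sub>m r k) (0\<^sub>m k r) (0\<^sub>m k k)"

definition tail_proj :: "nat \<Rightarrow> nat \<Rightarrow> 'a::comm_ring_1 mat" where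
  "tail_proj r k = four_block_mat (0\<^sub>m r r) (0\<^sub>m r k) (0\<^sub>m k r) (1\<^sub>m k)"

lemma proj_carrier [simp]:
  "head_proj r k \<in> carrier_mat (r + k) (r + k)" "tail_proj r k \<in> carrier_mat (r + k) (r + k)"
  unfolding head_proj_def tail_proj_def by (auto intro!: four_block_carrier_mat)

lemma sigma_mat_blk3:
  "sigma_mat (Suc (r + k)) r = blk3 (r + k) (tail_proj r k) (head_proj r k) (0\<^sub>m (r + k) 2)
     (head_proj r k) (tail_proj r k) (0\<^sub>m (r + k) 2) (0\<^sub>m 2 (r + k)) (0\<^sub>m 2 (r + k)) (1\<^sub>m 2)"
proof (rule blk3_eqI)
  define m where "m = r + k"
  fix p q a b assume *: "p < 3" "q < (3::nat)" "a < blk_dim (r + k) p" "b < blk_dim (r + k) q"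
  then have "p \<in> {0, 1, 2}" "q \<in> {0, 1, 2}" by auto
  then show "sigma_mat (Suc (r + k)) r $$ ((r + k) * p + a, (r + k) * q + b) =
    tri (tri (tail_proj r k) (head_proj r k) (0\<^sub>m (r + k) 2)) (tri (head_proj r k) (tail_proj r k) (0\<^sub>m (r + k) 2))
      (tri (0\<^sub>m 2 (r + k)) (0\<^sub>m 2 (r + k)) (1\<^sub>m 2)) p q $$ (a, b)"
    using * by (elim insertE emptyE)
      (auto simp: blk_dim_def sigma_mat_def sigma_perm_def head_proj_def tail_proj_def)
qed (auto simp: sigma_mat_def blk3_dims_def)

text \<open>Matrix of multiplication by \<open>a + b * sqrt e\<close> in the basis \<open>1\<close>,
  \<open>sqrt e\<close>, where \<open>p = (a, b)\<close>.\<close>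

definition so2 :: "'a::comm_ring_1 \<Rightarrow> 'a \<times> 'a \<Rightarrow> 'a mat" where
  "so2 e p = mat 2 2 (\<lambda>(i, j). if i = j then fst p else if i = 0 then e * snd p else snd p)"

lemma so2_carrier [simp]: "so2 e p \<in> carrier_mat 2 2"
  by (simp add: so2_def)

lemma det_2:
  assumes "A \<in> carrier_mat 2 2"
  shows "det A = A $$ (0, 0) * A $$ (1, 1) - A $$ (0, 1) * A $$ (1, 0)"
proof -
  have "det A = (\<Sum>i<2. A $$ (i, 0) * cofactor A i 0)"
    by (rule laplace_expansion_column[OF assms]) simp
  then show ?thesis
    using assms by (simp add: numeral_2_eq_2 cofactor_def det_single mat_delete_def)
qed

definition SO2 :: "'a::field \<Rightarrow> 'a mat set" where
  "SO2 e = SOminus 1 e"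

lemma SO2_iff:
  "i \<in> SO2 e \<longleftrightarrow> i \<in> carrier_mat 2 2 \<and> det i = 1 \<and> transpose_mat i * delta_eps e * i = delta_eps e"
proof -
  have "Jmat 1 e = delta_eps e"
    unfolding Jmat_def by (rule eq_matI) (auto simp: delta_eps_def)
  then show ?thesis by (auto simp: SO2_def SOminus_def Ominus_def)
qed

text \<open>The isometry relations and determinant one determine the second column from the first,
  which has norm one.\<close>

lemma SO2_eq:
  fixes e :: "'a::field"
  assumes "e \<noteq> 0"
  shows "SO2 e = so2 e ` {(a, b). a^2 - e * b^2 = 1}"
proof (intro equalityI subsetI)
  fix w assume "w \<in> SO2 e"
  then have w: "w \<in> carrier_mat 2 2" "det w = 1" "gram e w = delta_eps e"
    by (auto simp: SO2_iff gram_def)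
  define a x b y where "a = w $$ (0, 0)" and "x = w $$ (0, 1)" and "b = w $$ (1, 0)" and "y = w $$ (1, 1)"
  have g: "a * a - e * b * b = 1" "a * x - e * b * y = 0"
    using gram_index[OF w(1), of 0 0 e] gram_index[OF w(1), of 0 1 e]
    by (simp_all add: w(3) delta_eps_def a_def b_def x_def y_def)
  have d: "a * y - x * b = 1" using w(2) det_2[OF w(1)] by (simp add: a_def b_def x_def y_def)
  \<comment> \<open>Each entry of the second column is found by multiplying with
    \<open>1 = a * a - e * b * b\<close> and eliminating through the orthogonality of the columns
    and the determinant.\<close>
  have "y = y * (a * a - e * b * b)" using g by simp
  also have "\<dots> = a * (a * y) - b * (e * b * y)" by (simp add: algebra_simps)
  also have "\<dots> = a * (1 + x * b) - b * (a * x)" using d g by (simp add: algebra_simps)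
  also have "\<dots> = a" by (simp add: algebra_simps)
  finally have ya: "y = a" .
  have "x = x * (a * a - e * b * b)" using g by simp
  also have "\<dots> = a * (a * x) - e * b * (x * b)" by (simp add: algebra_simps)
  also have "\<dots> = a * (e * b * y) - e * b * (a * y - 1)" using d g by (simp add: algebra_simps)
  also have "\<dots> = e * b" by (simp add: algebra_simps)
  finally have xb: "x = e * b" .
  have "w = so2 e (a, b)"
    using w(1) ya xb by (intro eq_matI) (auto simp: so2_def less_2_cases_iff a_def b_def x_def y_def)
  then show "w \<in> so2 e ` {(a, b). a^2 - e * b^2 = 1}"
    using g by (intro image_eqI[of _ _ "(a, b)"]) (auto simp: power2_eq_square mult.assoc)
next
  fix w assume "w \<in> so2 e ` {(a, b). a^2 - e * b^2 = 1}"
  then obtain a b where w: "w = so2 e (a, b)" and ab: "a^2 - e * b^2 = 1" by auto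
  have wc: "w \<in> carrier_mat 2 2" by (simp add: w)
  have "gram e w = delta_eps e"
  proof (rule eq_matI)
    fix i j assume "i < dim_row (delta_eps e)" "j < dim_col (delta_eps e)"
    then have ij: "i < 2" "j < 2" by (auto simp: delta_eps_def)
    have "e * b * (e * b) - e * a * a = - e * (a^2 - e * b^2)" by (simp add: power2_eq_square algebra_simps)
    then have "e * b * (e * b) - e * a * a = - e" using ab by simp
    then show "gram e w $$ (i, j) = delta_eps e $$ (i, j)"
      using ij ab unfolding gram_index[OF wc ij]
      by (auto simp: w so2_def delta_eps_def less_2_cases_iff power2_eq_square algebra_simps)
  qed (use gram_carrier[OF wc, of e] in \<open>auto simp: delta_eps_def\<close>)
  moreover have "det w = 1" using ab unfolding det_2[OF wc] by (simp add: w so2_def power2_eq_square algebra_simps)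
  ultimately show "w \<in> SO2 e" using wc by (simp add: SO2_iff gram_def)
qed

lemma inj_so2: "inj (so2 e)"
proof (rule injI)
  fix p p' assume eq: "so2 e p = so2 e p'"
  have "so2 e p $$ (0, 0) = so2 e p' $$ (0, 0)" "so2 e p $$ (1, 0) = so2 e p' $$ (1, 0)" by (simp_all only: eq)
  then show "p = p'" by (simp add: so2_def prod_eq_iff)
qed

text \<open>The diagonal entries of \<open>so2 e p\<close> are equal, and the reflection changes the
  sign of one of them, so the reflected coset has trace zero throughout.\<close>

lemma mat_trace_so2: "mat_trace (so2 e p) = 2 * fst p" "mat_trace (delta_eps 1 * so2 e p) = 0"
  by (simp_all add: mat_trace_def so2_def delta_eps_def numeral_2_eq_2 scalar_prod_def)

context nonsquare_setup
begin

lemma sum_SO2: "(\<Sum>i\<in>SO2 e. F i) = (\<Sum>p\<in>norm1. F (so2 e p))"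
  unfolding SO2_eq[OF e_neq_0] norm1_def
  by (rule sum.reindex[unfolded o_def]) (rule inj_on_subset[OF inj_so2], simp)

lemma card_SO2: "card (SO2 e) = q + 1"
  using sum_SO2[of "\<lambda>_. 1::nat"] card_norm1 by simp

lemma sum_lam_SO2:
  assumes "\<beta> \<noteq> 0"
  shows "(\<Sum>i\<in>SO2 e. lam (\<beta> * mat_trace i)) = - kloosterman lam (\<beta>^2)"
  using sum_lam_norm1[of \<beta>] assms
  by (simp add: sum_SO2 mat_trace_so2 kloosterman_square add_eq_0_iff2)

lemma sum_lam_SO2_reflected:
  "(\<Sum>i\<in>SO2 e. lam (\<beta> * mat_trace (delta_eps 1 * i))) = of_nat q + 1"
  by (simp add: sum_SO2 mat_trace_so2 card_norm1)

end

section \<open>Laws for rectangular matrices\<close>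

lemma zero_mult_dim: "dim_row X = k \<Longrightarrow> 0\<^sub>m n k * X = (0\<^sub>m n (dim_col X) :: 'a::comm_ring_1 mat)"
  by (rule left_mult_zero_mat) auto

lemma mult_zero_dim: "dim_col X = k \<Longrightarrow> X * 0\<^sub>m k n = (0\<^sub>m (dim_row X) n :: 'a::comm_ring_1 mat)"
  by (rule right_mult_zero_mat) auto

lemma zero_add_dim: "dim_row X = a \<Longrightarrow> dim_col X = b \<Longrightarrow> 0\<^sub>m a b + X = (X :: 'a::comm_ring_1 mat)"
  by (rule left_add_zero_mat) auto

lemma add_zero_dim: "dim_row X = a \<Longrightarrow> dim_col X = b \<Longrightarrow> X + 0\<^sub>m a b = (X :: 'a::comm_ring_1 mat)"
  by (rule right_add_zero_mat) auto

lemma one_mult_dim: "dim_row X = k \<Longrightarrow> 1\<^sub>m k * X = (X :: 'a::comm_ring_1 mat)"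
  by (rule left_mult_one_mat) auto

lemma mult_one_dim: "dim_col X = k \<Longrightarrow> X * 1\<^sub>m k = (X :: 'a::comm_ring_1 mat)"
  by (rule right_mult_one_mat) auto

lemma mult_assoc_dim:
  "dim_col A = dim_row B \<Longrightarrow> dim_col B = dim_row C \<Longrightarrow> A * B * C = A * (B * (C :: 'a::comm_ring_1 mat))"
  by (rule assoc_mult_mat) auto

lemma transpose_mult_dim:
  "dim_col A = dim_row B \<Longrightarrow> transpose_mat (A * B) = transpose_mat B * transpose_mat (A :: 'a::comm_ring_1 mat)"
  by (rule transpose_mult) auto

lemma transpose_add_dim:
  "dim_row A = dim_row B \<Longrightarrow> dim_col A = dim_col B \<Longrightarrow> transpose_mat (A + B) = transpose_mat A + transpose_mat (B :: 'a::comm_ring_1 mat)"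
  by (rule transpose_add) auto

lemma mult_add_dim:
  "dim_col A = dim_row B \<Longrightarrow> dim_row B = dim_row C \<Longrightarrow> dim_col B = dim_col C \<Longrightarrow>
    A * (B + C) = A * B + A * (C :: 'a::comm_ring_1 mat)"
  by (rule mult_add_distrib_mat) auto

lemma add_mult_dim:
  "dim_row A = dim_row B \<Longrightarrow> dim_col A = dim_col B \<Longrightarrow> dim_col A = dim_row C \<Longrightarrow>
    (A + B) * C = A * C + B * (C :: 'a::comm_ring_1 mat)"
  by (rule add_mult_distrib_mat[of _ "dim_row A" "dim_col A"]) auto

lemma mult_uminus_dim: "dim_col A = dim_row B \<Longrightarrow> A * (- B) = - (A * (B :: 'a::comm_ring_1 mat))"
  by (rule uminus_mult_right_mat)

lemma add_uminus_dim: "dim_row A = a \<Longrightarrow> dim_col A = b \<Longrightarrow> - A + A = (0\<^sub>m a b :: 'a::comm_ring_1 mat)"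
  by (intro eq_matI) auto

lemma delta_eps_dim [simp]: "dim_row (delta_eps e) = 2" "dim_col (delta_eps e) = 2"
  by (simp_all add: delta_eps_def)

lemmas mat_dim_simps = zero_mult_dim mult_zero_dim zero_add_dim add_zero_dim one_mult_dim mult_one_dim

lemma right_inverse_imp_left:
  assumes "A \<in> carrier_mat n n" "B \<in> carrier_mat n n" "A * B = 1\<^sub>m n"
  shows "B * A = (1\<^sub>m n :: 'a::field mat)"
  using mat_mult_left_right_inverse[OF assms] .

section \<open>Isometries of parabolic shape\<close>

lemma blk3_eq: "a = a' \<Longrightarrow> b = b' \<Longrightarrow> c = c' \<Longrightarrow> d = d' \<Longrightarrow> e = e' \<Longrightarrow> f = f' \<Longrightarrow> g = g' \<Longrightarrow> h = h' \<Longrightarrow> i = i' \<Longrightarrow>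
  blk3 m a b c d e f g h i = blk3 m a' b' c' d' e' f' g' h' i'"
  by simp

text \<open>The first block column says that the totally isotropic span of the first
  \<open>m\<close> basis vectors is preserved, the second block row that its orthogonal complement
  is.\<close>

definition parabolic :: "nat \<Rightarrow> 'a::field mat \<Rightarrow> 'a mat \<Rightarrow> 'a mat \<Rightarrow> 'a mat \<Rightarrow> 'a mat \<Rightarrow> 'a mat \<Rightarrow> 'a mat" where
  "parabolic m A C E P S i = blk3 m A C E (0\<^sub>m m m) P (0\<^sub>m m 2) (0\<^sub>m 2 m) S i"

definition parabolic_dims :: "nat \<Rightarrow> 'a::field mat \<Rightarrow> 'a mat \<Rightarrow> 'a mat \<Rightarrow> 'a mat \<Rightarrow> 'a mat \<Rightarrow> 'a mat \<Rightarrow> bool" where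
  "parabolic_dims m A C E P S i \<longleftrightarrow> blk3_dims m A C E (0\<^sub>m m m :: 'a mat) P (0\<^sub>m m 2 :: 'a mat) (0\<^sub>m 2 m :: 'a mat) S i"

lemma parabolic_dimsD:
  assumes "parabolic_dims m A C E P S i"
  shows "dim_row A = m" "dim_col A = m" "dim_row C = m" "dim_col C = m" "dim_row E = m" "dim_col E = 2"
    "dim_row P = m" "dim_col P = m" "dim_row S = 2" "dim_col S = m" "dim_row i = 2" "dim_col i = 2"
  using assms by (auto simp: parabolic_dims_def blk3_dims_def)

lemma parabolic_form:
  assumes D: "parabolic_dims m A C E P S i"
  shows "transpose_mat (parabolic m A C E P S i) * Jmat (Suc m) e * parabolic m A C E P S i =
    blk3 m (0\<^sub>m m m) (transpose_mat A * P) (0\<^sub>m m 2)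
      (transpose_mat P * A) (transpose_mat P * C + transpose_mat C * P + transpose_mat S * delta_eps e * S)
      (transpose_mat P * E + transpose_mat S * delta_eps e * i)
      (0\<^sub>m 2 m) (transpose_mat E * P + transpose_mat i * delta_eps e * S) (transpose_mat i * delta_eps e * i)"
proof -
  note d = parabolic_dimsD[OF D]
  have T: "transpose_mat (parabolic m A C E P S i) =
    blk3 m (transpose_mat A) (0\<^sub>m m m) (0\<^sub>m m 2) (transpose_mat C) (transpose_mat P) (transpose_mat S)
      (transpose_mat E) (0\<^sub>m 2 m) (transpose_mat i)"
    unfolding parabolic_def
    by (subst blk3_transpose) (use D in \<open>auto simp: parabolic_dims_def\<close>)
  have TJ: "transpose_mat (parabolic m A C E P S i) * Jmat (Suc m) e =
    blk3 m (0\<^sub>m m m) (transpose_mat A) (0\<^sub>m m 2) (transpose_mat P) (transpose_mat C) (transpose_mat S * delta_eps e)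
      (0\<^sub>m 2 m) (transpose_mat E) (transpose_mat i * delta_eps e)"
    unfolding T Jmat_blk3
    by (subst blk3_mult) (use d in \<open>auto simp: blk3_dims_def mat_dim_simps intro!: blk3_eq\<close>)
  show ?thesis
    unfolding TJ unfolding parabolic_def
    by (subst blk3_mult) (use d in \<open>auto simp: blk3_dims_def mat_dim_simps intro!: blk3_eq\<close>)
qed

definition Qpar :: "nat \<Rightarrow> 'a::field \<Rightarrow> 'a mat set" where
  "Qpar m e = {w. transpose_mat w * Jmat (Suc m) e * w = Jmat (Suc m) e \<and>
     (\<exists>A C E P S i. parabolic_dims m A C E P S i \<and> w = parabolic m A C E P S i \<and> det i = 1)}"

lemma Jmat_dims: "blk3_dims m (0\<^sub>m m m) (1\<^sub>m m) (0\<^sub>m m 2) (1\<^sub>m m) (0\<^sub>m m m) (0\<^sub>m m 2)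
     (0\<^sub>m 2 m) (0\<^sub>m 2 m) (delta_eps e)"
  by (simp add: blk3_dims_def)

text \<open>The two off-diagonal blocks involving the last two coordinates are transposes of each
  other, so one equation covers both.\<close>

lemma parabolic_form_eq_Jmat_iff:
  assumes D: "parabolic_dims m A C E P S i"
  shows "transpose_mat (parabolic m A C E P S i) * Jmat (Suc m) e * parabolic m A C E P S i = Jmat (Suc m) e \<longleftrightarrow>
    transpose_mat A * P = 1\<^sub>m m \<and> transpose_mat P * A = 1\<^sub>m m \<and>
    transpose_mat P * C + transpose_mat C * P + transpose_mat S * delta_eps e * S = 0\<^sub>m m m \<and>
    transpose_mat P * E + transpose_mat S * delta_eps e * i = 0\<^sub>m m 2 \<and>
    transpose_mat i * delta_eps e * i = delta_eps e"
proof -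
  note d = parabolic_dimsD[OF D]
  have "transpose_mat E * P + transpose_mat i * delta_eps e * S =
    transpose_mat (transpose_mat P * E + transpose_mat S * delta_eps e * i)"
    using d by (simp add: transpose_add_dim transpose_mult_dim mult_assoc_dim)
  then have "transpose_mat P * E + transpose_mat S * delta_eps e * i = 0\<^sub>m m 2 \<Longrightarrow>
    transpose_mat E * P + transpose_mat i * delta_eps e * S = 0\<^sub>m 2 m" by simp
  then show ?thesis
    unfolding parabolic_form[OF D] unfolding Jmat_blk3
    by (subst blk3_inject[OF _ Jmat_dims]) (use d in \<open>auto simp: blk3_dims_def\<close>)
qed

definition Qelt :: "nat \<Rightarrow> 'a::field \<Rightarrow> 'a mat \<Rightarrow> 'a mat \<Rightarrow> 'a mat \<Rightarrow> 'a mat \<Rightarrow> 'a mat \<Rightarrow> 'a mat" where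
  "Qelt m e A A' B h i = parabolic m A (A * B) (- (A * (transpose_mat h * delta_eps e))) (transpose_mat A') (i * h) i"

definition Qdata :: "nat \<Rightarrow> 'a::field \<Rightarrow> 'a mat \<Rightarrow> 'a mat \<Rightarrow> 'a mat \<Rightarrow> 'a mat \<Rightarrow> 'a mat \<Rightarrow> bool" where
  "Qdata m e A A' B h i \<longleftrightarrow> A \<in> carrier_mat m m \<and> A' \<in> carrier_mat m m \<and> A * A' = 1\<^sub>m m \<and> A' * A = 1\<^sub>m m \<and>
     i \<in> SO2 e \<and> B \<in> carrier_mat m m \<and> h \<in> carrier_mat 2 m \<and> transpose_mat B + B + gram e h = 0\<^sub>m m m"

lemma Qdata_dims:
  assumes "Qdata m e A A' B h i"
  shows "parabolic_dims m A (A * B) (- (A * (transpose_mat h * delta_eps e))) (transpose_mat A') (i * h) i"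
  using assms by (auto simp: Qdata_def parabolic_dims_def blk3_dims_def SO2_iff)

lemma Qgrp_Suc: "Qgrp (Suc m) e = {Qelt m e A A' B h i | A A' B h i. Qdata m e A A' B h i}"
proof -
  have prod: "levi_part (Suc m) A A' i * unip_part (Suc m) e B h = Qelt m e A A' B h i" if "Qdata m e A A' B h i"
    for A A' B h i
  proof -
    have car: "A \<in> carrier_mat m m" "A' \<in> carrier_mat m m" "i \<in> carrier_mat 2 2" "B \<in> carrier_mat m m" "h \<in> carrier_mat 2 m"
      using that by (auto simp: Qdata_def SO2_iff)
    note d = car[THEN carrier_matD(1)] car[THEN carrier_matD(2)]
    show ?thesis
      unfolding levi_part_blk3[OF car(1-3)] unip_part_blk3[OF car(4,5)] Qelt_def parabolic_def
      by (subst blk3_mult) (use d in \<open>auto simp: blk3_dims_def mat_dim_simps mult_uminus_dim intro!: blk3_eq\<close>)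
  qed
  show ?thesis
  proof (intro equalityI subsetI)
    fix w assume "w \<in> Qgrp (Suc m) e"
    then obtain A A' i B h where "w = levi_part (Suc m) A A' i * unip_part (Suc m) e B h" "Qdata m e A A' B h i"
      unfolding Qgrp_def Qdata_def SO2_def gram_def diff_Suc_1 by blast
    then show "w \<in> {Qelt m e A A' B h i | A A' B h i. Qdata m e A A' B h i}" using prod by blast
  next
    fix w assume "w \<in> {Qelt m e A A' B h i | A A' B h i. Qdata m e A A' B h i}"
    then obtain A A' B h i where *: "w = Qelt m e A A' B h i" "Qdata m e A A' B h i" by blast
    then have "w = levi_part (Suc m) A A' i * unip_part (Suc m) e B h" using prod by simp
    then show "w \<in> Qgrp (Suc m) e"
      using *(2) unfolding Qgrp_def Qdata_def SO2_def gram_def diff_Suc_1 by blast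
  qed
qed

lemma Qelt_in_Qpar:
  assumes D: "Qdata m e A A' B h i"
  shows "Qelt m e A A' B h i \<in> Qpar m e"
proof -
  note dims = Qdata_dims[OF D]
  have car: "A \<in> carrier_mat m m" "A' \<in> carrier_mat m m" "i \<in> carrier_mat 2 2" "B \<in> carrier_mat m m" "h \<in> carrier_mat 2 m"
    and inv: "A * A' = 1\<^sub>m m" "A' * A = 1\<^sub>m m" and i: "det i = 1" "transpose_mat i * delta_eps e * i = delta_eps e"
    and B: "transpose_mat B + B + gram e h = 0\<^sub>m m m"
    using D by (auto simp: Qdata_def SO2_iff)
  note d = car[THEN carrier_matD(1)] car[THEN carrier_matD(2)]
  have inv': "A' * (A * X) = X" if "dim_row X = m" for X
    using that d inv by (simp add: one_mult_dim flip: mult_assoc_dim)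
  have invT: "transpose_mat A * transpose_mat A' = 1\<^sub>m m"
    using inv(2) d by (metis transpose_mult_dim transpose_one)
  have iX: "transpose_mat i * (delta_eps e * (i * X)) = delta_eps e * X" if "dim_row X = 2" for X
  proof -
    have "transpose_mat i * (delta_eps e * (i * X)) = (transpose_mat i * delta_eps e * i) * X"
      using d that by (simp add: mult_assoc_dim)
    then show ?thesis by (simp only: i(2))
  qed
  have "transpose_mat (transpose_mat A') * (A * B) + transpose_mat (A * B) * transpose_mat A' +
      transpose_mat (i * h) * delta_eps e * (i * h) = B + transpose_mat B + gram e h"
    using d by (simp add: inv' transpose_mult_dim mult_assoc_dim iX gram_def invT mult_one_dim)
  also have "\<dots> = transpose_mat B + B + gram e h" using car by (simp add: comm_add_mat[of B m m])
  finally have 1: "transpose_mat (transpose_mat A') * (A * B) + transpose_mat (A * B) * transpose_mat A' +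
      transpose_mat (i * h) * delta_eps e * (i * h) = 0\<^sub>m m m" using B by simp
  have i1: "transpose_mat i * (delta_eps e * i) = delta_eps e" using i(2) d by (simp add: mult_assoc_dim)
  have "transpose_mat (transpose_mat A') * - (A * (transpose_mat h * delta_eps e)) +
      transpose_mat (i * h) * delta_eps e * i = - (transpose_mat h * delta_eps e) + transpose_mat h * delta_eps e"
    using d by (simp add: inv' mult_uminus_dim transpose_mult_dim mult_assoc_dim i1)
  also have "\<dots> = 0\<^sub>m m 2" by (rule add_uminus_dim) (use d in auto)
  finally have 2: "transpose_mat (transpose_mat A') * - (A * (transpose_mat h * delta_eps e)) +
      transpose_mat (i * h) * delta_eps e * i = 0\<^sub>m m 2" .
  have "transpose_mat (Qelt m e A A' B h i) * Jmat (Suc m) e * Qelt m e A A' B h i = Jmat (Suc m) e"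
    unfolding Qelt_def parabolic_form_eq_Jmat_iff[OF dims]
    using 1 2 invT inv i by simp
  then show ?thesis unfolding Qpar_def Qelt_def using dims i(1) by blast
qed

text \<open>The data of the factorisation are forced: \<open>A'\<close> is the transpose of
  \<open>P\<close>, \<open>B\<close> is \<open>A' * C\<close>, and \<open>h\<close> is the inverse
  of \<open>i\<close> times \<open>S\<close>; the shape of \<open>E\<close> then follows from the
  isometry equation.\<close>

lemma Qpar_imp_Qelt:
  assumes "w \<in> Qpar m e"
  shows "\<exists>A A' B h i. w = Qelt m e A A' B h i \<and> Qdata m e A A' B h i"
proof -
  from assms obtain A C E P S i where D: "parabolic_dims m A C E P S i" and w: "w = parabolic m A C E P S i"
    and det: "det i = 1" and J: "transpose_mat w * Jmat (Suc m) e * w = Jmat (Suc m) e"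
    by (auto simp: Qpar_def)
  note d = parabolic_dimsD[OF D]
  have PA: "transpose_mat P * A = 1\<^sub>m m"
    and CS: "transpose_mat P * C + transpose_mat C * P + transpose_mat S * delta_eps e * S = 0\<^sub>m m m"
    and ES: "transpose_mat P * E + transpose_mat S * delta_eps e * i = 0\<^sub>m m 2"
    and i: "transpose_mat i * delta_eps e * i = delta_eps e"
    using J unfolding w parabolic_form_eq_Jmat_iff[OF D] by auto
  have ic: "i \<in> carrier_mat 2 2" using d by auto
  obtain k where k: "k \<in> carrier_mat 2 2" "i * k = 1\<^sub>m 2" "k * i = 1\<^sub>m 2"
    using obtain_inverse_mat[OF ic] det by auto
  have AP: "A * transpose_mat P = 1\<^sub>m m" by (rule right_inverse_imp_left[OF _ _ PA]) (use d in auto)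
  define B h where "B = transpose_mat P * C" and "h = k * S"
  have kd: "dim_row k = 2" "dim_col k = 2" using k by auto
  have dB: "dim_row B = m" "dim_col B = m" "dim_row h = 2" "dim_col h = m" using d kd by (auto simp: B_def h_def)
  have C: "C = A * B" unfolding B_def using d AP by (simp add: one_mult_dim flip: mult_assoc_dim)
  have S: "S = i * h" unfolding h_def using d kd k by (simp add: one_mult_dim flip: mult_assoc_dim)
  have i1: "transpose_mat i * (delta_eps e * i) = delta_eps e" using i d by (simp add: mult_assoc_dim)
  have Si: "transpose_mat S * delta_eps e * i = transpose_mat h * delta_eps e"
    unfolding S using d dB by (simp add: transpose_mult_dim mult_assoc_dim i1)
  have SS: "transpose_mat S * delta_eps e * S = gram e h"
  proof -
    have "transpose_mat S * delta_eps e * S = transpose_mat S * delta_eps e * i * h"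
      using d dB by (subst S(1)) (simp add: mult_assoc_dim transpose_mult_dim)
    then show ?thesis unfolding Si by (simp add: gram_def)
  qed
  have CP: "transpose_mat C * P = transpose_mat B" unfolding B_def using d by (simp add: transpose_mult_dim)
  have B: "transpose_mat B + B + gram e h = 0\<^sub>m m m"
    using CS unfolding CP SS B_def[symmetric] using dB by (subst comm_add_mat[of _ m m]) auto
  have E: "E = - (A * (transpose_mat h * delta_eps e))"
  proof -
    have "transpose_mat P * E = - (transpose_mat h * delta_eps e)"
    proof (rule eq_matI)
      fix a b assume "a < dim_row (- (transpose_mat h * delta_eps e))" "b < dim_col (- (transpose_mat h * delta_eps e))"
      then have ab: "a < m" "b < 2" using dB by auto
      have "(transpose_mat P * E + transpose_mat h * delta_eps e) $$ (a, b) = 0" using ES ab unfolding Si by simp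
      then have "(transpose_mat P * E) $$ (a, b) + (transpose_mat h * delta_eps e) $$ (a, b) = 0"
        using ab d dB by (subst (asm) index_add_mat) auto
      then show "(transpose_mat P * E) $$ (a, b) = (- (transpose_mat h * delta_eps e)) $$ (a, b)"
        using ab dB by (subst index_uminus_mat) (auto simp: eq_neg_iff_add_eq_0)
    qed (use d dB in auto)
    then have "A * (transpose_mat P * E) = - (A * (transpose_mat h * delta_eps e))"
      using d dB by (simp add: mult_uminus_dim)
    then show ?thesis using d AP by (simp add: one_mult_dim flip: mult_assoc_dim)
  qed
  have "w = Qelt m e A (transpose_mat P) B h i"
    unfolding w Qelt_def by (simp flip: C E S)
  moreover have "Qdata m e A (transpose_mat P) B h i"
    unfolding Qdata_def SO2_iff using d dB AP PA B i det by auto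
  ultimately show ?thesis by blast
qed

lemma Qgrp_eq_Qpar: "Qgrp (Suc m) e = Qpar m e"
  unfolding Qgrp_Suc using Qelt_in_Qpar Qpar_imp_Qelt by blast

lemma parabolic_mult:
  assumes D: "parabolic_dims m A C E P S i" and D': "parabolic_dims m A' C' E' P' S' i'"
  shows "parabolic m A C E P S i * parabolic m A' C' E' P' S' i' =
      parabolic m (A * A') (A * C' + C * P' + E * S') (A * E' + E * i') (P * P') (S * P' + i * S') (i * i')"
    and "parabolic_dims m (A * A') (A * C' + C * P' + E * S') (A * E' + E * i') (P * P') (S * P' + i * S') (i * i')"
proof -
  note d = parabolic_dimsD[OF D] parabolic_dimsD[OF D']
  show "parabolic m A C E P S i * parabolic m A' C' E' P' S' i' =
      parabolic m (A * A') (A * C' + C * P' + E * S') (A * E' + E * i') (P * P') (S * P' + i * S') (i * i')"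
    unfolding parabolic_def blk3_mult[OF D[unfolded parabolic_dims_def] D'[unfolded parabolic_dims_def]]
    by (intro blk3_eq) (use d in \<open>auto simp: mat_dim_simps\<close>)
  show "parabolic_dims m (A * A') (A * C' + C * P' + E * S') (A * E' + E * i') (P * P') (S * P' + i * S') (i * i')"
    unfolding parabolic_dims_def blk3_dims_def using d by auto
qed

lemma blk3_dim [simp]:
  "dim_row (blk3 m a b c d e f g h i) = 2 * m + 2" "dim_col (blk3 m a b c d e f g h i) = 2 * m + 2"
  by (simp_all add: blk3_def blk_mat_def)

lemma Jmat_dim [simp]: "dim_row (Jmat (Suc m) e) = 2 * m + 2" "dim_col (Jmat (Suc m) e) = 2 * m + 2"
  unfolding Jmat_blk3 by (rule blk3_dim)+

lemma Qpar_dim: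
  assumes "w \<in> Qpar m e"
  shows "dim_row w = 2 * m + 2" "dim_col w = 2 * m + 2"
  using assms by (auto simp: Qpar_def parabolic_def)

lemma isometry_mult:
  assumes "transpose_mat v * J * v = J" "transpose_mat w * J * w = (J :: 'a::comm_ring_1 mat)"
    and "v \<in> carrier_mat N N" "w \<in> carrier_mat N N" "J \<in> carrier_mat N N"
  shows "transpose_mat (v * w) * J * (v * w) = J"
proof -
  have d: "dim_row v = N" "dim_col v = N" "dim_row w = N" "dim_col w = N" "dim_row J = N" "dim_col J = N"
    using assms by auto
  have "transpose_mat (v * w) * J * (v * w) = transpose_mat w * (transpose_mat v * J * v) * w"
    using d by (simp add: transpose_mult_dim mult_assoc_dim)
  then show ?thesis by (simp only: assms)
qed

lemma Qpar_carrier: "w \<in> Qpar m e \<Longrightarrow> w \<in> carrier_mat (2 * m + 2) (2 * m + 2)"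
  using Qpar_dim[of w m e] unfolding carrier_mat_def by blast

lemma Jmat_carrier: "Jmat (Suc m) e \<in> carrier_mat (2 * m + 2) (2 * m + 2)"
  unfolding Jmat_blk3 by (rule blk3_carrier)

lemma Qpar_mult:
  assumes v: "v \<in> Qpar m e" and w: "w \<in> Qpar m e"
  shows "v * w \<in> Qpar m e"
proof -
  obtain A C E P S i where D: "parabolic_dims m A C E P S i" and v': "v = parabolic m A C E P S i" "det i = 1"
    using v unfolding Qpar_def by blast
  obtain A' C' E' P' S' i' where D': "parabolic_dims m A' C' E' P' S' i'" and w': "w = parabolic m A' C' E' P' S' i'" "det i' = 1"
    using w unfolding Qpar_def by blast
  have car: "i \<in> carrier_mat 2 2" "i' \<in> carrier_mat 2 2"
    using D D' by (auto simp: parabolic_dims_def blk3_dims_def)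
  have "det (i * i') = 1"
    unfolding det_mult[OF car] v'(2) w'(2) by simp
  moreover have "transpose_mat (v * w) * Jmat (Suc m) e * (v * w) = Jmat (Suc m) e"
    by (rule isometry_mult[OF _ _ Qpar_carrier[OF v] Qpar_carrier[OF w] Jmat_carrier])
       (use v w in \<open>simp_all only: Qpar_def mem_Collect_eq\<close>)
  ultimately show ?thesis
    using parabolic_mult[OF D D'] unfolding v' w' Qpar_def by blast
qed

lemma blk3_one:
  "blk3 m (1\<^sub>m m) (0\<^sub>m m m) (0\<^sub>m m 2) (0\<^sub>m m m) (1\<^sub>m m) (0\<^sub>m m 2) (0\<^sub>m 2 m) (0\<^sub>m 2 m) (1\<^sub>m 2) = 1\<^sub>m (2 * m + 2)"
proof (rule blk3_eqI[symmetric])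
  fix p q k l assume *: "p < 3" "q < (3::nat)" "k < blk_dim m p" "l < blk_dim m q"
  then have "p \<in> {0, 1, 2}" "q \<in> {0, 1, 2}" by auto
  then show "1\<^sub>m (2 * m + 2) $$ (m * p + k, m * q + l) =
    tri (tri (1\<^sub>m m) (0\<^sub>m m m) (0\<^sub>m m 2)) (tri (0\<^sub>m m m) (1\<^sub>m m) (0\<^sub>m m 2))
    (tri (0\<^sub>m 2 m) (0\<^sub>m 2 m) (1\<^sub>m 2)) p q $$ (k, l)"
    using * by (elim insertE emptyE) (auto simp: blk_dim_def)
qed (auto simp: blk3_dims_def)

lemma Qpar_one: "1\<^sub>m (2 * m + 2) \<in> Qpar m e"
proof -
  have eq: "1\<^sub>m (2 * m + 2) = parabolic m (1\<^sub>m m) (0\<^sub>m m m) (0\<^sub>m m 2) (1\<^sub>m m) (0\<^sub>m 2 m) (1\<^sub>m 2)"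
    unfolding parabolic_def blk3_one ..
  have "transpose_mat (1\<^sub>m (2 * m + 2)) * Jmat (Suc m) e * 1\<^sub>m (2 * m + 2) = Jmat (Suc m) e"
    using Jmat_carrier[of m e] by (simp add: mat_dim_simps)
  moreover have "parabolic_dims m (1\<^sub>m m) (0\<^sub>m m m) (0\<^sub>m m 2) (1\<^sub>m m) (0\<^sub>m 2 m) (1\<^sub>m 2)"
    by (simp add: parabolic_dims_def blk3_dims_def)
  ultimately show ?thesis unfolding Qpar_def using eq det_one by blast
qed

text \<open>\<open>K\<close> inverts the form, so by the isometry equation
  \<open>K * transpose_mat w * Jmat (Suc m) e\<close> undoes \<open>w\<close>;
  \<open>e \<noteq> 0\<close> enters as nondegeneracy.\<close>

lemma Qpar_left_inverse:
  assumes w: "w \<in> Qpar m e" and e: "e \<noteq> 0"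
  shows "\<exists>L\<in>carrier_mat (2 * m + 2) (2 * m + 2). L * w = 1\<^sub>m (2 * m + 2)"
proof -
  define K where "K = blk3 m (0\<^sub>m m m) (1\<^sub>m m) (0\<^sub>m m 2) (1\<^sub>m m) (0\<^sub>m m m) (0\<^sub>m m 2)
     (0\<^sub>m 2 m) (0\<^sub>m 2 m) (delta_eps (inverse e))"
  have dd: "delta_eps (inverse e) * delta_eps e = 1\<^sub>m 2"
    using e by (intro eq_matI) (auto simp: delta_eps_def scalar_prod_def numeral_2_eq_2 less_2_cases_iff)
  have "K * Jmat (Suc m) e = blk3 m (1\<^sub>m m) (0\<^sub>m m m) (0\<^sub>m m 2) (0\<^sub>m m m) (1\<^sub>m m) (0\<^sub>m m 2)
     (0\<^sub>m 2 m) (0\<^sub>m 2 m) (1\<^sub>m 2)"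
    unfolding K_def Jmat_blk3 blk3_mult[OF Jmat_dims Jmat_dims]
    by (intro blk3_eq) (auto simp: mat_dim_simps dd)
  also have "\<dots> = 1\<^sub>m (2 * m + 2)" by (rule blk3_one)
  finally have KJ: "K * Jmat (Suc m) e = 1\<^sub>m (2 * m + 2)" .
  have K: "dim_row K = 2 * m + 2" "dim_col K = 2 * m + 2" by (simp_all add: K_def)
  note d = Qpar_dim[OF w] K
  have "K * transpose_mat w * Jmat (Suc m) e * w = K * (transpose_mat w * Jmat (Suc m) e * w)"
    using d by (simp add: mult_assoc_dim)
  also have "\<dots> = 1\<^sub>m (2 * m + 2)" using w KJ by (simp add: Qpar_def)
  finally show ?thesis using d by (intro bexI[of _ "K * transpose_mat w * Jmat (Suc m) e"]) auto
qed

section \<open>Double cosets and character sums\<close>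

text \<open>Closure under inverses is not assumed: left multiplication is injective on a finite
  set closed under multiplication, so it permutes the set.\<close>
locale mat_group =
  fixes Q :: "'a::field mat set" and N :: nat
  assumes fin: "finite Q" and car: "\<And>x. x \<in> Q \<Longrightarrow> x \<in> carrier_mat N N"
    and one: "1\<^sub>m N \<in> Q" and mult: "\<And>x y. x \<in> Q \<Longrightarrow> y \<in> Q \<Longrightarrow> x * y \<in> Q"
    and left_inv: "\<And>x. x \<in> Q \<Longrightarrow> \<exists>L\<in>carrier_mat N N. L * x = 1\<^sub>m N"
begin

lemma dims: "x \<in> Q \<Longrightarrow> dim_row x = N" "x \<in> Q \<Longrightarrow> dim_col x = N"
  using car by auto

lemma bij_left_mult:
  assumes x: "x \<in> Q"
  shows "bij_betw (\<lambda>y. x * y) Q Q"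
proof -
  obtain L where L: "L \<in> carrier_mat N N" "L * x = 1\<^sub>m N" using left_inv[OF x] by blast
  have "L * (x * y) = y" if "y \<in> Q" for y
    using L dims[OF x] dims[OF that] by (simp add: one_mult_dim flip: mult_assoc_dim)
  then have "inj_on (\<lambda>y. x * y) Q" by (rule inj_on_inverseI)
  moreover have "(\<lambda>y. x * y) ` Q \<subseteq> Q" using mult x by blast
  ultimately show ?thesis using endo_inj_surj[OF fin] by (simp add: bij_betw_def)
qed

lemma inverse_ex:
  assumes x: "x \<in> Q"
  shows "\<exists>y\<in>Q. x * y = 1\<^sub>m N \<and> y * x = 1\<^sub>m N"
proof -
  obtain y where y: "y \<in> Q" "x * y = 1\<^sub>m N"
    using bij_left_mult[OF x] one by (metis (no_types, lifting) bij_betw_def imageE)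
  then show ?thesis using right_inverse_imp_left[OF car[OF x] car[OF y(1)]] by blast
qed

text \<open>Since \<open>s\<close> is its own inverse, two factorisations of one element differ by
  some \<open>w\<close> in \<open>Q\<close> whose conjugate is also in \<open>Q\<close>: the pairs
  are \<open>x0 * (s * w * s)\<close> with the inverse of \<open>w\<close> times \<open>y0\<close>.
  All fibres therefore have the same size.\<close>

lemma card_double_coset_fibre:
  assumes s: "s \<in> carrier_mat N N" "s * s = 1\<^sub>m N" and x0: "x0 \<in> Q" and y0: "y0 \<in> Q"
  shows "card {p \<in> Q \<times> Q. fst p * s * snd p = x0 * s * y0} = card {w \<in> Q. s * w * s \<in> Q}"
proof -
  have sd: "dim_row s = N" "dim_col s = N" using s by auto
  have ss: "s * (s * z) = z" if "dim_row z = N" for z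
    using that s(2) sd by (simp add: one_mult_dim flip: mult_assoc_dim)
  obtain ginv where ginv_all: "\<forall>x\<in>Q. ginv x \<in> Q \<and> x * ginv x = 1\<^sub>m N \<and> ginv x * x = 1\<^sub>m N"
    using inverse_ex by metis
  then have ginv: "ginv x \<in> Q" "x * ginv x = 1\<^sub>m N" "ginv x * x = 1\<^sub>m N" if "x \<in> Q" for x
    using that by blast+
  have invz: "x * (ginv x * z) = z" "ginv x * (x * z) = z" if "x \<in> Q" "dim_row z = N" for x z
    using that ginv[OF that(1)] dims[OF that(1)] dims[OF ginv(1)[OF that(1)]]
    by (simp_all add: one_mult_dim flip: mult_assoc_dim)
  note assoc = mult_assoc_dim
  have "bij_betw (\<lambda>w. (x0 * (s * w * s), ginv w * y0)) {w \<in> Q. s * w * s \<in> Q} {p \<in> Q \<times> Q. fst p * s * snd p = x0 * s * y0}"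
  proof (rule bij_betw_byWitness[of _ "\<lambda>p. y0 * ginv (snd p)"])
    show "\<forall>w\<in>{w \<in> Q. s * w * s \<in> Q}. y0 * ginv (snd (x0 * (s * w * s), ginv w * y0)) = w"
    proof
      fix w assume "w \<in> {w \<in> Q. s * w * s \<in> Q}"
      then have w: "w \<in> Q" by simp
      define u where "u = ginv w * y0"
      have u: "u \<in> Q" unfolding u_def using mult ginv w y0 by blast
      have "w * u = y0" unfolding u_def using invz(1)[OF w] dims[OF y0] by simp
      then have "y0 * ginv u = w * (u * ginv u)"
        using dims w u ginv(1)[OF u] by (simp flip: assoc)
      also have "\<dots> = w" using ginv(2)[OF u] dims w by (simp add: mult_one_dim)
      finally show "y0 * ginv (snd (x0 * (s * w * s), ginv w * y0)) = w" by (simp add: u_def)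
    qed
    show "(\<lambda>w. (x0 * (s * w * s), ginv w * y0)) ` {w \<in> Q. s * w * s \<in> Q} \<subseteq> {p \<in> Q \<times> Q. fst p * s * snd p = x0 * s * y0}"
    proof (rule image_subsetI)
      fix w assume "w \<in> {w \<in> Q. s * w * s \<in> Q}"
      then have w: "w \<in> Q" "s * w * s \<in> Q" by auto
      have "x0 * (s * w * s) * s * (ginv w * y0) = x0 * s * y0"
        using dims[OF w(1)] dims[OF x0] dims[OF y0] dims[OF ginv(1)[OF w(1)]] sd
        by (simp add: assoc ss invz(1)[OF w(1)])
      then show "(x0 * (s * w * s), ginv w * y0) \<in> {p \<in> Q \<times> Q. fst p * s * snd p = x0 * s * y0}"
        using mult w x0 y0 ginv by simp
    qed
    have key: "s * (y0 * ginv y) * s = ginv x0 * x" if "x \<in> Q" "y \<in> Q" "x * s * y = x0 * s * y0" for x y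
    proof -
      note d = dims[OF that(1)] dims[OF that(2)] dims[OF x0] dims[OF y0] dims[OF ginv(1)[OF x0]] dims[OF ginv(1)[OF that(2)]] sd
      have "s * (y0 * ginv y) * s = ginv x0 * (x0 * s * y0) * ginv y * s"
        using d by (simp add: assoc invz(2)[OF x0])
      also have "\<dots> = ginv x0 * (x * s * y) * ginv y * s" by (simp only: that(3))
      also have "\<dots> = ginv x0 * x"
        using d s(2) by (simp add: assoc invz(1)[OF that(2)] mult_one_dim)
      finally show ?thesis .
    qed
    show "(\<lambda>p. y0 * ginv (snd p)) ` {p \<in> Q \<times> Q. fst p * s * snd p = x0 * s * y0} \<subseteq> {w \<in> Q. s * w * s \<in> Q}"
      using key mult ginv x0 y0 by auto
    show "\<forall>p\<in>{p \<in> Q \<times> Q. fst p * s * snd p = x0 * s * y0}.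
      (x0 * (s * (y0 * ginv (snd p)) * s), ginv (y0 * ginv (snd p)) * y0) = p"
    proof
      fix p assume "p \<in> {p \<in> Q \<times> Q. fst p * s * snd p = x0 * s * y0}"
      moreover obtain x y where p: "p = (x, y)" by (cases p)
      ultimately have xy: "x \<in> Q" "y \<in> Q" "x * s * y = x0 * s * y0" by auto
      define u where "u = y0 * ginv y"
      have u: "u \<in> Q" unfolding u_def using mult ginv xy y0 by blast
      note d = dims[OF xy(1)] dims[OF xy(2)] dims[OF y0] dims[OF ginv(1)[OF xy(2)]] dims[OF u] dims[OF ginv(1)[OF u]]
      have "u * y = y0" unfolding u_def using d ginv(3)[OF xy(2)] by (simp add: assoc mult_one_dim)
      then have "ginv u * y0 = y" using invz(2)[OF u] d by metis
      moreover have "x0 * (s * u * s) = x" unfolding u_def using key[OF xy(1,2)] xy(3) invz(1)[OF x0] d by simp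
      ultimately show "(x0 * (s * (y0 * ginv (snd p)) * s), ginv (y0 * ginv (snd p)) * y0) = p"
        by (simp add: u_def p)
    qed
  qed
  then show ?thesis by (rule bij_betw_same_card[symmetric])
qed

lemma sum_double_coset:
  assumes s: "s \<in> carrier_mat N N" "s * s = 1\<^sub>m N"
  shows "(\<Sum>x\<in>Q. \<Sum>y\<in>Q. F (x * s * y)) =
    of_nat (card {w \<in> Q. s * w * s \<in> Q}) * (\<Sum>g\<in>{x * s * y | x y. x \<in> Q \<and> y \<in> Q}. F g :: 'b::comm_semiring_1)"
proof -
  let ?D = "{x * s * y | x y. x \<in> Q \<and> y \<in> Q}"
  have D: "?D = (\<lambda>p. fst p * s * snd p) ` (Q \<times> Q)" by force
  have "(\<Sum>x\<in>Q. \<Sum>y\<in>Q. F (x * s * y)) = (\<Sum>p\<in>Q \<times> Q. F (fst p * s * snd p))"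
    by (simp add: sum.cartesian_product split_def)
  also have "\<dots> = (\<Sum>g\<in>?D. \<Sum>p\<in>{p \<in> Q \<times> Q. fst p * s * snd p = g}. F (fst p * s * snd p))"
    unfolding D by (rule sum.image_gen) (simp add: fin)
  also have "\<dots> = (\<Sum>g\<in>?D. of_nat (card {w \<in> Q. s * w * s \<in> Q}) * F g)"
  proof (rule sum.cong[OF refl])
    fix g assume "g \<in> ?D"
    then obtain x0 y0 where "g = x0 * s * y0" "x0 \<in> Q" "y0 \<in> Q" by blast
    then have "card {p \<in> Q \<times> Q. fst p * s * snd p = g} = card {w \<in> Q. s * w * s \<in> Q}"
      using card_double_coset_fibre[OF s] by simp
    then show "(\<Sum>p\<in>{p \<in> Q \<times> Q. fst p * s * snd p = g}. F (fst p * s * snd p)) =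
      of_nat (card {w \<in> Q. s * w * s \<in> Q}) * F g" by simp
  qed
  finally show ?thesis by (simp add: sum_distrib_left)
qed

text \<open>Cyclicity of the trace absorbs the right-hand factor into the left-hand one.\<close>
lemma sum_trace_double_coset:
  assumes s: "s \<in> carrier_mat N N"
    and \<rho>: "\<rho> \<in> carrier_mat N N" "\<rho> * \<rho> = 1\<^sub>m N" "\<And>y. y \<in> Q \<Longrightarrow> \<rho> * y * \<rho> \<in> Q"
  shows "(\<Sum>x\<in>Q. \<Sum>y\<in>Q. f (mat_trace (\<rho> * (x * s * y)))) =
    of_nat (card Q) * (\<Sum>x\<in>Q. f (mat_trace (\<rho> * x * s)) :: 'b::comm_semiring_1)"
proof -
  have sd: "dim_row s = N" "dim_col s = N" "dim_row \<rho> = N" "dim_col \<rho> = N" using s \<rho> by auto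
  have \<rho>\<rho>: "\<rho> * (\<rho> * z) = z" if "dim_row z = N" for z
    using that \<rho>(2) sd by (simp add: one_mult_dim flip: mult_assoc_dim)
  have "(\<Sum>x\<in>Q. f (mat_trace (\<rho> * (x * s * y)))) = (\<Sum>x\<in>Q. f (mat_trace (\<rho> * x * s)))" if y: "y \<in> Q" for y
  proof -
    have "(\<Sum>x\<in>Q. f (mat_trace (\<rho> * (x * s * y)))) = (\<Sum>x\<in>Q. f (mat_trace (\<rho> * (\<rho> * y * \<rho> * x) * s)))"
    proof (rule sum.cong[OF refl])
      fix x assume x: "x \<in> Q"
      note d = dims[OF x] dims[OF y] sd
      have "mat_trace (\<rho> * (x * s * y)) = mat_trace (\<rho> * (x * s) * y)"
        using d by (simp add: mult_assoc_dim)
      also have "\<dots> = mat_trace (y * (\<rho> * (x * s)))"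
        by (rule mat_trace_commute[of _ N N]) (use d in auto)
      also have "y * (\<rho> * (x * s)) = \<rho> * (\<rho> * y * \<rho> * x) * s"
        using d by (simp add: mult_assoc_dim \<rho>\<rho>)
      finally show "f (mat_trace (\<rho> * (x * s * y))) = f (mat_trace (\<rho> * (\<rho> * y * \<rho> * x) * s))" by simp
    qed
    also have "\<dots> = (\<Sum>x\<in>Q. f (mat_trace (\<rho> * x * s)))"
      by (rule sum.reindex_bij_betw[OF bij_left_mult[OF \<rho>(3)[OF y]]])
    finally show ?thesis .
  qed
  then show ?thesis by (subst sum.swap) simp
qed

end

lemma mat_group_Qpar:
  fixes e :: "'a::{field,finite}"
  assumes "e \<noteq> 0"
  shows "mat_group (Qpar m e) (2 * m + 2)"
proof
  show "finite (Qpar m e)" by (rule finite_subset[OF _ finite_carrier_mat]) (use Qpar_carrier in blast)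
qed (use Qpar_carrier Qpar_one Qpar_mult Qpar_left_inverse assms in auto)

text \<open>An inverse given as a function of \<open>A\<close>, so that elements of \<open>Q\<close>
  can be indexed by \<open>A\<close> without carrying the inverse as a second parameter.\<close>

definition minv :: "nat \<Rightarrow> 'a::field mat \<Rightarrow> 'a mat" where
  "minv n A = (SOME B. B \<in> carrier_mat n n \<and> A * B = 1\<^sub>m n \<and> B * A = 1\<^sub>m n)"

lemma minv:
  assumes "A \<in> GL n"
  shows "minv n A \<in> carrier_mat n n" "A * minv n A = 1\<^sub>m n" "minv n A * A = 1\<^sub>m n"
proof -
  obtain B where "B \<in> GL n" "A * B = 1\<^sub>m n" "B * A = 1\<^sub>m n" using GL_inverse[OF assms] .
  then have "\<exists>B. B \<in> carrier_mat n n \<and> A * B = 1\<^sub>m n \<and> B * A = 1\<^sub>m n" using GL_carrier by blast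
  from someI_ex[OF this] show "minv n A \<in> carrier_mat n n" "A * minv n A = 1\<^sub>m n" "minv n A * A = 1\<^sub>m n"
    unfolding minv_def by auto
qed

lemma minv_unique:
  assumes A: "A \<in> GL n" and B: "B \<in> carrier_mat n n" "A * B = 1\<^sub>m n"
  shows "minv n A = B"
proof -
  note m = minv[OF A]
  have d: "dim_row (minv n A) = n" "dim_col (minv n A) = n" "dim_row A = n" "dim_col A = n" "dim_row B = n" "dim_col B = n"
    using m(1) GL_carrier[OF A] B by auto
  have "minv n A * (A * B) = B" using d m(3) by (simp add: one_mult_dim flip: mult_assoc_dim)
  then show ?thesis using d B by (simp add: mult_one_dim)
qed

section \<open>Block projections and block triangular matrices\<close>

lemma left_cancel_mat:
  assumes "C * A = 1\<^sub>m n" "A * X = A * Y" "dim_col C = dim_row A" "dim_col A = n" "dim_row X = n" "dim_row Y = n"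
  shows "X = (Y :: 'a::comm_ring_1 mat)"
proof -
  have canc: "C * (A * Z) = Z" if "dim_row Z = n" for Z
    using that assms(1,3,4) by (simp add: one_mult_dim flip: mult_assoc_dim)
  have "C * (A * X) = C * (A * Y)" by (simp only: assms(2))
  then show ?thesis using canc assms(5,6) by simp
qed

lemma block_proj:
  assumes "A \<in> carrier_mat r r" "B \<in> carrier_mat r k" "C \<in> carrier_mat k r" "D \<in> carrier_mat k k"
  shows "head_proj r k * four_block_mat A B C D = four_block_mat A B (0\<^sub>m k r) (0\<^sub>m k k)"
    and "four_block_mat A B C D * head_proj r k = four_block_mat A (0\<^sub>m r k) C (0\<^sub>m k k)"
    and "tail_proj r k * four_block_mat A B C D = four_block_mat (0\<^sub>m r r) (0\<^sub>m r k) C D"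
    and "four_block_mat A B C D * tail_proj r k = four_block_mat (0\<^sub>m r r) B (0\<^sub>m k r) (D :: 'a::comm_ring_1 mat)"
  unfolding head_proj_def tail_proj_def
  by (subst mult_four_block_mat[of _ r r _ k _ k]; use assms in \<open>auto intro!: cong_four_block_mat\<close>)+

lemma proj_dim [simp]:
  "dim_row (head_proj r k) = r + k" "dim_col (head_proj r k) = r + k"
  "dim_row (tail_proj r k) = r + k" "dim_col (tail_proj r k) = r + k"
  by (simp_all add: head_proj_def tail_proj_def)

lemma proj_mult:
  "head_proj r k * head_proj r k = (head_proj r k :: 'a::comm_ring_1 mat)"
  "tail_proj r k * tail_proj r k = (tail_proj r k :: 'a mat)"
  "head_proj r k * tail_proj r k = (0\<^sub>m (r + k) (r + k) :: 'a mat)"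
  "tail_proj r k * head_proj r k = (0\<^sub>m (r + k) (r + k) :: 'a mat)"
proof -
  show "head_proj r k * head_proj r k = (head_proj r k :: 'a mat)"
    by (subst (2) head_proj_def, subst block_proj) (auto simp: head_proj_def)
  show "tail_proj r k * tail_proj r k = (tail_proj r k :: 'a mat)"
    by (subst (2) tail_proj_def, subst block_proj) (auto simp: tail_proj_def)
  show "head_proj r k * tail_proj r k = (0\<^sub>m (r + k) (r + k) :: 'a mat)"
    by (subst tail_proj_def, subst block_proj) auto
  show "tail_proj r k * head_proj r k = (0\<^sub>m (r + k) (r + k) :: 'a mat)"
    by (subst head_proj_def, subst block_proj) auto
qed

lemma proj_add: "head_proj r k + tail_proj r k = 1\<^sub>m (r + k)" "tail_proj r k + head_proj r k = 1\<^sub>m (r + k)"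
  unfolding head_proj_def tail_proj_def by (auto intro!: eq_matI)

lemma proj_transpose: "transpose_mat (head_proj r k) = head_proj r k" "transpose_mat (tail_proj r k) = tail_proj r k"
  unfolding head_proj_def tail_proj_def by (auto intro!: eq_matI)

text \<open>The upper right block of the product gives \<open>A1 * B2 = 0\<close> with
  \<open>A1\<close> invertible. So the inverse is block lower triangular too, with the inverses of
  the diagonal blocks on its diagonal.\<close>

lemma inverse_block_lower:
  fixes A1 :: "'a::field mat"
  assumes A: "A1 \<in> carrier_mat r r" "A3 \<in> carrier_mat k r" "A4 \<in> carrier_mat k k"
    and B: "B1 \<in> carrier_mat r r" "B2 \<in> carrier_mat r k" "B3 \<in> carrier_mat k r" "B4 \<in> carrier_mat k k"
    and AB: "four_block_mat A1 (0\<^sub>m r k) A3 A4 * four_block_mat B1 B2 B3 B4 = 1\<^sub>m (r + k)"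
  shows "A1 * B1 = 1\<^sub>m r" "B2 = 0\<^sub>m r k" "A4 * B4 = 1\<^sub>m k"
proof -
  have "four_block_mat A1 (0\<^sub>m r k) A3 A4 * four_block_mat B1 B2 B3 B4 =
    four_block_mat (A1 * B1 + 0\<^sub>m r k * B3) (A1 * B2 + 0\<^sub>m r k * B4) (A3 * B1 + A4 * B3) (A3 * B2 + A4 * B4)"
    by (rule mult_four_block_mat) (use A B in auto)
  also have "\<dots> = four_block_mat (A1 * B1) (A1 * B2) (A3 * B1 + A4 * B3) (A3 * B2 + A4 * B4)"
    using A B by (intro cong_four_block_mat) auto
  finally have "four_block_mat (A1 * B1) (A1 * B2) (A3 * B1 + A4 * B3) (A3 * B2 + A4 * B4) =
    four_block_mat (1\<^sub>m r) (0\<^sub>m r k) (0\<^sub>m k r) (1\<^sub>m k)" using AB by simp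
  then have *: "A1 * B1 = 1\<^sub>m r \<and> A1 * B2 = 0\<^sub>m r k \<and> A3 * B1 + A4 * B3 = 0\<^sub>m k r \<and> A3 * B2 + A4 * B4 = 1\<^sub>m k"
    by (subst (asm) four_block_mat_inject[of _ r r _ k _ k]) (use A B in auto)
  then show "A1 * B1 = 1\<^sub>m r" by simp
  have "B1 * A1 = 1\<^sub>m r" using right_inverse_imp_left[OF A(1) B(1)] * by simp
  then show B2: "B2 = 0\<^sub>m r k"
    by (rule left_cancel_mat) (use A B * in auto)
  show "A4 * B4 = 1\<^sub>m k" using * A B unfolding B2 by simp
qed

text \<open>Two conditions on \<open>A\<close> arise, one from the intersection of \<open>Q\<close>
  with its conjugate and one from the sum over skew matrices. Both make \<open>A\<close> block lower
  triangular and differ only in the set \<open>U\<close> of admissible leading blocks.\<close>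

definition lower_blocks :: "nat \<Rightarrow> nat \<Rightarrow> 'a::field mat set \<Rightarrow> 'a mat set" where
  "lower_blocks r k U = (\<lambda>(A, C, D). four_block_mat A (0\<^sub>m r k) C D) ` (U \<times> carrier_mat k r \<times> GL k)"

lemma bij_betw_lower_blocks:
  assumes "U \<subseteq> GL r"
  shows "bij_betw (\<lambda>(A, C, D). four_block_mat A (0\<^sub>m r k) C D) (U \<times> carrier_mat k r \<times> GL k) (lower_blocks r k U)"
  unfolding lower_blocks_def bij_betw_def
proof (intro conjI refl inj_onI)
  fix p p' assume p: "p \<in> U \<times> carrier_mat k r \<times> GL k" "p' \<in> U \<times> carrier_mat k r \<times> GL k"
    "(\<lambda>(A, C, D). four_block_mat A (0\<^sub>m r k) C D) p = (\<lambda>(A, C, D). four_block_mat A (0\<^sub>m r k) C D) p'"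
  obtain A C D A' C' D' where pp: "p = (A, C, D)" "p' = (A', C', D')" by (cases p; cases p') auto
  have car: "A \<in> carrier_mat r r" "A' \<in> carrier_mat r r" "C \<in> carrier_mat k r" "C' \<in> carrier_mat k r"
    "D \<in> carrier_mat k k" "D' \<in> carrier_mat k k" using p assms by (auto simp: pp GL_def)
  have "four_block_mat A (0\<^sub>m r k) C D = four_block_mat A' (0\<^sub>m r k) C' D'" using p(3) by (simp add: pp)
  then show "p = p'" unfolding pp
    by (subst (asm) four_block_mat_inject[of _ r r _ k _ k]) (use car in auto)
qed

lemma sum_lower_blocks:
  assumes "U \<subseteq> GL r"
  shows "(\<Sum>A\<in>lower_blocks r k U. F A) = (\<Sum>A\<in>U. \<Sum>C\<in>carrier_mat k r. \<Sum>D\<in>GL k. F (four_block_mat A (0\<^sub>m r k) C D))"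
  unfolding sum.reindex_bij_betw[OF bij_betw_lower_blocks[OF assms, of k], of F, symmetric]
  by (simp add: sum.cartesian_product split_def)

lemma det_lower_block:
  assumes "A \<in> carrier_mat r r" "C \<in> carrier_mat k r" "D \<in> carrier_mat k k"
  shows "det (four_block_mat A (0\<^sub>m r k) C D) = det A * det (D :: 'a::field mat)"
  by (rule det_four_block_mat_upper_right_zero) (use assms in auto)

lemma lower_blocks_subset: "U \<subseteq> GL r \<Longrightarrow> lower_blocks r k U \<subseteq> GL (r + k)"
  by (auto simp: lower_blocks_def GL_def det_lower_block subset_eq)

lemma lower_blocks_eq:
  assumes U: "\<And>A1 A2 A3 A4. A1 \<in> carrier_mat r r \<Longrightarrow> A2 \<in> carrier_mat r k \<Longrightarrow> A3 \<in> carrier_mat k r \<Longrightarrow>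
      A4 \<in> carrier_mat k k \<Longrightarrow> P (four_block_mat A1 A2 A3 A4) \<longleftrightarrow> A2 = 0\<^sub>m r k \<and> R A1"
  shows "{A \<in> GL (r + k). P A} = lower_blocks r k {A \<in> GL r. R A}"
proof (intro equalityI subsetI)
  fix A :: "'a mat" assume A: "A \<in> {A \<in> GL (r + k). P A}"
  then have "A \<in> carrier_mat (r + k) (r + k)" by (simp add: GL_def)
  then obtain A1 A2 A3 A4 where *: "A1 \<in> carrier_mat r r" "A2 \<in> carrier_mat r k" "A3 \<in> carrier_mat k r"
    "A4 \<in> carrier_mat k k" "A = four_block_mat A1 A2 A3 A4" by (rule carrier_mat_blocks)
  have "A2 = 0\<^sub>m r k" "R A1" using A U[OF *(1-4)] *(5) by auto
  moreover from this have "det A1 \<noteq> 0" "det A4 \<noteq> 0" using A * det_lower_block[OF *(1,3,4)] by (auto simp: GL_def)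
  ultimately show "A \<in> lower_blocks r k {A \<in> GL r. R A}"
    unfolding lower_blocks_def using * by (intro image_eqI[of _ _ "(A1, A3, A4)"]) (auto simp: GL_def)
next
  fix A assume A: "A \<in> lower_blocks r k {A \<in> GL r. R A}"
  then obtain A1 A3 A4 where *: "A1 \<in> GL r" "R A1" "A3 \<in> carrier_mat k r" "A4 \<in> GL k"
    "A = four_block_mat A1 (0\<^sub>m r k) A3 A4" unfolding lower_blocks_def by auto
  then have "P A" using U[of A1 "0\<^sub>m r k" A3 A4] by (auto simp: GL_def)
  moreover have "A \<in> GL (r + k)" using lower_blocks_subset[of "{A \<in> GL r. R A}" r k] A by auto
  ultimately show "A \<in> {A \<in> GL (r + k). P A}" by simp
qed

lemma lower_blocks_GL:
  "{A \<in> GL (r + k) :: 'a::field mat set. head_proj r k * (A * tail_proj r k) = 0\<^sub>m (r + k) (r + k)} = lower_blocks r k (GL r)"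
proof -
  have "{A \<in> GL (r + k) :: 'a mat set. head_proj r k * (A * tail_proj r k) = 0\<^sub>m (r + k) (r + k)} =
    lower_blocks r k {A \<in> GL r. True}"
  proof (rule lower_blocks_eq)
    fix A1 A2 A3 A4 :: "'a mat"
    assume *: "A1 \<in> carrier_mat r r" "A2 \<in> carrier_mat r k" "A3 \<in> carrier_mat k r" "A4 \<in> carrier_mat k k"
    have "head_proj r k * (four_block_mat A1 A2 A3 A4 * tail_proj r k) = four_block_mat (0\<^sub>m r r) A2 (0\<^sub>m k r) (0\<^sub>m k k)"
      using * by (simp add: block_proj)
    also have "\<dots> = four_block_mat (0\<^sub>m r r) (0\<^sub>m r k) (0\<^sub>m k r) (0\<^sub>m k k) \<longleftrightarrow> A2 = 0\<^sub>m r k"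
      by (subst four_block_mat_inject[of _ r r _ k _ k]) (use * in auto)
    finally show "(head_proj r k * (four_block_mat A1 A2 A3 A4 * tail_proj r k) = 0\<^sub>m (r + k) (r + k)) =
      (A2 = 0\<^sub>m r k \<and> True)" by simp
  qed
  then show ?thesis by simp
qed

text \<open>\<open>head_proj r k * A\<close> keeps the first \<open>r\<close> rows and clears the
  others, so its symmetry kills the upper right block and makes the leading block symmetric.\<close>

lemma lower_blocks_SymGL:
  "{A \<in> GL (r + k) :: 'a::field mat set. transpose_mat (head_proj r k * A) = head_proj r k * A} = lower_blocks r k (SymGL r)"
  unfolding SymGL_def
proof (rule lower_blocks_eq)
  fix A1 A2 A3 A4 :: "'a mat"
  assume *: "A1 \<in> carrier_mat r r" "A2 \<in> carrier_mat r k" "A3 \<in> carrier_mat k r" "A4 \<in> carrier_mat k k"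
  have "transpose_mat (four_block_mat A1 A2 (0\<^sub>m k r) (0\<^sub>m k k)) =
    four_block_mat (transpose_mat A1) (0\<^sub>m r k) (transpose_mat A2) (0\<^sub>m k k)"
    using * by (subst transpose_four_block_mat[of _ r r _ k _ k]) auto
  then have "transpose_mat (head_proj r k * four_block_mat A1 A2 A3 A4) = head_proj r k * four_block_mat A1 A2 A3 A4 \<longleftrightarrow>
    four_block_mat (transpose_mat A1) (0\<^sub>m r k) (transpose_mat A2) (0\<^sub>m k k) = four_block_mat A1 A2 (0\<^sub>m k r) (0\<^sub>m k k)"
    using * by (simp add: block_proj)
  also have "\<dots> \<longleftrightarrow> transpose_mat A1 = A1 \<and> 0\<^sub>m r k = A2 \<and> transpose_mat A2 = 0\<^sub>m k r"
    by (subst four_block_mat_inject[of _ r r _ k _ k]) (use * in auto)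
  also have "\<dots> \<longleftrightarrow> A2 = 0\<^sub>m r k \<and> transpose_mat A1 = A1" by auto
  finally show "(transpose_mat (head_proj r k * four_block_mat A1 A2 A3 A4) = head_proj r k * four_block_mat A1 A2 A3 A4) =
    (A2 = 0\<^sub>m r k \<and> transpose_mat A1 = A1)" .
qed

lemma row_blocks:
  assumes "h \<in> carrier_mat 2 (r + k)"
  obtains h1 h2 where "h1 \<in> carrier_mat 2 r" "h2 \<in> carrier_mat 2 k" "h = four_block_mat h1 h2 (0\<^sub>m 0 r) (0\<^sub>m 0 k)"
proof -
  from assms have "h \<in> carrier_mat (2 + 0) (r + k)" by simp
  then show ?thesis by (rule carrier_mat_blocks) (use that in \<open>auto simp: carrier_mat_0\<close>)
qed

lemma card_row_blocks:
  "card {h \<in> carrier_mat 2 (r + k) :: 'a mat set. h * head_proj r k = 0\<^sub>m 2 (r + k)} = card (UNIV :: 'a::{field,finite} set) ^ (2 * k)"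
proof -
  let ?f = "\<lambda>h2 :: 'a mat. four_block_mat (0\<^sub>m 2 r) h2 (0\<^sub>m 0 r) (0\<^sub>m 0 k)"
  have prod: "four_block_mat h1 h2 (0\<^sub>m 0 r) (0\<^sub>m 0 k) * head_proj r k = four_block_mat h1 (0\<^sub>m 2 k) (0\<^sub>m 0 r) (0\<^sub>m 0 k)"
    if "h1 \<in> carrier_mat 2 r" "h2 \<in> carrier_mat 2 k" for h1 h2 :: "'a mat"
    unfolding head_proj_def
    by (subst mult_four_block_mat[of _ 2 r _ k _ 0]) (use that in \<open>auto intro!: cong_four_block_mat\<close>)
  have zero: "0\<^sub>m 2 (r + k) = four_block_mat (0\<^sub>m 2 r) (0\<^sub>m 2 k) (0\<^sub>m 0 r) (0\<^sub>m 0 k)"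
    by (rule eq_matI) auto
  have car: "?f h2 \<in> carrier_mat 2 (r + k)" if "h2 \<in> carrier_mat 2 k" for h2
    using that four_block_carrier_mat[of "0\<^sub>m 2 r" 2 r "0\<^sub>m 0 k" 0 k] by simp
  have "bij_betw ?f (carrier_mat 2 k) {h \<in> carrier_mat 2 (r + k). h * head_proj r k = 0\<^sub>m 2 (r + k)}"
    unfolding bij_betw_def
  proof
    show "inj_on ?f (carrier_mat 2 k)"
      by (rule inj_onI) (auto simp: four_block_mat_inject[of _ 2 r _ k _ 0])
    show "?f ` carrier_mat 2 k = {h \<in> carrier_mat 2 (r + k). h * head_proj r k = 0\<^sub>m 2 (r + k)}"
    proof (intro equalityI subsetI)
      fix h :: "'a mat" assume h: "h \<in> {h \<in> carrier_mat 2 (r + k). h * head_proj r k = 0\<^sub>m 2 (r + k)}"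
      then obtain h1 h2 where *: "h1 \<in> carrier_mat 2 r" "h2 \<in> carrier_mat 2 k" "h = four_block_mat h1 h2 (0\<^sub>m 0 r) (0\<^sub>m 0 k)"
        using row_blocks[of h r k] by blast
      then have "four_block_mat h1 (0\<^sub>m 2 k) (0\<^sub>m 0 r) (0\<^sub>m 0 k) = four_block_mat (0\<^sub>m 2 r) (0\<^sub>m 2 k) (0\<^sub>m 0 r) (0\<^sub>m 0 k :: 'a mat)"
        using h prod[OF *(1,2)] by (simp flip: zero)
      then have "h1 = 0\<^sub>m 2 r" by (subst (asm) four_block_mat_inject[of _ 2 r _ k _ 0]) (use * in auto)
      then show "h \<in> ?f ` carrier_mat 2 k" using * by blast
    qed (auto simp: prod car simp flip: zero)
  qed
  from bij_betw_same_card[OF this] show ?thesis by (simp add: card_carrier_mat)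
qed

text \<open>Once the leading block vanishes, a skew matrix is given by its lower left block and a
  skew block of size \<open>k\<close>.\<close>

lemma card_Skew_head_zero:
  "card {S \<in> Skew (r + k) :: 'a mat set. head_proj r k * (S * head_proj r k) = 0\<^sub>m (r + k) (r + k)} =
    card (UNIV :: 'a::{field,finite} set) ^ (k * r) * card (Skew k :: 'a mat set)"
proof -
  let ?f = "\<lambda>(A, C, D). four_block_mat A (- transpose_mat C) C D :: 'a mat"
  have head: "head_proj r k * (?f (A, C, D) * head_proj r k) = 0\<^sub>m (r + k) (r + k) \<longleftrightarrow> A = 0\<^sub>m r r"
    if "A \<in> carrier_mat r r" "C \<in> carrier_mat k r" "D \<in> carrier_mat k k" for A C D :: "'a mat"
  proof -
    have "head_proj r k * (?f (A, C, D) * head_proj r k) = four_block_mat A (0\<^sub>m r k) (0\<^sub>m k r) (0\<^sub>m k k)"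
      using that by (simp add: block_proj)
    also have "\<dots> = four_block_mat (0\<^sub>m r r) (0\<^sub>m r k) (0\<^sub>m k r) (0\<^sub>m k k) \<longleftrightarrow> A = 0\<^sub>m r r"
      by (subst four_block_mat_inject[of _ r r _ k _ k]) (use that in auto)
    finally show ?thesis by simp
  qed
  note bij = bij_betw_Skew_blocks[of r k, where 'a='a]
  have "{S \<in> Skew (r + k). head_proj r k * (S * head_proj r k) = 0\<^sub>m (r + k) (r + k)} =
    ?f ` ({0\<^sub>m r r} \<times> carrier_mat k r \<times> Skew k)"
  proof (intro equalityI subsetI)
    fix S assume S: "S \<in> {S \<in> Skew (r + k). head_proj r k * (S * head_proj r k) = (0\<^sub>m (r + k) (r + k) :: 'a mat)}"
    then have "S \<in> Skew (r + k)" by simp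
    then have "S \<in> ?f ` (Skew r \<times> carrier_mat k r \<times> Skew k)"
      unfolding bij_betw_imp_surj_on[OF bij] .
    then obtain A C D where *: "A \<in> Skew r" "C \<in> carrier_mat k r" "D \<in> Skew k" "S = ?f (A, C, D)" by blast
    have "A = 0\<^sub>m r r"
      using S unfolding *(4) mem_Collect_eq head[OF Skew_carrier[OF *(1)] *(2) Skew_carrier[OF *(3)]] by blast
    then show "S \<in> ?f ` ({0\<^sub>m r r} \<times> carrier_mat k r \<times> Skew k)" using * by blast
  next
    fix S assume "S \<in> ?f ` ({0\<^sub>m r r} \<times> carrier_mat k r \<times> Skew k)"
    then obtain C D where *: "C \<in> carrier_mat k r" "D \<in> Skew k" "S = ?f (0\<^sub>m r r, C, D)" by blast
    have "0\<^sub>m r r \<in> Skew r" by (auto simp: Skew_def intro!: eq_matI)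
    then have "S \<in> Skew (r + k)" using bij_betw_imp_surj_on[OF bij] * by blast
    then show "S \<in> {S \<in> Skew (r + k). head_proj r k * (S * head_proj r k) = 0\<^sub>m (r + k) (r + k)}"
      using head[of "0\<^sub>m r r" C D] *(1) Skew_carrier[OF *(2)] unfolding *(3) by simp
  qed
  moreover have "inj_on ?f ({0\<^sub>m r r} \<times> carrier_mat k r \<times> Skew k)"
    by (rule inj_on_subset[OF bij_betw_imp_inj_on[OF bij]]) (auto simp: Skew_def intro!: eq_matI)
  ultimately show ?thesis by (simp add: card_image card_cartesian_product card_carrier_mat)
qed

section \<open>Conjugation by \<open>sigma_mat\<close>\<close>

lemma sigma_dims:
  "blk3_dims (r + k) (tail_proj r k) (head_proj r k) (0\<^sub>m (r + k) 2)
     (head_proj r k) (tail_proj r k) (0\<^sub>m (r + k) 2) (0\<^sub>m 2 (r + k)) (0\<^sub>m 2 (r + k)) (1\<^sub>m 2)"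
  by (simp add: blk3_dims_def)

lemma sigma_mat_involution: "sigma_mat (Suc (r + k)) r * sigma_mat (Suc (r + k)) r = (1\<^sub>m (2 * (r + k) + 2) :: 'a::comm_ring_1 mat)"
  unfolding sigma_mat_blk3 blk3_mult[OF sigma_dims sigma_dims] blk3_one[symmetric]
  by (intro blk3_eq) (auto simp: mat_dim_simps proj_mult proj_add)

lemma sigma_mat_isometry:
  "transpose_mat (sigma_mat (Suc (r + k)) r) * Jmat (Suc (r + k)) e * sigma_mat (Suc (r + k)) r = Jmat (Suc (r + k)) e"
proof -
  have T: "transpose_mat (sigma_mat (Suc (r + k)) r) = (sigma_mat (Suc (r + k)) r :: 'a mat)"
    unfolding sigma_mat_blk3 by (subst blk3_transpose[OF sigma_dims]) (auto simp: proj_transpose)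
  have TJ: "sigma_mat (Suc (r + k)) r * Jmat (Suc (r + k)) e =
    blk3 (r + k) (head_proj r k) (tail_proj r k) (0\<^sub>m (r + k) 2) (tail_proj r k) (head_proj r k) (0\<^sub>m (r + k) 2)
      (0\<^sub>m 2 (r + k)) (0\<^sub>m 2 (r + k)) (delta_eps e)"
    unfolding sigma_mat_blk3 Jmat_blk3 blk3_mult[OF sigma_dims Jmat_dims]
    by (intro blk3_eq) (auto simp: mat_dim_simps)
  show ?thesis
    unfolding T unfolding TJ unfolding sigma_mat_blk3 Jmat_blk3
    by (subst blk3_mult[OF _ sigma_dims])
       (auto simp: blk3_dims_def mat_dim_simps proj_mult proj_add intro!: blk3_eq)
qed

lemma sigma_mat_carrier: "sigma_mat (Suc m) r \<in> carrier_mat (2 * m + 2) (2 * m + 2)"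
  by (auto simp: sigma_mat_def)

lemma parabolic_mult_sigma:
  assumes D: "parabolic_dims (r + k) A C E P S i"
  shows "parabolic (r + k) A C E P S i * sigma_mat (Suc (r + k)) r =
    blk3 (r + k) (A * tail_proj r k + C * head_proj r k) (A * head_proj r k + C * tail_proj r k) E
      (P * head_proj r k) (P * tail_proj r k) (0\<^sub>m (r + k) 2) (S * head_proj r k) (S * tail_proj r k) i"
  using parabolic_dimsD[OF D]
  unfolding parabolic_def sigma_mat_blk3 blk3_mult[OF D[unfolded parabolic_dims_def] sigma_dims]
  by (intro blk3_eq) (auto simp: mat_dim_simps)

lemma sigma_conj:
  assumes D: "parabolic_dims (r + k) A C E P S i"
  defines "H \<equiv> head_proj r k" and "T \<equiv> tail_proj r k"
  shows "sigma_mat (Suc (r + k)) r * parabolic (r + k) A C E P S i * sigma_mat (Suc (r + k)) r =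
    blk3 (r + k) (T * (A * T + C * H) + H * (P * H)) (T * (A * H + C * T) + H * (P * T)) (T * E)
      (H * (A * T + C * H) + T * (P * H)) (H * (A * H + C * T) + T * (P * T)) (H * E) (S * H) (S * T) i"
proof -
  note d = parabolic_dimsD[OF D]
  have "sigma_mat (Suc (r + k)) r * parabolic (r + k) A C E P S i * sigma_mat (Suc (r + k)) r =
    sigma_mat (Suc (r + k)) r * (parabolic (r + k) A C E P S i * sigma_mat (Suc (r + k)) r)"
    by (rule mult_assoc_dim) (simp_all add: parabolic_def sigma_mat_def)
  also have "\<dots> = blk3 (r + k) (T * (A * T + C * H) + H * (P * H)) (T * (A * H + C * T) + H * (P * T)) (T * E)
      (H * (A * T + C * H) + T * (P * H)) (H * (A * H + C * T) + T * (P * T)) (H * E) (S * H) (S * T) i"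
    unfolding parabolic_mult_sigma[OF D] unfolding sigma_mat_blk3 H_def T_def
    by (subst blk3_mult[OF sigma_dims]) (use d in \<open>auto simp: blk3_dims_def mat_dim_simps intro!: blk3_eq\<close>)
  finally show ?thesis .
qed

text \<open>The conjugate is again an isometry and keeps the block \<open>i\<close>, so membership
  is a matter of the zero pattern; the three equations name the blocks that have to vanish.\<close>

lemma sigma_conj_in_Qpar_iff:
  assumes D: "parabolic_dims (r + k) A C E P S i" and w: "parabolic (r + k) A C E P S i \<in> Qpar (r + k) e"
    and det: "det i = 1"
  shows "sigma_mat (Suc (r + k)) r * parabolic (r + k) A C E P S i * sigma_mat (Suc (r + k)) r \<in> Qpar (r + k) e \<longleftrightarrow>
    head_proj r k * (A * tail_proj r k + C * head_proj r k) + tail_proj r k * (P * head_proj r k) = 0\<^sub>m (r + k) (r + k) \<and>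
    head_proj r k * E = 0\<^sub>m (r + k) 2 \<and> S * head_proj r k = 0\<^sub>m 2 (r + k)"
    (is "?s * ?w * ?s \<in> _ \<longleftrightarrow> ?Z")
proof -
  define H T where "H = (head_proj r k :: 'a mat)" and "T = (tail_proj r k :: 'a mat)"
  note d = parabolic_dimsD[OF D]
  have HT: "dim_row H = r + k" "dim_col H = r + k" "dim_row T = r + k" "dim_col T = r + k"
    by (simp_all add: H_def T_def)
  note conj = sigma_conj[OF D, folded H_def T_def]
  have dims: "blk3_dims (r + k) (T * (A * T + C * H) + H * (P * H)) (T * (A * H + C * T) + H * (P * T)) (T * E)
      (H * (A * T + C * H) + T * (P * H)) (H * (A * H + C * T) + T * (P * T)) (H * E) (S * H) (S * T) i"
    unfolding blk3_dims_def using d HT by auto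
  have "?s * ?w * ?s \<in> Qpar (r + k) e \<longleftrightarrow>
    H * (A * T + C * H) + T * (P * H) = 0\<^sub>m (r + k) (r + k) \<and> H * E = 0\<^sub>m (r + k) 2 \<and> S * H = 0\<^sub>m 2 (r + k)"
  proof
    assume "?s * ?w * ?s \<in> Qpar (r + k) e"
    then obtain A' C' E' P' S' i' where D': "parabolic_dims (r + k) A' C' E' P' S' i'"
      and eq: "?s * ?w * ?s = parabolic (r + k) A' C' E' P' S' i'" unfolding Qpar_def by blast
    show "H * (A * T + C * H) + T * (P * H) = 0\<^sub>m (r + k) (r + k) \<and> H * E = 0\<^sub>m (r + k) 2 \<and> S * H = 0\<^sub>m 2 (r + k)"
      using eq unfolding conj unfolding parabolic_def blk3_inject[OF dims D'[unfolded parabolic_dims_def]] by blast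
  next
    assume Z: "H * (A * T + C * H) + T * (P * H) = 0\<^sub>m (r + k) (r + k) \<and> H * E = 0\<^sub>m (r + k) 2 \<and> S * H = 0\<^sub>m 2 (r + k)"
    have "?s * ?w * ?s = parabolic (r + k) (T * (A * T + C * H) + H * (P * H)) (T * (A * H + C * T) + H * (P * T)) (T * E)
      (H * (A * H + C * T) + T * (P * T)) (S * T) i"
      unfolding conj unfolding parabolic_def using Z by simp
    moreover have "parabolic_dims (r + k) (T * (A * T + C * H) + H * (P * H)) (T * (A * H + C * T) + H * (P * T)) (T * E)
      (H * (A * H + C * T) + T * (P * T)) (S * T) i"
      using dims Z by (simp add: parabolic_dims_def)
    moreover have "transpose_mat (?s * ?w * ?s) * Jmat (Suc (r + k)) e * (?s * ?w * ?s) = Jmat (Suc (r + k)) e"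
    proof (rule isometry_mult)
      show "transpose_mat (?s * ?w) * Jmat (Suc (r + k)) e * (?s * ?w) = Jmat (Suc (r + k)) e"
        by (rule isometry_mult[OF sigma_mat_isometry _ sigma_mat_carrier Qpar_carrier[OF w] Jmat_carrier])
           (use w in \<open>simp_all only: Qpar_def mem_Collect_eq\<close>)
    qed (rule sigma_mat_isometry mult_carrier_mat sigma_mat_carrier Qpar_carrier[OF w] Jmat_carrier)+
    ultimately show "?s * ?w * ?s \<in> Qpar (r + k) e" unfolding Qpar_def using det by blast
  qed
  then show ?thesis by (simp only: H_def T_def)
qed

lemma minv_lower:
  assumes A: "A \<in> GL (r + k)" and 0: "head_proj r k * (A * tail_proj r k) = 0\<^sub>m (r + k) (r + k)"
  shows "head_proj r k * (minv (r + k) A * tail_proj r k) = (0\<^sub>m (r + k) (r + k) :: 'a::field mat)"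
proof -
  have "A \<in> lower_blocks r k (GL r)" using lower_blocks_GL A 0 by blast
  then obtain A1 A3 A4 where *: "A1 \<in> carrier_mat r r" "A3 \<in> carrier_mat k r" "A4 \<in> carrier_mat k k"
    "A = four_block_mat A1 (0\<^sub>m r k) A3 A4" unfolding lower_blocks_def GL_def by auto
  obtain B1 B2 B3 B4 where B: "B1 \<in> carrier_mat r r" "B2 \<in> carrier_mat r k" "B3 \<in> carrier_mat k r" "B4 \<in> carrier_mat k k"
    "minv (r + k) A = four_block_mat B1 B2 B3 B4" using carrier_mat_blocks[OF minv(1)[OF A]] .
  have "four_block_mat A1 (0\<^sub>m r k) A3 A4 * four_block_mat B1 B2 B3 B4 = 1\<^sub>m (r + k)"
    using minv(2)[OF A] B(5) *(4) by simp
  then have "B2 = 0\<^sub>m r k" using inverse_block_lower(2)[OF *(1-3) B(1-4)] by blast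
  then show ?thesis unfolding B(5) using B by (simp add: block_proj)
qed

section \<open>Independent coordinates on the parabolic group\<close>

context nonsquare_setup
begin

text \<open>In these coordinates \<open>A\<close>, \<open>S\<close>, \<open>h\<close> and
  \<open>i\<close> range independently of each other, which makes a sum over \<open>Q\<close> an
  iterated sum.\<close>

definition Qpt :: "nat \<Rightarrow> 'a mat \<times> 'a mat \<times> 'a mat \<times> 'a mat \<Rightarrow> 'a mat" where
  "Qpt m = (\<lambda>(A, S, h, i). Qelt m e A (minv m A) (gram e h + S) h i)"

abbreviation Qparam :: "nat \<Rightarrow> ('a mat \<times> 'a mat \<times> 'a mat \<times> 'a mat) set" where
  "Qparam m \<equiv> GL m \<times> Skew m \<times> carrier_mat 2 m \<times> SO2 e"

lemma triple_eq_0: "x + x + x = (0::'a)"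
proof -
  have "x + x + x = 3 * x" by (simp add: algebra_simps)
  then show ?thesis by (simp add: three_eq_0)
qed

text \<open>In characteristic three \<open>- 1 / 2 = 1\<close>, so the solutions of
  \<open>B\<^sup>T + B = - h\<^sup>T \<delta> h\<close> form the coset of the skew matrices through \<open>h\<^sup>T \<delta> h\<close>.\<close>
lemma transpose_add_gram_iff:
  assumes S: "S \<in> carrier_mat m m" and h: "h \<in> carrier_mat 2 m"
  shows "transpose_mat (gram e h + S) + (gram e h + S) + gram e h = 0\<^sub>m m m \<longleftrightarrow> S \<in> Skew m"
proof -
  note G = gram_carrier[OF h, of e]
  have sym: "gram e h $$ (j, i) = gram e h $$ (i, j)" if "i < m" "j < m" for i j
    using that by (simp add: gram_index[OF h] mult.commute mult.left_commute)
  have entry: "(transpose_mat (gram e h + S) + (gram e h + S) + gram e h) $$ (i, j) = S $$ (j, i) + S $$ (i, j)"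
    if "i < m" "j < m" for i j
    using that S G triple_eq_0[of "gram e h $$ (i, j)"] sym[OF that] by (simp add: algebra_simps)
  show ?thesis
  proof
    assume eq: "transpose_mat (gram e h + S) + (gram e h + S) + gram e h = 0\<^sub>m m m"
    have "transpose_mat S = - S"
    proof (rule eq_matI)
      fix i j assume "i < dim_row (- S)" "j < dim_col (- S)"
      then have ij: "i < m" "j < m" using S by auto
      then have "S $$ (j, i) + S $$ (i, j) = 0" using entry[OF ij] by (simp add: eq)
      then show "transpose_mat S $$ (i, j) = (- S) $$ (i, j)" using ij S by (simp add: eq_neg_iff_add_eq_0)
    qed (use S in auto)
    then show "S \<in> Skew m" using S by (simp add: Skew_def)
  next
    assume "S \<in> Skew m"
    then have sk: "transpose_mat S = - S" by (simp add: Skew_def)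
    have "S $$ (j, i) + S $$ (i, j) = 0" if "i < m" "j < m" for i j
    proof -
      have "transpose_mat S $$ (i, j) = (- S) $$ (i, j)" by (simp only: sk)
      then show ?thesis using that S by (simp add: eq_neg_iff_add_eq_0)
    qed
    then show "transpose_mat (gram e h + S) + (gram e h + S) + gram e h = 0\<^sub>m m m"
      using entry S G by (intro eq_matI) (simp_all del: index_add_mat(1))
  qed
qed

lemma Qparam_Qdata:
  assumes "(A, S, h, i) \<in> Qparam m"
  shows "Qdata m e A (minv m A) (gram e h + S) h i"
  unfolding Qdata_def
  using assms minv[of A m] GL_carrier[of A m] transpose_add_gram_iff[of S m h] Skew_carrier[of S m]
  by auto

lemma bij_betw_Qpt: "bij_betw (Qpt m) (Qparam m) (Qpar m e)"
  unfolding bij_betw_def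
proof
  show "inj_on (Qpt m) (Qparam m)"
  proof (rule inj_onI)
    fix p p' assume p: "p \<in> Qparam m" "p' \<in> Qparam m" "Qpt m p = Qpt m p'"
    obtain A S h i A' S' h' i' where pp: "p = (A, S, h, i)" "p' = (A', S', h', i')" by (cases p; cases p') auto
    note D = Qparam_Qdata[OF p(1)[unfolded pp]] and D' = Qparam_Qdata[OF p(2)[unfolded pp]]
    have car: "A \<in> GL m" "S \<in> carrier_mat m m" "S' \<in> carrier_mat m m" "h \<in> carrier_mat 2 m" "h' \<in> carrier_mat 2 m" "i \<in> SO2 e"
      using p Skew_carrier by (auto simp: pp)
    have "A = A' \<and> A * (gram e h + S) = A' * (gram e h' + S') \<and> i * h = i' * h' \<and> i = i'"
      using p(3) unfolding pp Qpt_def split Qelt_def parabolic_def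
      by (subst (asm) blk3_inject[OF Qdata_dims[OF D, unfolded parabolic_dims_def] Qdata_dims[OF D', unfolded parabolic_dims_def]]) blast
    then have eq: "A' = A" "i' = i" "A * (gram e h + S) = A * (gram e h' + S')" "i * h = i * h'" by auto
    have ic: "i \<in> carrier_mat 2 2" "det i \<noteq> 0" using car(6) by (auto simp: SO2_iff)
    obtain l where l: "l \<in> carrier_mat 2 2" "l * i = 1\<^sub>m 2" using obtain_inverse_mat[OF ic] by blast
    have h: "h = h'" by (rule left_cancel_mat[OF l(2) eq(4)]) (use l ic car in auto)
    note G = gram_carrier[OF car(4), of e] gram_carrier[OF car(5), of e]
    have "gram e h + S = gram e h' + S'"
      by (rule left_cancel_mat[OF minv(3)[OF car(1)] eq(3)]) (use minv(1)[OF car(1)] GL_carrier[OF car(1)] car G in auto)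
    then have gs: "gram e h + S = gram e h + S'" by (simp add: h)
    have "S = S'"
    proof (rule eq_matI)
      fix a b assume "a < dim_row S'" "b < dim_col S'"
      then have "a < m" "b < m" using car by auto
      moreover have "(gram e h + S) $$ (a, b) = (gram e h + S') $$ (a, b)" by (simp only: gs)
      ultimately show "S $$ (a, b) = S' $$ (a, b)" using car by simp
    qed (use car in auto)
    then show "p = p'" using pp eq h by simp
  qed
  show "Qpt m ` Qparam m = Qpar m e"
  proof (intro equalityI subsetI)
    fix w assume "w \<in> Qpt m ` Qparam m"
    then obtain A S h i where "(A, S, h, i) \<in> Qparam m" "w = Qelt m e A (minv m A) (gram e h + S) h i"
      by (auto simp: Qpt_def)
    then show "w \<in> Qpar m e" using Qelt_in_Qpar[OF Qparam_Qdata] by simp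
  next
    fix w assume "w \<in> Qpar m e"
    then obtain A A' B h i where w: "w = Qelt m e A A' B h i" and D: "Qdata m e A A' B h i"
      using Qpar_imp_Qelt by blast
    have car: "A \<in> carrier_mat m m" "A' \<in> carrier_mat m m" "A * A' = 1\<^sub>m m" "i \<in> SO2 e" "B \<in> carrier_mat m m" "h \<in> carrier_mat 2 m"
      and B: "transpose_mat B + B + gram e h = 0\<^sub>m m m" using D by (auto simp: Qdata_def)
    have A: "A \<in> GL m" using det_neq_0_if_inverse[OF car(1,2,3)] car by (simp add: GL_def)
    have inv: "minv m A = A'" by (rule minv_unique[OF A car(2,3)])
    define S where "S = B - gram e h"
    have G: "gram e h \<in> carrier_mat m m" using car by simp
    have S: "S \<in> carrier_mat m m" unfolding S_def by (rule minus_carrier_mat[OF G])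
    have BS: "gram e h + S = B" unfolding S_def using car(5) G by (intro eq_matI) auto
    have "S \<in> Skew m" using transpose_add_gram_iff[OF S car(6)] B unfolding BS by simp
    then have "(A, S, h, i) \<in> Qparam m" using A car by simp
    moreover have "w = Qpt m (A, S, h, i)" by (simp add: Qpt_def w inv BS)
    ultimately show "w \<in> Qpt m ` Qparam m" by blast
  qed
qed

lemma sum_Qpar:
  "(\<Sum>w\<in>Qpar m e. F w) = (\<Sum>A\<in>GL m. \<Sum>S\<in>Skew m. \<Sum>h\<in>carrier_mat 2 m. \<Sum>i\<in>SO2 e. F (Qpt m (A, S, h, i)))"
  unfolding sum.reindex_bij_betw[OF bij_betw_Qpt, of F m, symmetric]
  by (simp add: sum.cartesian_product split_def)

lemma card_Qpar:
  "card (Qpar m e) = card (GL m :: 'a mat set) * (card (Skew m :: 'a mat set) * (q ^ (2 * m) * (q + 1)))"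
  using bij_betw_same_card[OF bij_betw_Qpt[of m]] by (simp add: card_cartesian_product card_carrier_mat card_SO2 q_def)

text \<open>The block equations decouple, so the intersection of \<open>Q\<close> with its conjugate
  is a product set. Projecting the mixed equation from the right with \<open>T\<close> isolates the
  condition on \<open>A\<close>, and projecting with \<open>H\<close> gives, once \<open>A\<close>
  is cancelled, the condition on \<open>S\<close>.\<close>

lemma sigma_conj_Qpt_iff:
  assumes p: "(A, S, h, i) \<in> Qparam (r + k)"
  shows "sigma_mat (Suc (r + k)) r * Qpt (r + k) (A, S, h, i) * sigma_mat (Suc (r + k)) r \<in> Qpar (r + k) e \<longleftrightarrow>
    head_proj r k * (A * tail_proj r k) = 0\<^sub>m (r + k) (r + k) \<and> h * head_proj r k = 0\<^sub>m 2 (r + k) \<and>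
    head_proj r k * (S * head_proj r k) = 0\<^sub>m (r + k) (r + k)"
proof -
  define m where "m = r + k"
  define H T where "H = (head_proj r k :: 'a mat)" and "T = (tail_proj r k :: 'a mat)"
  have HTd: "dim_row H = m" "dim_col H = m" "dim_row T = m" "dim_col T = m" by (simp_all add: H_def T_def m_def)
  have HT: "H * H = H" "T * T = T" "H * T = 0\<^sub>m m m" "T * H = 0\<^sub>m m m" "H + T = 1\<^sub>m m"
    by (simp_all add: H_def T_def m_def proj_mult proj_add)
  have HTt: "transpose_mat H = H" "transpose_mat T = T" by (simp_all add: H_def T_def proj_transpose)
  have HX: "H * (H * X) = H * X" "H * (T * X) = 0\<^sub>m m (dim_col X)" "T * (H * X) = 0\<^sub>m m (dim_col X)" "T * (T * X) = T * X"
    if "dim_row X = m" for X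
    using that HTd HT by (simp_all add: zero_mult_dim flip: mult_assoc_dim)
  have split: "X = H * X + T * X" if "dim_row X = m" for X
    using that HTd HT(5) by (simp add: one_mult_dim flip: add_mult_dim)
  define M where "M = minv m A"
  note D = Qparam_Qdata[OF p[folded m_def]]
  have A: "A \<in> GL m" using p by (simp add: m_def)
  have car: "A \<in> carrier_mat m m" "M \<in> carrier_mat m m" "S \<in> carrier_mat m m" "h \<in> carrier_mat 2 m" "i \<in> carrier_mat 2 2"
    using p GL_carrier[OF A] minv(1)[OF A] Skew_carrier[of S m] by (auto simp: m_def M_def SO2_iff)
  have G: "gram e h \<in> carrier_mat m m" using car by simp
  note d = HTd car[THEN carrier_matD(1)] car[THEN carrier_matD(2)] carrier_matD[OF G]
  have MA: "M * A = 1\<^sub>m m" using minv(3)[OF A] by (simp add: M_def)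
  have i: "det i = 1" using p by (simp add: SO2_iff)
  note dims = Qdata_dims[OF D, folded M_def]
  have "sigma_mat (Suc m) r * Qpt m (A, S, h, i) * sigma_mat (Suc m) r \<in> Qpar m e \<longleftrightarrow>
    H * (A * T + A * (gram e h + S) * H) + T * (transpose_mat M * H) = 0\<^sub>m m m \<and>
    H * - (A * (transpose_mat h * delta_eps e)) = 0\<^sub>m m 2 \<and> i * h * H = 0\<^sub>m 2 m"
  proof -
    have "Qpt m (A, S, h, i) \<in> Qpar m e" using bij_betw_imp_surj_on[OF bij_betw_Qpt[of m]] p[folded m_def] by blast
    then have w: "parabolic (r + k) A (A * (gram e h + S)) (- (A * (transpose_mat h * delta_eps e))) (transpose_mat M) (i * h) i \<in> Qpar (r + k) e"
      by (simp add: Qpt_def Qelt_def M_def m_def)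
    show ?thesis
      using sigma_conj_in_Qpar_iff[OF dims[unfolded m_def] w i]
      by (simp add: Qpt_def Qelt_def H_def T_def M_def m_def)
  qed
  also have "\<dots> \<longleftrightarrow> H * (A * T) = 0\<^sub>m m m \<and> h * H = 0\<^sub>m 2 m \<and> H * (S * H) = 0\<^sub>m m m"
  proof -
    \<comment> \<open>For block lower triangular \<open>A\<close> the head rows see only the head
      coordinates, so an extra \<open>H\<close> may be inserted; \<open>HM\<close> says the same of
      the inverse.\<close>
    have HA: "H * (A * X) = H * (A * (H * X))" if "H * (A * T) = 0\<^sub>m m m" "dim_row X = m" for X
    proof -
      have "H * (A * X) = H * (A * (H * X + T * X))" using split[OF that(2)] by simp
      also have "\<dots> = H * (A * (H * X)) + H * (A * T) * X"
        using d that(2) by (simp add: mult_add_dim mult_assoc_dim)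
      also have "\<dots> = H * (A * (H * X))" unfolding that(1) using d that(2) by (simp add: mat_dim_simps)
      finally show ?thesis .
    qed
    have HM: "H * (M * X) = H * (M * (H * X))" if "H * (A * T) = 0\<^sub>m m m" "dim_row X = m" for X
    proof -
      have MT: "H * (M * T) = 0\<^sub>m m m"
        unfolding H_def T_def M_def m_def
        by (rule minv_lower) (use A that(1) in \<open>simp_all add: H_def T_def m_def\<close>)
      have "H * (M * X) = H * (M * (H * X + T * X))" using split[OF that(2)] by simp
      also have "\<dots> = H * (M * (H * X)) + H * (M * T) * X"
        using d that(2) by (simp add: mult_add_dim mult_assoc_dim)
      also have "\<dots> = H * (M * (H * X))" unfolding MT using d that(2) by (simp add: mat_dim_simps)
      finally show ?thesis .
    qed
    have TMH: "T * (transpose_mat M * H) = 0\<^sub>m m m" if "H * (A * T) = 0\<^sub>m m m"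
    proof -
      have "T * (transpose_mat M * H) = transpose_mat (H * (M * T))"
        using d by (simp add: transpose_mult_dim mult_assoc_dim HTt)
      also have "H * (M * T) = H * (M * (H * T))" by (rule HM[OF that]) (simp add: d)
      also have "\<dots> = 0\<^sub>m m m" unfolding HT(3) using d by (simp add: mat_dim_simps)
      finally show ?thesis by simp
    qed
    have HGH: "H * (gram e h * H) = 0\<^sub>m m m" if "h * H = 0\<^sub>m 2 m"
    proof -
      have "H * (gram e h * H) = gram e (h * H)"
        using d by (subst gram_mult[OF car(4), of H m]) (auto simp: HTt mult_assoc_dim)
      then show ?thesis unfolding that by (simp add: gram_def mat_dim_simps)
    qed
    have CH: "H * (A * (gram e h + S) * H) = H * (A * (H * (S * H)))" if "H * (A * T) = 0\<^sub>m m m" "h * H = 0\<^sub>m 2 m"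
    proof -
      have "H * (A * (gram e h + S) * H) = H * (A * ((gram e h + S) * H))" using d by (simp add: mult_assoc_dim)
      also have "\<dots> = H * (A * (H * ((gram e h + S) * H)))" by (rule HA[OF that(1)]) (simp add: d)
      also have "H * ((gram e h + S) * H) = H * (gram e h * H) + H * (S * H)"
        using d by (simp add: mult_add_dim add_mult_dim)
      also have "\<dots> = H * (S * H)" unfolding HGH[OF that(2)] using d by (simp add: mat_dim_simps)
      finally show ?thesis .
    qed
    show ?thesis
    proof
      assume *: "H * (A * T + A * (gram e h + S) * H) + T * (transpose_mat M * H) = 0\<^sub>m m m \<and>
        H * - (A * (transpose_mat h * delta_eps e)) = 0\<^sub>m m 2 \<and> i * h * H = 0\<^sub>m 2 m"
      let ?X = "H * (A * T + A * (gram e h + S) * H) + T * (transpose_mat M * H)"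
      have ih: "i * (h * H) = i * 0\<^sub>m 2 m" using * d by (simp add: mult_assoc_dim mat_dim_simps)
      obtain l where l: "l \<in> carrier_mat 2 2" "l * i = 1\<^sub>m 2" using obtain_inverse_mat[OF car(5)] i by auto
      have hH: "h * H = 0\<^sub>m 2 m" by (rule left_cancel_mat[OF l(2) ih]) (use l(1) d in simp_all)
      \<comment> \<open>Projection on both sides kills every term of \<open>?X\<close> except
        \<open>H * (A * T)\<close>.\<close>
      have "H * (?X * T) = H * (A * T)"
        using d by (simp add: mult_add_dim add_mult_dim mult_assoc_dim HX HT mat_dim_simps)
      then have AT: "H * (A * T) = 0\<^sub>m m m" using * d by (simp add: mat_dim_simps)
      have "H * (?X * H) = H * (A * (gram e h + S) * H)"
        using d by (simp add: mult_add_dim add_mult_dim mult_assoc_dim HX HT mat_dim_simps)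
      then have 0: "H * (A * (H * (S * H))) = 0\<^sub>m m m" using * d CH[OF AT hH] by (simp add: mat_dim_simps)
      \<comment> \<open>\<open>A\<close> is cancelled by inserting \<open>M * A\<close>;
        triangularity of \<open>M\<close> provides the inner projection that the equation
        \<open>0\<close> requires.\<close>
      have "H * (S * H) = H * (M * A * (H * (S * H)))" unfolding MA using d by (simp add: one_mult_dim HX)
      also have "\<dots> = H * (M * (A * (H * (S * H))))" using d by (simp add: mult_assoc_dim)
      also have "\<dots> = H * (M * (H * (A * (H * (S * H)))))" by (rule HM[OF AT]) (simp add: d)
      also have "\<dots> = 0\<^sub>m m m" unfolding 0 using d by (simp add: mat_dim_simps)
      finally show "H * (A * T) = 0\<^sub>m m m \<and> h * H = 0\<^sub>m 2 m \<and> H * (S * H) = 0\<^sub>m m m" using AT hH by simp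
    next
      assume *: "H * (A * T) = 0\<^sub>m m m \<and> h * H = 0\<^sub>m 2 m \<and> H * (S * H) = 0\<^sub>m m m"
      then have AT: "H * (A * T) = 0\<^sub>m m m" and hH: "h * H = 0\<^sub>m 2 m" and SH: "H * (S * H) = 0\<^sub>m m m" by auto
      have 1: "H * (A * T + A * (gram e h + S) * H) + T * (transpose_mat M * H) = 0\<^sub>m m m"
        unfolding TMH[OF AT] using d CH[OF AT hH] AT SH by (simp add: mult_add_dim mat_dim_simps)
      have Hh: "H * (transpose_mat h * delta_eps e) = 0\<^sub>m m 2"
      proof -
        have "H * (transpose_mat h * delta_eps e) = transpose_mat (h * H) * delta_eps e"
          using d by (simp add: transpose_mult_dim HTt mult_assoc_dim)
        then show ?thesis unfolding hH by (simp add: mat_dim_simps)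
      qed
      have "H * (A * (transpose_mat h * delta_eps e)) = H * (A * (H * (transpose_mat h * delta_eps e)))"
        by (rule HA[OF AT]) (simp add: d)
      also have "\<dots> = 0\<^sub>m m 2" unfolding Hh using d by (simp add: mat_dim_simps)
      finally have 2: "H * - (A * (transpose_mat h * delta_eps e)) = 0\<^sub>m m 2"
        using d by (simp add: mult_uminus_dim) (auto intro!: eq_matI)
      have 3: "i * h * H = 0\<^sub>m 2 m" using d hH by (simp add: mult_assoc_dim mat_dim_simps)
      show "H * (A * T + A * (gram e h + S) * H) + T * (transpose_mat M * H) = 0\<^sub>m m m \<and>
        H * - (A * (transpose_mat h * delta_eps e)) = 0\<^sub>m m 2 \<and> i * h * H = 0\<^sub>m 2 m" using 1 2 3 by simp
    qed
  qed
  finally show ?thesis by (simp add: H_def T_def m_def)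
qed

lemma Collect_image_eq: "f ` P = Q \<Longrightarrow> {w \<in> Q. R w} = f ` {p \<in> P. R (f p)}"
  by auto

lemma card_sigma_stabilizer:
  "card {w \<in> Qpar (r + k) e. sigma_mat (Suc (r + k)) r * w * sigma_mat (Suc (r + k)) r \<in> Qpar (r + k) e} =
    card (GL r :: 'a mat set) * (q ^ (k * r) * card (GL k :: 'a mat set)) *
    ((q ^ (k * r) * card (Skew k :: 'a mat set)) * (q ^ (2 * k) * (q + 1)))"
proof -
  let ?m = "r + k"
  let ?s = "sigma_mat (Suc ?m) r :: 'a mat"
  let ?P = "{A \<in> GL ?m. head_proj r k * (A * tail_proj r k) = (0\<^sub>m ?m ?m :: 'a mat)} \<times>
    {S \<in> Skew ?m :: 'a mat set. head_proj r k * (S * head_proj r k) = 0\<^sub>m ?m ?m} \<times> {h \<in> carrier_mat 2 ?m :: 'a mat set. h * head_proj r k = 0\<^sub>m 2 ?m} \<times> SO2 e"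
  have "{w \<in> Qpar ?m e. ?s * w * ?s \<in> Qpar ?m e} = Qpt ?m ` {p \<in> Qparam ?m. ?s * Qpt ?m p * ?s \<in> Qpar ?m e}"
    by (rule Collect_image_eq[OF bij_betw_imp_surj_on[OF bij_betw_Qpt[of ?m]]])
  also have "{p \<in> Qparam ?m. ?s * Qpt ?m p * ?s \<in> Qpar ?m e} = ?P"
  proof (rule Set.set_eqI)
    fix p :: "'a mat \<times> 'a mat \<times> 'a mat \<times> 'a mat"
    obtain A S h i where p: "p = (A, S, h, i)" by (cases p) auto
    show "p \<in> {p \<in> Qparam ?m. ?s * Qpt ?m p * ?s \<in> Qpar ?m e} \<longleftrightarrow> p \<in> ?P"
    proof (cases "(A, S, h, i) \<in> Qparam ?m")
      case True
      then show ?thesis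
        unfolding p mem_Collect_eq mem_Sigma_iff sigma_conj_Qpt_iff[OF True] by blast
    next
      case False
      then show ?thesis unfolding p by blast
    qed
  qed
  finally have "card {w \<in> Qpar ?m e. ?s * w * ?s \<in> Qpar ?m e} = card (Qpt ?m ` ?P)" by (rule arg_cong)
  also have "\<dots> = card ?P"
    by (rule card_image, rule inj_on_subset[OF bij_betw_imp_inj_on[OF bij_betw_Qpt[of ?m]]]) blast
  also have "\<dots> = card (lower_blocks r k (GL r :: 'a mat set)) * ((q ^ (k * r) * card (Skew k :: 'a mat set)) * (q ^ (2 * k) * (q + 1)))"
  proof -
    have prod: "card (A \<times> B \<times> C \<times> D) = card A * (card B * (card C * card D))"
      for A B C D :: "'a mat set" by (simp only: card_cartesian_product)
    have "card {S \<in> Skew ?m :: 'a mat set. head_proj r k * (S * head_proj r k) = 0\<^sub>m ?m ?m} =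
      q ^ (k * r) * card (Skew k :: 'a mat set)" unfolding q_def by (rule card_Skew_head_zero)
    moreover have "card {h \<in> carrier_mat 2 ?m :: 'a mat set. h * head_proj r k = 0\<^sub>m 2 ?m} = q ^ (2 * k)"
      unfolding q_def by (rule card_row_blocks)
    ultimately show ?thesis unfolding prod lower_blocks_GL card_SO2 by (simp only:)
  qed
  also have "card (lower_blocks r k (GL r :: 'a mat set)) = card (GL r :: 'a mat set) * (q ^ (k * r) * card (GL k :: 'a mat set))"
    using bij_betw_same_card[OF bij_betw_lower_blocks[OF subset_refl, of r k, where 'a='a]]
    by (simp add: card_cartesian_product card_carrier_mat q_def)
  finally show ?thesis .
qed

end

text \<open>The identity for \<open>d = 1\<close> and \<open>rho_mat\<close> for
  \<open>d = delta_eps 1\<close>, so that both kinds of double coset are treated at once.\<close>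

definition rho_blk :: "nat \<Rightarrow> 'a::comm_ring_1 mat \<Rightarrow> 'a mat" where
  "rho_blk m d = blk3 m (1\<^sub>m m) (0\<^sub>m m m) (0\<^sub>m m 2) (0\<^sub>m m m) (1\<^sub>m m) (0\<^sub>m m 2) (0\<^sub>m 2 m) (0\<^sub>m 2 m) d"

lemma rho_blk_dims:
  "d \<in> carrier_mat 2 2 \<Longrightarrow> blk3_dims m (1\<^sub>m m) (0\<^sub>m m m) (0\<^sub>m m 2) (0\<^sub>m m m) (1\<^sub>m m) (0\<^sub>m m 2) (0\<^sub>m 2 m) (0\<^sub>m 2 m) d"
  by (simp add: blk3_dims_def)

lemma rho_blk_carrier: "rho_blk m d \<in> carrier_mat (2 * m + 2) (2 * m + 2)"
  unfolding rho_blk_def by (rule blk3_carrier)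

lemma rho_blk_one: "rho_blk m (1\<^sub>m 2) = 1\<^sub>m (2 * m + 2)"
  unfolding rho_blk_def by (rule blk3_one)

lemma rho_blk_involution:
  assumes "d \<in> carrier_mat 2 2" "d * d = 1\<^sub>m 2"
  shows "rho_blk m d * rho_blk m d = 1\<^sub>m (2 * m + 2)"
  using assms
  unfolding rho_blk_def blk3_mult[OF rho_blk_dims[OF assms(1)] rho_blk_dims[OF assms(1)]] blk3_one[symmetric]
  by (intro blk3_eq) (auto simp: mat_dim_simps)

lemma rho_blk_parabolic:
  assumes D: "parabolic_dims m A C E P S i" and d: "d \<in> carrier_mat 2 2"
  shows "rho_blk m d * parabolic m A C E P S i * rho_blk m d = parabolic m A C (E * d) P (d * S) (d * i * d)"
proof -
  note dd = parabolic_dimsD[OF D] carrier_matD[OF d]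
  have "rho_blk m d * parabolic m A C E P S i = parabolic m A C E P (d * S) (d * i)"
    unfolding rho_blk_def parabolic_def blk3_mult[OF rho_blk_dims[OF d] D[unfolded parabolic_dims_def]]
    by (intro blk3_eq) (use dd in \<open>auto simp: mat_dim_simps\<close>)
  then show ?thesis
    unfolding rho_blk_def parabolic_def
    by (simp only:, subst blk3_mult[OF _ rho_blk_dims[OF d]])
       (use dd in \<open>auto simp: blk3_dims_def mat_dim_simps intro!: blk3_eq\<close>)
qed

lemma rho_blk_isometry:
  assumes d: "d \<in> carrier_mat 2 2" "gram e d = delta_eps e"
  shows "transpose_mat (rho_blk m d) * Jmat (Suc m) e * rho_blk m d = Jmat (Suc m) e"
proof -
  note dd = carrier_matD[OF d(1)]
  have T: "transpose_mat (rho_blk m d) = rho_blk m (transpose_mat d)"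
    unfolding rho_blk_def by (subst blk3_transpose[OF rho_blk_dims[OF d(1)]]) auto
  have dT: "transpose_mat d \<in> carrier_mat 2 2" using d by simp
  have TJ: "rho_blk m (transpose_mat d) * Jmat (Suc m) e =
    blk3 m (0\<^sub>m m m) (1\<^sub>m m) (0\<^sub>m m 2) (1\<^sub>m m) (0\<^sub>m m m) (0\<^sub>m m 2) (0\<^sub>m 2 m) (0\<^sub>m 2 m) (transpose_mat d * delta_eps e)"
    unfolding rho_blk_def Jmat_blk3 blk3_mult[OF rho_blk_dims[OF dT] Jmat_dims]
    by (intro blk3_eq) (use dd in \<open>auto simp: mat_dim_simps\<close>)
  show ?thesis
    unfolding T unfolding TJ unfolding rho_blk_def Jmat_blk3
    by (subst blk3_mult[OF _ rho_blk_dims[OF d(1)]])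
       (use dd d(2) in \<open>auto simp: blk3_dims_def mat_dim_simps gram_def intro!: blk3_eq\<close>)
qed

text \<open>Such a \<open>d\<close> normalises \<open>Q\<close>: conjugation keeps the shape and the
  isometry property, and \<open>det (d * i * d) = det i\<close> because \<open>d * d = 1\<close>.
  This lets the right-hand factor of a reflected double coset be moved to the left under the
  trace.\<close>

lemma rho_blk_conj_Qpar:
  assumes d: "d \<in> carrier_mat 2 2" "d * d = 1\<^sub>m 2" "gram e d = delta_eps e" and w: "w \<in> Qpar m e"
  shows "rho_blk m d * w * rho_blk m d \<in> Qpar m e"
proof -
  obtain A C E P S i where D: "parabolic_dims m A C E P S i" and w': "w = parabolic m A C E P S i" and i: "det i = 1"
    using w unfolding Qpar_def by blast
  note dd = parabolic_dimsD[OF D] carrier_matD[OF d(1)]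
  have ic: "i \<in> carrier_mat 2 2" using dd by auto
  have "det d * det d = 1" using det_mult[OF d(1) d(1)] by (simp add: d(2))
  then have det: "det (d * i * d) = 1"
    using det_mult[of "d * i" 2 d] det_mult[OF d(1) ic] d(1) ic i by simp
  have "transpose_mat (rho_blk m d * w * rho_blk m d) * Jmat (Suc m) e * (rho_blk m d * w * rho_blk m d) = Jmat (Suc m) e"
  proof (rule isometry_mult)
    show "transpose_mat (rho_blk m d * w) * Jmat (Suc m) e * (rho_blk m d * w) = Jmat (Suc m) e"
      by (rule isometry_mult[OF rho_blk_isometry[OF d(1,3)] _ rho_blk_carrier Qpar_carrier[OF w] Jmat_carrier])
         (use w in \<open>simp_all only: Qpar_def mem_Collect_eq\<close>)
  qed (rule rho_blk_isometry[OF d(1,3)] mult_carrier_mat rho_blk_carrier Qpar_carrier[OF w] Jmat_carrier)+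
  moreover have "parabolic_dims m A C (E * d) P (d * S) (d * i * d)"
    unfolding parabolic_dims_def blk3_dims_def using dd by auto
  ultimately show ?thesis
    unfolding w' rho_blk_parabolic[OF D d(1)] Qpar_def using det by blast
qed

lemma mat_trace_rho_parabolic_sigma:
  assumes D: "parabolic_dims (r + k) A C E P S i" and d: "d \<in> carrier_mat 2 2"
  shows "mat_trace (rho_blk (r + k) d * parabolic (r + k) A C E P S i * sigma_mat (Suc (r + k)) r) =
    mat_trace (A * tail_proj r k) + mat_trace (C * head_proj r k) + mat_trace (P * tail_proj r k) + mat_trace (d * i)"
proof -
  note dd = parabolic_dimsD[OF D] carrier_matD[OF d]
  have "rho_blk (r + k) d * parabolic (r + k) A C E P S i * sigma_mat (Suc (r + k)) r =
    rho_blk (r + k) d * (parabolic (r + k) A C E P S i * sigma_mat (Suc (r + k)) r)"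
    by (rule mult_assoc_dim) (simp_all add: parabolic_def sigma_mat_def rho_blk_def)
  also have "\<dots> = blk3 (r + k) (A * tail_proj r k + C * head_proj r k) (A * head_proj r k + C * tail_proj r k) E
      (P * head_proj r k) (P * tail_proj r k) (0\<^sub>m (r + k) 2) (d * (S * head_proj r k)) (d * (S * tail_proj r k)) (d * i)"
    unfolding parabolic_mult_sigma[OF D] unfolding rho_blk_def
    by (subst blk3_mult[OF rho_blk_dims[OF d]]) (use dd in \<open>auto simp: blk3_dims_def mat_dim_simps intro!: blk3_eq\<close>)
  also have "mat_trace \<dots> = mat_trace (A * tail_proj r k + C * head_proj r k) + mat_trace (P * tail_proj r k) + mat_trace (d * i)"
    by (rule blk3_trace) (use dd in \<open>auto simp: blk3_dims_def\<close>)
  also have "mat_trace (A * tail_proj r k + C * head_proj r k) = mat_trace (A * tail_proj r k) + mat_trace (C * head_proj r k)"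
    by (rule mat_trace_add[of _ "r + k"]) (use dd in auto)
  finally show ?thesis .
qed

lemma mat_trace_block_tail:
  assumes "A \<in> carrier_mat r r" "B \<in> carrier_mat r k" "C \<in> carrier_mat k r" "D \<in> carrier_mat k k"
  shows "mat_trace (four_block_mat A B C D * tail_proj r k) = mat_trace (D :: 'a::comm_ring_1 mat)"
proof -
  have "mat_trace (four_block_mat (0\<^sub>m r r) B (0\<^sub>m k r) D) = mat_trace (0\<^sub>m r r :: 'a mat) + mat_trace D"
    by (rule mat_trace_four_block[of _ r _ k]) (use assms in auto)
  then show ?thesis unfolding block_proj(4)[OF assms] by (simp add: mat_trace_def)
qed

section \<open>Evaluation of the character sums\<close>

context nonsquare_setup
begin

text \<open>\<open>h\<close> and \<open>S\<close> enter in separate terms, each paired with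
  \<open>head_proj r k * A\<close>, and \<open>i\<close> stands alone. So the summand factors, and
  for fixed \<open>A\<close> the sums over \<open>S\<close>, \<open>h\<close> and \<open>i\<close>
  can be taken separately.\<close>

lemma mat_trace_rho_Qpt_sigma:
  assumes p: "(A, S, h, i) \<in> Qparam (r + k)" and d: "d \<in> carrier_mat 2 2"
  shows "mat_trace (rho_blk (r + k) d * Qpt (r + k) (A, S, h, i) * sigma_mat (Suc (r + k)) r) =
    mat_trace (A * tail_proj r k) + mat_trace (minv (r + k) A * tail_proj r k) +
    mat_trace (head_proj r k * A * gram e h) + mat_trace (head_proj r k * A * S) + mat_trace (d * i)"
proof -
  let ?m = "r + k" and ?H = "head_proj r k :: 'a mat" and ?T = "tail_proj r k :: 'a mat"
  note D = Qdata_dims[OF Qparam_Qdata[OF p]]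
  have car: "A \<in> carrier_mat ?m ?m" "minv ?m A \<in> carrier_mat ?m ?m" "S \<in> carrier_mat ?m ?m" "gram e h \<in> carrier_mat ?m ?m"
    using p GL_carrier[of A ?m] minv(1)[of A ?m] Skew_carrier[of S ?m] by auto
  note dd = car[THEN carrier_matD(1)] car[THEN carrier_matD(2)]
  have 1: "mat_trace (A * (gram e h + S) * ?H) = mat_trace (?H * A * gram e h) + mat_trace (?H * A * S)"
  proof -
    have "mat_trace (A * (gram e h + S) * ?H) = mat_trace (?H * (A * (gram e h + S)))"
      by (rule mat_trace_commute[of _ ?m ?m]) (use dd in auto)
    also have "?H * (A * (gram e h + S)) = ?H * A * gram e h + ?H * A * S"
      using dd by (simp add: mult_assoc_dim mult_add_dim)
    also have "mat_trace \<dots> = mat_trace (?H * A * gram e h) + mat_trace (?H * A * S)"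
      by (rule mat_trace_add[of _ ?m]) (use dd in auto)
    finally show ?thesis .
  qed
  have 2: "mat_trace (transpose_mat (minv ?m A) * ?T) = mat_trace (minv ?m A * ?T)"
  proof -
    have "transpose_mat (minv ?m A) * ?T = transpose_mat (?T * minv ?m A)"
      using dd by (simp add: transpose_mult_dim proj_transpose)
    also have "mat_trace \<dots> = mat_trace (?T * minv ?m A)" by (rule mat_trace_transpose[of _ ?m]) (use dd in auto)
    also have "\<dots> = mat_trace (minv ?m A * ?T)" by (rule mat_trace_commute[of _ ?m ?m]) (use dd in auto)
    finally show ?thesis .
  qed
  show ?thesis
    unfolding Qpt_def split Qelt_def mat_trace_rho_parabolic_sigma[OF D d] 1 2 by (simp only: ac_simps)
qed

text \<open>The Kloosterman sum of the group \<open>GL k\<close>, where \<open>k\<close> is the size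
  of the block that \<open>sigma_mat\<close> leaves in place; it is evaluated for
  \<open>k = 0\<close> and \<open>k = 1\<close>.\<close>

definition matrix_kloosterman :: "nat \<Rightarrow> 'a \<Rightarrow> complex" where
  "matrix_kloosterman k \<beta> = (\<Sum>A\<in>GL k. lam (\<beta> * (mat_trace A + mat_trace (minv k A))))"

text \<open>After projection only the leading block is left: it gives \<open>(- q) ^ r\<close>, and
  the zero block leaves the other \<open>2 * k\<close> entries of \<open>h\<close> free.\<close>

lemma gram_sum_smult_head:
  assumes A: "A \<in> SymGL r" and C: "C \<in> carrier_mat k r" and D: "D \<in> carrier_mat k k" and \<beta>: "\<beta> \<noteq> 0"
  shows "gram_sum (\<beta> \<cdot>\<^sub>m (head_proj r k * four_block_mat A (0\<^sub>m r k) C D)) = (- of_nat q) ^ r * of_nat q ^ (2 * k)"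
proof -
  note AC = SymGL_carrier[OF A]
  have "\<beta> \<cdot>\<^sub>m (head_proj r k * four_block_mat A (0\<^sub>m r k) C D) =
    four_block_mat (\<beta> \<cdot>\<^sub>m A) (0\<^sub>m r k) (0\<^sub>m k r) (0\<^sub>m k k)"
    unfolding block_proj(1)[OF AC zero_carrier_mat C D] by (rule eq_matI) (use AC in auto)
  moreover have "\<beta> \<cdot>\<^sub>m A \<in> SymGL r"
  proof -
    have "transpose_mat (\<beta> \<cdot>\<^sub>m A) = \<beta> \<cdot>\<^sub>m transpose_mat A" by (rule eq_matI) auto
    then show ?thesis using A \<beta> by (simp add: SymGL_def GL_def)
  qed
  ultimately show ?thesis
    using gram_sum_block_diag[of "\<beta> \<cdot>\<^sub>m A" r "0\<^sub>m k k" k] AC by (simp add: gram_sum_SymGL gram_sum_zero)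
qed

text \<open>The factors have separate origins. The sum over \<open>S\<close> gives the order of
  \<open>Skew\<close> and restricts \<open>A\<close>; of the restricted \<open>A\<close>, the
  leading block gives the order of \<open>SymGL\<close>, the free lower left block
  \<open>q ^ (k * r)\<close>, and the lower diagonal block \<open>matrix_kloosterman\<close>. The
  last factor is the sum over \<open>h\<close>.\<close>

lemma sum_lam_Qpar:
  assumes \<beta>: "\<beta> \<noteq> 0" and d: "d \<in> carrier_mat 2 2"
  shows "(\<Sum>w\<in>Qpar (r + k) e. lam (\<beta> * mat_trace (rho_blk (r + k) d * w * sigma_mat (Suc (r + k)) r))) =
    (\<Sum>i\<in>SO2 e. lam (\<beta> * mat_trace (d * i))) * of_nat (card (Skew (r + k) :: 'a mat set)) *
    (of_nat (card (SymGL r :: 'a mat set)) * of_nat q ^ (k * r) * matrix_kloosterman k \<beta> *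
      ((- of_nat q) ^ r * of_nat q ^ (2 * k)))"
proof -
  let ?m = "r + k" and ?H = "head_proj r k :: 'a mat" and ?T = "tail_proj r k :: 'a mat"
  let ?I = "\<Sum>i\<in>SO2 e. lam (\<beta> * mat_trace (d * i))"
  define t where "t A = lam (\<beta> * (mat_trace (A * ?T) + mat_trace (minv ?m A * ?T)))" for A
  define X where "X A = \<beta> \<cdot>\<^sub>m (?H * A)" for A
  have smult: "\<beta> * mat_trace (?H * A * Z) = mat_trace (X A * Z)" if "A \<in> carrier_mat ?m ?m" "Z \<in> carrier_mat ?m ?m" for A Z
  proof -
    have "X A * Z = \<beta> \<cdot>\<^sub>m (?H * A * Z)" unfolding X_def
      by (rule mult_smult_assoc_mat[of _ ?m ?m _ ?m]) (use that in auto)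
    moreover have "mat_trace (\<beta> \<cdot>\<^sub>m (?H * A * Z)) = \<beta> * mat_trace (?H * A * Z)"
      by (rule mat_trace_smult[of _ ?m]) (use that in auto)
    ultimately show ?thesis by simp
  qed
  have summand: "lam (\<beta> * mat_trace (rho_blk ?m d * Qpt ?m (A, S, h, i) * sigma_mat (Suc ?m) r)) =
    t A * (lam (mat_trace (X A * S)) * (lam (mat_trace (X A * gram e h)) * lam (\<beta> * mat_trace (d * i))))"
    if "A \<in> GL ?m" "S \<in> Skew ?m" "h \<in> carrier_mat 2 ?m" "i \<in> SO2 e" for A S h i
  proof -
    have p: "(A, S, h, i) \<in> Qparam ?m" using that by simp
    show ?thesis
      unfolding mat_trace_rho_Qpt_sigma[OF p d] t_def
        smult[OF GL_carrier[OF that(1)] Skew_carrier[OF that(2)], symmetric]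
        smult[OF GL_carrier[OF that(1)] gram_carrier[OF that(3)], symmetric]
        distrib_left lam_add by (simp only: ac_simps)
  qed
  have XC: "X A \<in> carrier_mat ?m ?m" if "A \<in> GL ?m" for A
    using GL_carrier[OF that] by (auto simp: X_def)
  have XT: "transpose_mat (X A) = X A \<longleftrightarrow> transpose_mat (?H * A) = ?H * A" for A
  proof -
    have "transpose_mat (X A) = \<beta> \<cdot>\<^sub>m transpose_mat (?H * A)" unfolding X_def by (rule eq_matI) auto
    moreover have "\<beta> \<cdot>\<^sub>m Y = \<beta> \<cdot>\<^sub>m Z \<longleftrightarrow> Y = Z" for Y Z :: "'a mat"
    proof
      assume eq: "\<beta> \<cdot>\<^sub>m Y = \<beta> \<cdot>\<^sub>m Z"
      have "inverse \<beta> \<cdot>\<^sub>m (\<beta> \<cdot>\<^sub>m W) = W" for W :: "'a mat" using \<beta> by (intro eq_matI) auto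
      then show "Y = Z" by (metis eq)
    qed simp
    ultimately show ?thesis by (simp add: X_def)
  qed
  have "(\<Sum>w\<in>Qpar ?m e. lam (\<beta> * mat_trace (rho_blk ?m d * w * sigma_mat (Suc ?m) r))) =
    (\<Sum>A\<in>GL ?m. \<Sum>S\<in>Skew ?m. \<Sum>h\<in>carrier_mat 2 ?m. \<Sum>i\<in>SO2 e.
      t A * (lam (mat_trace (X A * S)) * (lam (mat_trace (X A * gram e h)) * lam (\<beta> * mat_trace (d * i)))))"
    unfolding sum_Qpar by (intro sum.cong refl summand)
  also have "\<dots> = (\<Sum>A\<in>GL ?m. t A * ((\<Sum>S\<in>Skew ?m. lam (mat_trace (X A * S))) *
      ((\<Sum>h\<in>carrier_mat 2 ?m. lam (mat_trace (X A * gram e h))) * ?I)))"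
    by (simp only: sum_distrib_left[symmetric] sum_distrib_right[symmetric])
  also have "\<dots> = (\<Sum>A\<in>GL ?m. if transpose_mat (?H * A) = ?H * A
      then t A * (of_nat (card (Skew ?m :: 'a mat set)) * (gram_sum (X A) * ?I)) else 0)"
  proof (rule sum.cong[OF refl])
    fix A :: "'a mat" assume A: "A \<in> GL ?m"
    have "(\<Sum>h\<in>carrier_mat 2 ?m. lam (mat_trace (X A * gram e h))) = gram_sum (X A)"
      unfolding gram_sum_def using XC[OF A] by simp
    then show "t A * ((\<Sum>S\<in>Skew ?m. lam (mat_trace (X A * S))) *
      ((\<Sum>h\<in>carrier_mat 2 ?m. lam (mat_trace (X A * gram e h))) * ?I)) =
      (if transpose_mat (?H * A) = ?H * A then t A * (of_nat (card (Skew ?m :: 'a mat set)) * (gram_sum (X A) * ?I)) else 0)"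
      unfolding sum_lam_Skew[OF XC[OF A]] XT by simp
  qed
  also have "\<dots> = (\<Sum>A\<in>{A \<in> GL ?m. transpose_mat (?H * A) = ?H * A}.
      t A * (of_nat (card (Skew ?m :: 'a mat set)) * (gram_sum (X A) * ?I)))"
    by (rule sum.inter_filter[symmetric]) simp
  also have "\<dots> = (\<Sum>A\<in>SymGL r. \<Sum>C\<in>carrier_mat k r. \<Sum>D\<in>GL k.
      t (four_block_mat A (0\<^sub>m r k) C D) * (of_nat (card (Skew ?m :: 'a mat set)) *
        (gram_sum (X (four_block_mat A (0\<^sub>m r k) C D)) * ?I)))"
    unfolding lower_blocks_SymGL by (rule sum_lower_blocks) (auto simp: SymGL_def)
  also have "\<dots> = (\<Sum>A\<in>(SymGL r :: 'a mat set). \<Sum>C\<in>(carrier_mat k r :: 'a mat set). \<Sum>D\<in>GL k.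
      lam (\<beta> * (mat_trace D + mat_trace (minv k D))) * (of_nat (card (Skew ?m :: 'a mat set)) *
        ((- of_nat q) ^ r * of_nat q ^ (2 * k) * ?I)))"
  proof (intro sum.cong refl)
    fix A C D :: "'a mat" assume A: "A \<in> SymGL r" and C: "C \<in> carrier_mat k r" and D: "D \<in> GL k"
    let ?F = "four_block_mat A (0\<^sub>m r k) C D"
    note AC = SymGL_carrier[OF A] and DC = GL_carrier[OF D]
    have "?F \<in> lower_blocks r k (SymGL r)"
      unfolding lower_blocks_def by (rule image_eqI[of _ _ "(A, C, D)"]) (use A C D in simp_all)
    moreover have "SymGL r \<subseteq> (GL r :: 'a mat set)" by (auto simp: SymGL_def)
    ultimately have F: "?F \<in> GL ?m" using lower_blocks_subset by blast
    \<comment> \<open>Only the lower diagonal block of the inverse enters the trace, and for a block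
      lower triangular matrix it is the inverse of \<open>D\<close>.\<close>
    obtain B1 B2 B3 B4 where B: "B1 \<in> carrier_mat r r" "B2 \<in> carrier_mat r k" "B3 \<in> carrier_mat k r" "B4 \<in> carrier_mat k k"
      "minv ?m ?F = four_block_mat B1 B2 B3 B4" using carrier_mat_blocks[OF minv(1)[OF F]] .
    have "?F * four_block_mat B1 B2 B3 B4 = 1\<^sub>m ?m" using minv(2)[OF F] B(5) by simp
    from inverse_block_lower(3)[OF AC C DC B(1-4) this] have "minv k D = B4"
      using minv_unique[OF D B(4)] by simp
    then have "t ?F = lam (\<beta> * (mat_trace D + mat_trace (minv k D)))"
      unfolding t_def B(5) mat_trace_block_tail[OF AC zero_carrier_mat C DC] mat_trace_block_tail[OF B(1-4)] by simp
    then show "t ?F * (of_nat (card (Skew ?m :: 'a mat set)) * (gram_sum (X ?F) * ?I)) =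
      lam (\<beta> * (mat_trace D + mat_trace (minv k D))) * (of_nat (card (Skew ?m :: 'a mat set)) *
        ((- of_nat q) ^ r * of_nat q ^ (2 * k) * ?I))"
      unfolding X_def gram_sum_smult_head[OF A C DC \<beta>] by simp
  qed
  also have "\<dots> = of_nat (card (SymGL r :: 'a mat set)) * (of_nat q ^ (k * r) * (matrix_kloosterman k \<beta> *
      (of_nat (card (Skew ?m :: 'a mat set)) * ((- of_nat q) ^ r * of_nat q ^ (2 * k) * ?I))))"
    by (simp add: matrix_kloosterman_def card_carrier_mat flip: sum_distrib_right q_def)
  finally show ?thesis by (simp only: ac_simps)
qed

lemma matrix_kloosterman_0: "matrix_kloosterman 0 \<beta> = 1"
proof -
  have 1: "1\<^sub>m 0 \<in> (GL 0 :: 'a mat set)" by (simp add: GL_0)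
  have "mat_trace (minv 0 (1\<^sub>m 0 :: 'a mat)) = 0"
    unfolding mat_trace_def carrier_matD(1)[OF minv(1)[OF 1]] by simp
  moreover have "mat_trace (1\<^sub>m 0 :: 'a mat) = 0" by (simp add: mat_trace_def)
  ultimately show ?thesis by (simp add: matrix_kloosterman_def GL_0)
qed

lemma matrix_kloosterman_1:
  assumes "\<beta> \<noteq> 0"
  shows "matrix_kloosterman 1 \<beta> = kloosterman lam (\<beta>^2)"
proof -
  have GL1: "c \<cdot>\<^sub>m 1\<^sub>m 1 \<in> GL 1" if "c \<noteq> 0" for c :: 'a using that by (simp add: GL_def det_single)
  have inv: "minv 1 (c \<cdot>\<^sub>m 1\<^sub>m 1) = inverse c \<cdot>\<^sub>m 1\<^sub>m 1" if "c \<noteq> 0" for c :: 'a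
    by (rule minv_unique[OF GL1[OF that]]) (use that in \<open>auto intro!: eq_matI simp: scalar_prod_def\<close>)
  have tr: "mat_trace (c \<cdot>\<^sub>m 1\<^sub>m (Suc 0)) = (c :: 'a)" for c by (simp add: mat_trace_def)
  have "matrix_kloosterman 1 \<beta> = (\<Sum>c\<in>UNIV - {0}. lam (\<beta> * (c + inverse c)))"
    unfolding matrix_kloosterman_def
  proof (rule sum.reindex_bij_witness[of _ "\<lambda>c. c \<cdot>\<^sub>m 1\<^sub>m 1" "\<lambda>A. A $$ (0, 0)"])
    fix A :: "'a mat" assume A: "A \<in> GL 1"
    then obtain c where c: "A = c \<cdot>\<^sub>m 1\<^sub>m 1" using one_by_one_mat[of A] GL_carrier[OF A] by auto
    have "c \<noteq> 0" using A by (auto simp: c GL_def det_single)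
    then show "A $$ (0, 0) \<cdot>\<^sub>m 1\<^sub>m 1 = A" "A $$ (0, 0) \<in> UNIV - {0}"
      "lam (\<beta> * (A $$ (0, 0) + inverse (A $$ (0, 0)))) = lam (\<beta> * (mat_trace A + mat_trace (minv 1 A)))"
      using inv[of c] tr by (simp_all add: c)
  qed (use GL1 in auto)
  then show ?thesis using kloosterman_square[OF assms] by simp
qed

text \<open>Both identities evaluate one sum over \<open>Q \<times> Q\<close> in two ways, grouped
  by the product in the double coset, each element being hit \<open>Br\<close> times, or summed
  directly. The constant function one gives the order of the double coset.\<close>

lemma double_coset_character_sum:
  fixes r k :: nat and d :: "'a mat"
  assumes d: "d \<in> carrier_mat 2 2" "d * d = 1\<^sub>m 2" "gram e d = delta_eps e"
  defines "Q \<equiv> Qpar (r + k) e" and "s \<equiv> sigma_mat (Suc (r + k)) r"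
  defines "Br \<equiv> card {w \<in> Q. s * w * s \<in> Q}" and "X \<equiv> {x * s * y | x y. x \<in> Q \<and> y \<in> Q}"
  shows "of_nat Br * (\<Sum>g\<in>X. lam (\<beta> * mat_trace (rho_blk (r + k) d * g))) =
      of_nat (card Q) * (\<Sum>w\<in>Q. lam (\<beta> * mat_trace (rho_blk (r + k) d * w * s)))"
    and "Br * card X = card Q * card Q"
proof -
  interpret mat_group Q "2 * (r + k) + 2" unfolding Q_def by (rule mat_group_Qpar[OF e_neq_0])
  have s: "s \<in> carrier_mat (2 * (r + k) + 2) (2 * (r + k) + 2)" "s * s = 1\<^sub>m (2 * (r + k) + 2)"
    unfolding s_def by (rule sigma_mat_carrier sigma_mat_involution)+
  show "of_nat Br * (\<Sum>g\<in>X. lam (\<beta> * mat_trace (rho_blk (r + k) d * g))) =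
      of_nat (card Q) * (\<Sum>w\<in>Q. lam (\<beta> * mat_trace (rho_blk (r + k) d * w * s)))"
    unfolding Br_def X_def sum_double_coset[OF s, symmetric]
    by (rule sum_trace_double_coset[OF s(1) rho_blk_carrier rho_blk_involution[OF d(1,2)]])
       (use rho_blk_conj_Qpar[OF d] in \<open>simp add: Q_def\<close>)
  show "Br * card X = card Q * card Q"
    using sum_double_coset[OF s, of "\<lambda>_. 1::nat"] by (simp add: Br_def X_def)
qed

end

section \<open>The recursion and its parameters\<close>

text \<open>The weight attached to \<open>\<beta>\<close> is
  \<open>(2 / 3) * A * (B - \<eta> * K)\<close>, so the binomial expansion of its
  \<open>h\<close>-th power has \<open>M h\<close> in its top term; solving for it leaves the lower
  moments and, by the Pless identity, the weights of the code.\<close>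

lemma (in char3_character) power_moment_recursion:
  fixes D :: "'a mat set" and A B \<eta> :: real
  assumes D: "finite D" and N: "real (card D) = A * B" and A: "A \<noteq> 0"
    and E: "\<And>\<beta>. \<beta> \<noteq> 0 \<Longrightarrow> (\<Sum>g\<in>D. lam (\<beta> * mat_trace g)) = of_real (\<eta> * A) * kloosterman lam (\<beta>^2)"
    and h: "h \<ge> 1"
  defines "M \<equiv> \<lambda>l. \<Sum>a\<in>nonzero_squares. kloosterman lam (a::'a) ^ l"
  shows "(- of_real \<eta>) ^ h * M h =
    - (\<Sum>l<h. (- of_real \<eta>) ^ l * of_nat (h choose l) * of_real B ^ (h - l) * M l) +
    of_nat q * of_real A powi (- int h) *
      (\<Sum>j=0..min (card D) h. (-1) ^ j * of_nat (weight_dist D j) *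
        (\<Sum>t=j..h. of_nat (fact t * Stirling h t * 3 ^ (h - t)) * (2::complex) powi (int t - int h - int j - 1) *
          of_nat (if t \<le> card D then (card D - j) choose (card D - t) else 0)))"
proof -
  let ?w = "\<lambda>\<beta>. card {g\<in>D. lam (\<beta> * mat_trace g) \<noteq> 1}"
  let ?K = "kloosterman lam"
  let ?b = "\<lambda>j t. of_nat (if t \<le> card D then (card D - j) choose (card D - t) else 0) :: complex"
  have w: "of_nat (?w \<beta>) = (2 / 3) * of_real A * (of_real B - of_real \<eta> * ?K (\<beta>^2))" if \<beta>: "\<beta> \<noteq> 0" for \<beta>
  proof -
    \<comment> \<open>Squaring a value of \<open>lam\<close> negates its argument because
      \<open>2 = -1\<close>; the sum for \<open>- \<beta>\<close> agrees with that for
      \<open>\<beta>\<close>, as only \<open>\<beta>^2\<close> enters its value.\<close>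
    have sq: "lam x ^ 2 = lam (- x)" for x
    proof -
      have "lam x ^ 2 = lam (2 * x)" by (metis lam_add mult_2 power2_eq_square)
      then show ?thesis by (simp add: two_eq_minus_1)
    qed
    have "of_nat (?w \<beta>) = (\<Sum>g\<in>D. of_bool (lam (\<beta> * mat_trace g) \<noteq> 1) :: complex)"
      using D by (simp add: sum.If_cases of_bool_def Int_def)
    also have "\<dots> = (\<Sum>g\<in>D. 2 / 3 - (lam (\<beta> * mat_trace g) + lam ((- \<beta>) * mat_trace g)) / 3)"
      by (intro sum.cong refl) (simp only: of_bool_lam_neq_1 sq minus_mult_left)
    also have "\<dots> = 2 / 3 * of_nat (card D) - ((\<Sum>g\<in>D. lam (\<beta> * mat_trace g)) + (\<Sum>g\<in>D. lam ((- \<beta>) * mat_trace g))) / 3"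
      by (simp add: sum_subtractf sum.distrib add_divide_distrib flip: sum_divide_distrib)
    also have "(\<Sum>g\<in>D. lam ((- \<beta>) * mat_trace g)) = of_real (\<eta> * A) * ?K (\<beta>^2)" using E[of "- \<beta>"] \<beta> by simp
    also have "(\<Sum>g\<in>D. lam (\<beta> * mat_trace g)) = of_real (\<eta> * A) * ?K (\<beta>^2)" by (rule E[OF \<beta>])
    also have "of_nat (card D) = (of_real (A * B) :: complex)" by (metis N of_real_of_nat_eq)
    finally show ?thesis by (simp add: algebra_simps)
  qed
  define L where "L = (\<Sum>l\<le>h. (- of_real \<eta>) ^ l * of_nat (h choose l) * of_real B ^ (h - l) * M l)"
  define J where "J = (\<Sum>j=0..min (card D) h. (-1) ^ j * of_nat (weight_dist D j) *
      (\<Sum>t=j..h. of_nat (fact t * Stirling h t) * (2 ^ (t - j) / 3 ^ t) * ?b j t))"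
  \<comment> \<open>The term \<open>\<beta> = 0\<close> has weight zero and drops out because
    \<open>h \<ge> 1\<close>.\<close>
  have "(\<Sum>\<beta>\<in>UNIV. of_nat (?w \<beta>) ^ h :: complex) = (\<Sum>\<beta>\<in>UNIV - {0}. of_nat (?w \<beta>) ^ h)"
    by (rule sum.mono_neutral_right) (use h in auto)
  also have "\<dots> = (\<Sum>\<beta>\<in>UNIV - {0}. ((2 / 3) * of_real A) ^ h * (of_real B - of_real \<eta> * ?K (\<beta>^2)) ^ h)"
  proof (rule sum.cong[OF refl])
    fix \<beta> :: 'a assume "\<beta> \<in> UNIV - {0}"
    then have nz: "\<beta> \<noteq> 0" by simp
    show "of_nat (?w \<beta>) ^ h = ((2 / 3) * of_real A) ^ h * (of_real B - of_real \<eta> * ?K (\<beta>^2)) ^ h"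
      by (simp only: w[OF nz] power_mult_distrib)
  qed
  also have "\<dots> = 2 * (\<Sum>a\<in>nonzero_squares. ((2 / 3) * of_real A) ^ h * (of_real B - of_real \<eta> * ?K a) ^ h)"
    by (rule sum_over_nonzero_squares)
  also have "(\<Sum>a\<in>nonzero_squares. ((2 / 3) * of_real A) ^ h * (of_real B - of_real \<eta> * ?K a) ^ h) =
      ((2 / 3) * of_real A) ^ h * L"
  proof -
    have "(of_real B - of_real \<eta> * ?K a) ^ h =
        (\<Sum>l\<le>h. (- of_real \<eta>) ^ l * of_nat (h choose l) * of_real B ^ (h - l) * ?K a ^ l)" for a
    proof -
      have "(of_real B - of_real \<eta> * ?K a) ^ h = ((- of_real \<eta>) * ?K a + of_real B) ^ h" by simp
      also have "\<dots> = (\<Sum>l\<le>h. of_nat (h choose l) * ((- of_real \<eta>) * ?K a) ^ l * of_real B ^ (h - l))"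
        by (rule binomial_ring)
      finally show ?thesis by (simp only: power_mult_distrib mult_ac)
    qed
    then have "(\<Sum>a\<in>nonzero_squares. (of_real B - of_real \<eta> * ?K a) ^ h) =
      (\<Sum>l\<le>h. \<Sum>a\<in>nonzero_squares. (- of_real \<eta>) ^ l * of_nat (h choose l) * of_real B ^ (h - l) * ?K a ^ l)"
      by (simp only:) (rule sum.swap)
    then show ?thesis by (simp only: L_def M_def flip: sum_distrib_left)
  qed
  finally have lhs: "(\<Sum>\<beta>\<in>UNIV. of_nat (?w \<beta>) ^ h :: complex) = 2 * (((2 / 3) * of_real A) ^ h * L)" .
  have "(\<Sum>\<beta>\<in>UNIV. of_nat (?w \<beta>) ^ h :: complex) = of_nat q * J"
    unfolding pless_power_moment[OF D, of mat_trace h] J_def weight_dist_def code_def ..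
  then have LJ: "2 * (((2 / 3) * of_real A) ^ h * L) = of_nat q * J" by (simp only: lhs)
  have "L = (of_nat q * J) / (2 * ((2 / 3) * of_real A) ^ h)" unfolding LJ[symmetric] using A by simp
  \<comment> \<open>\<open>3 ^ h / 2 ^ Suc h\<close> undoes \<open>(2 / 3) ^ h\<close> together with
    the 2 from folding \<open>\<beta>\<close> onto the squares; it accounts for the
    \<open>- h - 1\<close> in the exponent of two.\<close>
  also have "\<dots> = of_nat q * of_real A powi (- int h) * (J * (3 ^ h / 2 ^ Suc h))"
    using A by (simp add: power_int_minus power_mult_distrib power_divide field_simps)
  also have "J * (3 ^ h / 2 ^ Suc h) = (\<Sum>j=0..min (card D) h. (-1) ^ j * of_nat (weight_dist D j) *
        (\<Sum>t=j..h. of_nat (fact t * Stirling h t * 3 ^ (h - t)) * (2::complex) powi (int t - int h - int j - 1) * ?b j t))"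
    unfolding J_def sum_distrib_right
  proof (rule sum.cong[OF refl])
    fix j
    have coeff: "(2 ^ (t - j) / 3 ^ t) * (3 ^ h / 2 ^ Suc h) = 3 ^ (h - t) * (2::complex) powi (int t - int h - int j - 1)"
      if t: "t \<in> {j..h}" for t
    proof -
      obtain a b where ab: "t = j + a" "h = t + b" using t by (metis atLeastAtMost_iff le_Suc_ex)
      have e: "int t - int h - int j - 1 = int a - int (Suc h)" using ab by simp
      have "(2::complex) powi (int t - int h - int j - 1) = 2 ^ a / 2 ^ Suc h"
        unfolding e by (subst power_int_diff) (simp_all del: power_Suc of_nat_Suc)
      moreover have "3 ^ h = (3 ^ t * 3 ^ b :: complex)" by (simp add: ab(2) power_add)
      ultimately show ?thesis using ab by simp
    qed
    have "(\<Sum>t=j..h. of_nat (fact t * Stirling h t) * (2 ^ (t - j) / 3 ^ t) * ?b j t) * (3 ^ h / 2 ^ Suc h) =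
        (\<Sum>t=j..h. of_nat (fact t * Stirling h t * 3 ^ (h - t)) * (2::complex) powi (int t - int h - int j - 1) * ?b j t)"
      unfolding sum_distrib_right
    proof (rule sum.cong[OF refl])
      fix t assume t: "t \<in> {j..h}"
      have "of_nat (fact t * Stirling h t) * (2 ^ (t - j) / 3 ^ t) * ?b j t * (3 ^ h / 2 ^ Suc h) =
        of_nat (fact t * Stirling h t) * ((2 ^ (t - j) / 3 ^ t) * (3 ^ h / 2 ^ Suc h)) * ?b j t"
        by (simp only: mult_ac)
      also have "\<dots> = of_nat (fact t * Stirling h t * 3 ^ (h - t)) * (2::complex) powi (int t - int h - int j - 1) * ?b j t"
        unfolding coeff[OF t] of_nat_mult of_nat_power of_nat_numeral by (simp only: mult_ac)
      finally show "of_nat (fact t * Stirling h t) * (2 ^ (t - j) / 3 ^ t) * ?b j t * (3 ^ h / 2 ^ Suc h) =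
        of_nat (fact t * Stirling h t * 3 ^ (h - t)) * (2::complex) powi (int t - int h - int j - 1) * ?b j t" .
    qed
    then show "(-1) ^ j * of_nat (weight_dist D j) *
        (\<Sum>t=j..h. of_nat (fact t * Stirling h t) * (2 ^ (t - j) / 3 ^ t) * ?b j t) * (3 ^ h / 2 ^ Suc h) =
      (-1) ^ j * of_nat (weight_dist D j) *
        (\<Sum>t=j..h. of_nat (fact t * Stirling h t * 3 ^ (h - t)) * (2::complex) powi (int t - int h - int j - 1) * ?b j t)"
      by (subst mult.assoc) (simp only:)
  qed
  finally have "L = of_nat q * of_real A powi (- int h) * (\<Sum>j=0..min (card D) h. (-1) ^ j * of_nat (weight_dist D j) *
        (\<Sum>t=j..h. of_nat (fact t * Stirling h t * 3 ^ (h - t)) * (2::complex) powi (int t - int h - int j - 1) * ?b j t))" .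
  \<comment> \<open>The term \<open>l = h\<close> is split off; its binomial coefficient and its
    power of \<open>B\<close> are one.\<close>
  moreover have "L = (\<Sum>l<h. (- of_real \<eta>) ^ l * of_nat (h choose l) * of_real B ^ (h - l) * M l) + (- of_real \<eta>) ^ h * M h"
    unfolding L_def by (simp flip: lessThan_Suc_atMost)
  ultimately show ?thesis by (metis (no_types, lifting) add_diff_cancel_left' diff_conv_add_uminus add.commute)
qed

section \<open>Product formulas for the matrix counts\<close>

context char3_character
begin

lemma q_gt_1: "q > 1"
proof -
  have "card {0, 1 :: 'a} \<le> q" unfolding q_def by (rule card_mono) auto
  then show ?thesis by simp
qed

lemma q_ge_1: "q ^ n \<ge> 1"
  using q_gt_1 by simp

abbreviation odd_prod :: "nat \<Rightarrow> real" where
  "odd_prod j \<equiv> (\<Prod>i=1..j. real q ^ (2 * i - 1) - 1)"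

abbreviation even_prod :: "nat \<Rightarrow> real" where
  "even_prod j \<equiv> (\<Prod>i=1..j. real q ^ (2 * i) - 1)"

lemma real_card_GL_Suc:
  "real (card (GL (Suc n) :: 'a mat set)) = (real q ^ Suc n - 1) * real q ^ n * real (card (GL n :: 'a mat set))"
  unfolding card_GL_Suc q_def[symmetric] of_nat_mult of_nat_diff[OF q_ge_1] by simp

text \<open>The recursion with two predecessors decouples into alternating single steps: a step with
  factor \<open>q^(n+1)\<close> is followed by one with factor \<open>q^(n+2) - 1\<close>, and a
  step with factor \<open>q^(n+1) - 1\<close> by one with factor \<open>q^(n+2)\<close>.\<close>

lemma real_card_SymGL_step:
  "real (card (SymGL (2 * j + 1) :: 'a mat set)) = (real q ^ (2 * j + 1) - 1) * real (card (SymGL (2 * j) :: 'a mat set)) \<and>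
   real (card (SymGL (2 * j + 2) :: 'a mat set)) = real q ^ (2 * j + 2) * real (card (SymGL (2 * j + 1) :: 'a mat set))"
proof -
  let ?s = "\<lambda>n. real (card (SymGL n :: 'a mat set))"
  have rec: "?s (Suc (Suc n)) = (real q ^ Suc n - 1) * (real q ^ Suc n * ?s n) + (real q - 1) * (real q ^ Suc n * ?s (Suc n))" for n
    unfolding card_SymGL_Suc_Suc[OF q_def, of n] of_nat_add of_nat_mult of_nat_diff[OF q_ge_1]
    using q_gt_1 by (simp add: of_nat_diff)
  have step_odd: "?s (Suc (Suc n)) = (real q * real q ^ Suc n - 1) * ?s (Suc n)"
    if "?s (Suc n) = real q ^ Suc n * ?s n" for n
  proof -
    have alg: "(y - 1) * (y * a) + (Q - 1) * (y * (y * a)) = (Q * y - 1) * (y * a)" for y a Q :: real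
      by (simp add: algebra_simps)
    show ?thesis unfolding rec that by (rule alg)
  qed
  have step_even: "?s (Suc (Suc n)) = real q * real q ^ Suc n * ?s (Suc n)"
    if "?s (Suc n) = (real q ^ Suc n - 1) * ?s n" for n
  proof -
    have alg: "(x - 1) * (x * a) + (Q - 1) * (x * ((x - 1) * a)) = Q * x * ((x - 1) * a)" for x a Q :: real
      by (simp add: algebra_simps)
    show ?thesis unfolding rec that by (rule alg)
  qed
  show ?thesis
  proof (induction j)
    case 0
    have 1: "?s 1 = real q - 1" using card_SymGL_1[where 'a='a] q_gt_1 by (simp add: q_def[symmetric] of_nat_diff)
    have 2: "?s 2 = (real q - 1) * (real q * 1) + (real q - 1) * (real q * ?s 1)"
      using rec[of 0] by (simp add: card_SymGL_0 numeral_2_eq_2)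
    have "?s 2 = real q ^ 2 * ?s 1" unfolding 2 1 by (simp add: algebra_simps power2_eq_square)
    then show ?case using 1 by (simp add: card_SymGL_0 numeral_2_eq_2)
  next
    case (Suc j)
    have "?s (2 * Suc j + 1) = (real q ^ (2 * Suc j + 1) - 1) * ?s (2 * Suc j)"
      using step_odd[of "2 * j + 1"] Suc by simp
    moreover from this have "?s (2 * Suc j + 2) = real q ^ (2 * Suc j + 2) * ?s (2 * Suc j + 1)"
      using step_even[of "2 * Suc j"] by simp
    ultimately show ?case by simp
  qed
qed

text \<open>The steps to even size contribute \<open>q^2\<close>, \<open>q^4\<close> and so on up to
  \<open>q^(2j)\<close>, whence the exponent \<open>j * (j + 1)\<close>; the steps to odd size
  contribute \<open>odd_prod\<close>.\<close>

lemma real_card_SymGL: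
  "real (card (SymGL (2 * j) :: 'a mat set)) = real q ^ (j * (j + 1)) * odd_prod j"
  "real (card (SymGL (2 * j + 1) :: 'a mat set)) = real q ^ (j * (j + 1)) * odd_prod (j + 1)"
proof -
  show even: "real (card (SymGL (2 * j) :: 'a mat set)) = real q ^ (j * (j + 1)) * odd_prod j" for j
  proof (induction j)
    case (Suc j)
    have "real (card (SymGL (2 * Suc j) :: 'a mat set)) =
        real q ^ (2 * j + 2) * ((real q ^ (2 * j + 1) - 1) * (real q ^ (j * (j + 1)) * odd_prod j))"
      using real_card_SymGL_step[of j] Suc by simp
    also have "\<dots> = real q ^ (j * (j + 1) + (2 * j + 2)) * (odd_prod j * (real q ^ (2 * j + 1) - 1))"
      unfolding power_add by (simp only: mult_ac)
    also have "j * (j + 1) + (2 * j + 2) = Suc j * (Suc j + 1)" by simp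
    also have "odd_prod j * (real q ^ (2 * j + 1) - 1) = odd_prod (Suc j)" by simp
    finally show ?case .
  qed (simp add: card_SymGL_0)
  show "real (card (SymGL (2 * j + 1) :: 'a mat set)) = real q ^ (j * (j + 1)) * odd_prod (j + 1)"
    using real_card_SymGL_step[of j] even[of j] by simp
qed

text \<open>The quotient of the two orders keeps only the factors with even exponents, which are
  those of \<open>B\<close>. In even size the power of \<open>q\<close> in it would be
  \<open>j * j - 2 * j\<close>, negative for \<open>j = 1\<close>, so \<open>q^(2j)\<close> stays on
  the left.\<close>

lemma real_card_GL:
  "real (card (GL (2 * j) :: 'a mat set)) * real q ^ (2 * j) = real (card (SymGL (2 * j) :: 'a mat set)) * (real q ^ (j * j) * even_prod j)"
  "real (card (GL (2 * j + 1) :: 'a mat set)) = real (card (SymGL (2 * j + 1) :: 'a mat set)) * (real q ^ (j * j) * even_prod j)"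
proof -
  let ?s = "\<lambda>n. real (card (SymGL n :: 'a mat set))" and ?g = "\<lambda>n. real (card (GL n :: 'a mat set))"
  have odd: "?g (2 * j + 1) = ?s (2 * j + 1) * (real q ^ (j * j) * even_prod j)"
    if "?g (2 * j) * real q ^ (2 * j) = ?s (2 * j) * (real q ^ (j * j) * even_prod j)" for j
  proof -
    have "?g (2 * j + 1) = (real q ^ (2 * j + 1) - 1) * (?g (2 * j) * real q ^ (2 * j))"
      using real_card_GL_Suc[of "2 * j"] by simp
    also have "\<dots> = ((real q ^ (2 * j + 1) - 1) * ?s (2 * j)) * (real q ^ (j * j) * even_prod j)"
      unfolding that by (simp only: mult_ac)
    finally show ?thesis using real_card_SymGL_step[of j] by simp
  qed
  show even: "?g (2 * j) * real q ^ (2 * j) = ?s (2 * j) * (real q ^ (j * j) * even_prod j)" for j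
  proof (induction j)
    case (Suc j)
    have "?g (2 * Suc j) * real q ^ (2 * Suc j) =
      (real q ^ (2 * j + 2) - 1) * real q ^ (2 * j + 1) * ?g (2 * j + 1) * real q ^ (2 * j + 2)"
      using real_card_GL_Suc[of "2 * j + 1"] by simp
    also have "\<dots> = (real q ^ (2 * j + 2) * ?s (2 * j + 1)) *
        (real q ^ (j * j + (2 * j + 1)) * (even_prod j * (real q ^ (2 * j + 2) - 1)))"
      unfolding odd[OF Suc] power_add[of _ "j * j"] by (simp only: mult_ac)
    also have "real q ^ (2 * j + 2) * ?s (2 * j + 1) = ?s (2 * Suc j)" using real_card_SymGL_step[of j] by simp
    also have "j * j + (2 * j + 1) = Suc j * Suc j" by simp
    also have "even_prod j * (real q ^ (2 * j + 2) - 1) = even_prod (Suc j)" by simp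
    finally show ?case .
  qed (simp add: card_SymGL_0 GL_0)
  show "?g (2 * j + 1) = ?s (2 * j + 1) * (real q ^ (j * j) * even_prod j)" by (rule odd[OF even])
qed

lemma card_GL_pos: "card (GL n :: 'a mat set) > 0"
proof -
  have "1\<^sub>m n \<in> (GL n :: 'a mat set)" by (simp add: GL_def)
  then show ?thesis by (simp add: card_gt_0_iff) blast
qed

text \<open>The order of \<open>Skew\<close> enters the double coset counts squared, where the
  exponent needs no halving.\<close>

lemma card_Skew_square: "card (Skew n :: 'a mat set) * card (Skew n :: 'a mat set) = q ^ (n * (n - 1))"
proof -
  have "even (n * (n - 1))" by auto
  then have "n * (n - 1) div 2 + n * (n - 1) div 2 = n * (n - 1)" by (elim evenE) simp
  then show ?thesis unfolding card_Skew by (simp flip: power_add)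
qed

end

section \<open>The two kinds of double coset\<close>

context nonsquare_setup
begin

lemma card_SymGL_pos: "card (SymGL n :: 'a mat set) > 0"
proof -
  have "1\<^sub>m n \<in> (SymGL n :: 'a mat set)" by (simp add: SymGL_def GL_def)
  then show ?thesis by (simp add: card_gt_0_iff) blast
qed

lemma dcoset_eq: "dcoset (Suc m) e r = {x * sigma_mat (Suc m) r * y | x y. x \<in> Qpar m e \<and> y \<in> Qpar m e}"
  unfolding dcoset_def Qgrp_eq_Qpar ..

lemma dcoset_carrier: "g \<in> dcoset (Suc m) e r \<Longrightarrow> g \<in> carrier_mat (2 * m + 2) (2 * m + 2)"
  unfolding dcoset_eq using Qpar_carrier sigma_mat_carrier by (blast intro: mult_carrier_mat)

text \<open>Here \<open>k = 0\<close>: the intersection of \<open>Q\<close> with its conjugate is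
  the Levi factor, of order \<open>g * (q + 1)\<close>, the matrix Kloosterman sum is one, and the
  Kloosterman sum comes from \<open>SO2 e\<close>.\<close>

lemma top_dcoset:
  "real (card (dcoset (Suc m) e m)) = real q ^ (m * m + 2 * m) * (real q ^ m * real (card (GL m :: 'a mat set)) * (real q + 1))"
  "\<beta> \<noteq> 0 \<Longrightarrow> (\<Sum>g\<in>dcoset (Suc m) e m. lam (\<beta> * mat_trace g)) =
    of_real (- ((-1) ^ m) * (real q ^ (m * m + 2 * m) * real (card (SymGL m :: 'a mat set)))) * kloosterman lam (\<beta>^2)"
proof -
  let ?D = "dcoset (Suc m) e m" and ?one = "1\<^sub>m 2 :: 'a mat"
  define g Sk s where "g = card (GL m :: 'a mat set)" and "Sk = card (Skew m :: 'a mat set)" and "s = card (SymGL m :: 'a mat set)"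
  have one: "?one \<in> carrier_mat 2 2" "?one * ?one = 1\<^sub>m 2" "gram e ?one = delta_eps e"
    by (auto simp: gram_def mat_dim_simps)
  have Sk2: "Sk * Sk = q ^ (m * (m - 1))" unfolding Sk_def by (rule card_Skew_square)
  \<comment> \<open>\<open>m * (m - 1)\<close> comes from the squared skew count and
    \<open>2 * m\<close> from the sum over \<open>h\<close> in the order of \<open>Q\<close>. The
    last \<open>m\<close> comes from \<open>(- q) ^ m\<close> in the character sum; in the order of
    the double coset a further \<open>q ^ m\<close> is left over and goes to
    \<open>B\<close>.\<close>
  have exps: "m * (m - 1) + 3 * m = m * m + 2 * m" by (cases m) simp_all
  have Br: "card {w \<in> Qpar m e. sigma_mat (Suc m) m * w * sigma_mat (Suc m) m \<in> Qpar m e} = g * (q + 1)"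
    using card_sigma_stabilizer[of m 0] by (simp add: GL_0 Skew_0 g_def)
  have Q: "card (Qpar m e) = g * (Sk * (q ^ (2 * m) * (q + 1)))" unfolding card_Qpar g_def Sk_def ..
  have gpos: "g > 0" unfolding g_def by (rule card_GL_pos)
  have "g * (q + 1) * card ?D = g * (Sk * (q ^ (2 * m) * (q + 1))) * (g * (Sk * (q ^ (2 * m) * (q + 1))))"
    using double_coset_character_sum(2)[OF one, of m 0] Br Q by (simp add: dcoset_eq)
  also have "\<dots> = g * (q + 1) * (Sk * Sk * q ^ (2 * m) * q ^ (2 * m) * g * (q + 1))" by (simp only: mult_ac)
  finally have "card ?D = Sk * Sk * q ^ (2 * m) * q ^ (2 * m) * g * (q + 1)" using gpos by simp
  also have "\<dots> = q ^ (m * (m - 1) + 3 * m) * (q ^ m * g * (q + 1))"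
    unfolding Sk2 by (simp add: power_add algebra_simps flip: power_mult power_add)
  finally show "real (card ?D) = real q ^ (m * m + 2 * m) * (real q ^ m * real (card (GL m :: 'a mat set)) * (real q + 1))"
    unfolding exps g_def by (simp only: of_nat_mult of_nat_power of_nat_add of_nat_1)
  show "(\<Sum>g\<in>?D. lam (\<beta> * mat_trace g)) =
    of_real (- ((-1) ^ m) * (real q ^ (m * m + 2 * m) * real (card (SymGL m :: 'a mat set)))) * kloosterman lam (\<beta>^2)"
    if \<beta>: "\<beta> \<noteq> 0"
  proof -
    let ?K = "kloosterman lam (\<beta>^2)" and ?E = "\<Sum>g\<in>?D. lam (\<beta> * mat_trace g)" and ?x = "of_nat q :: complex"
    have I: "(\<Sum>i\<in>SO2 e. lam (\<beta> * mat_trace (?one * i))) = - ?K"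
      unfolding sum_lam_SO2[OF \<beta>, symmetric] by (intro sum.cong refl) (auto simp: SO2_iff)
    have T: "(\<Sum>w\<in>Qpar m e. lam (\<beta> * mat_trace (rho_blk m ?one * w * sigma_mat (Suc m) m))) =
      - ?K * of_nat Sk * (of_nat s * (- ?x) ^ m)"
      using sum_lam_Qpar[OF \<beta> one(1), of m 0] unfolding I by (simp add: matrix_kloosterman_0 Sk_def s_def)
    have rho: "(\<Sum>g\<in>?D. lam (\<beta> * mat_trace (rho_blk m ?one * g))) = ?E"
    proof (rule sum.cong[OF refl])
      fix g assume "g \<in> ?D"
      then have "rho_blk m ?one * g = g" unfolding rho_blk_one by (intro left_mult_one_mat[OF dcoset_carrier])
      then show "lam (\<beta> * mat_trace (rho_blk m ?one * g)) = lam (\<beta> * mat_trace g)" by simp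
    qed
    have "of_nat (g * (q + 1)) * ?E = of_nat (g * (Sk * (q ^ (2 * m) * (q + 1)))) * (- ?K * of_nat Sk * (of_nat s * (- ?x) ^ m))"
      using double_coset_character_sum(1)[OF one, of m 0 \<beta>]
      unfolding add_0_right Br Q T dcoset_eq[symmetric] rho .
    also have "(- ?x) ^ m = (-1) ^ m * ?x ^ m" by (rule power_minus)
    also have "of_nat (g * (Sk * (q ^ (2 * m) * (q + 1)))) * (- ?K * of_nat Sk * (of_nat s * ((-1) ^ m * ?x ^ m))) =
      of_nat (g * (q + 1)) * (- ((-1) ^ m) * (of_nat (Sk * Sk) * ?x ^ (2 * m) * ?x ^ m * of_nat s) * ?K)"
      unfolding of_nat_mult of_nat_power by (simp add: mult_ac)
    finally have "of_nat (g * (q + 1)) * ?E =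
      of_nat (g * (q + 1)) * (- ((-1) ^ m) * (of_nat (Sk * Sk) * ?x ^ (2 * m) * ?x ^ m * of_nat s) * ?K)" .
    moreover have "of_nat (g * (q + 1)) \<noteq> (0 :: complex)" unfolding of_nat_eq_0_iff using gpos by simp
    ultimately have "?E = - ((-1) ^ m) * (of_nat (Sk * Sk) * ?x ^ (2 * m) * ?x ^ m * of_nat s) * ?K"
      using mult_left_cancel by blast
    also have "of_nat (Sk * Sk) * ?x ^ (2 * m) * ?x ^ m = ?x ^ (m * m + 2 * m)"
      unfolding Sk2 exps[symmetric] by (simp add: add_ac flip: power_add)
    finally show ?thesis by (simp add: s_def)
  qed
qed

lemma delta_eps_1:
  "delta_eps 1 * delta_eps 1 = (1\<^sub>m 2 :: 'a mat)" "gram e (delta_eps 1) = delta_eps e"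
proof -
  show "delta_eps 1 * delta_eps 1 = (1\<^sub>m 2 :: 'a mat)"
    by (intro eq_matI) (auto simp: delta_eps_def scalar_prod_def numeral_2_eq_2 less_2_cases_iff)
  show "gram e (delta_eps 1) = delta_eps e"
  proof (rule eq_matI)
    fix i j assume "i < dim_row (delta_eps e)" "j < dim_col (delta_eps e)"
    then have ij: "i < 2" "j < 2" by auto
    show "gram e (delta_eps 1) $$ (i, j) = delta_eps e $$ (i, j)"
      unfolding gram_index[OF delta_eps_carrier ij] using ij by (auto simp: less_2_cases_iff delta_eps_def)
  qed (simp_all add: gram_def)
qed

text \<open>Here \<open>k = 1\<close>: the reflected orthogonal factor is the constant
  \<open>q + 1\<close>, and the Kloosterman sum comes from \<open>GL 1\<close>. \<open>Y\<close> is
  the factor common to the order and the character sum; its denominator \<open>q - 1\<close> is the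
  order of \<open>GL 1\<close> inside \<open>Br\<close>.\<close>

lemma subtop_rho_dcoset:
  fixes r :: nat
  defines "Y \<equiv> (real q + 1) * ((real q ^ (r + 1) - 1) / (real q - 1)) * real q ^ (r * r + 4 * r + 2)"
  shows "real (card (rho_dcoset (Suc (r + 1)) e r)) = Y * real (card (GL (r + 1) :: 'a mat set))"
    and "\<beta> \<noteq> 0 \<Longrightarrow> (\<Sum>g\<in>rho_dcoset (Suc (r + 1)) e r. lam (\<beta> * mat_trace g)) =
      of_real ((-1) ^ r * (Y * real (card (SymGL r :: 'a mat set)))) * kloosterman lam (\<beta>^2)"
proof -
  let ?m = "r + 1" and ?d = "delta_eps 1 :: 'a mat" and ?R = "rho_dcoset (Suc (r + 1)) e r"
  let ?D = "dcoset (Suc ?m) e r" and ?rho = "rho_blk (r + 1) (delta_eps 1 :: 'a mat)"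
  define g gm Sk s where "g = card (GL r :: 'a mat set)" and "gm = card (GL ?m :: 'a mat set)"
    and "Sk = card (Skew ?m :: 'a mat set)" and "s = card (SymGL r :: 'a mat set)"
  \<comment> \<open>Left multiplication by the reflection is injective, so counts and sums over the
    reflected coset become those over the double coset itself.\<close>
  have rhoD: "?R = (\<lambda>g. ?rho * g) ` ?D"
  proof -
    have rho: "rho_mat (Suc ?m) = ?rho" unfolding rho_mat_blk3 rho_blk_def ..
    have assoc: "?rho * x * sigma_mat (Suc ?m) r * y = ?rho * (x * sigma_mat (Suc ?m) r * y)"
      if "x \<in> Qpar ?m e" "y \<in> Qpar ?m e" for x y
    proof -
      have dims: "dim_row ?rho = 2 * ?m + 2" "dim_col ?rho = 2 * ?m + 2"
        "dim_row (sigma_mat (Suc ?m) r :: 'a mat) = 2 * ?m + 2" "dim_col (sigma_mat (Suc ?m) r :: 'a mat) = 2 * ?m + 2"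
        using carrier_matD[OF rho_blk_carrier] carrier_matD[OF sigma_mat_carrier] by blast+
      show ?thesis using dims Qpar_dim[OF that(1)] Qpar_dim[OF that(2)] by (simp add: mult_assoc_dim)
    qed
    have "?R = {?rho * x * sigma_mat (Suc ?m) r * y | x y. x \<in> Qpar ?m e \<and> y \<in> Qpar ?m e}"
      unfolding rho_dcoset_def Qgrp_eq_Qpar rho ..
    also have "\<dots> = (\<lambda>g. ?rho * g) ` ?D"
    proof (intro equalityI subsetI)
      fix w assume "w \<in> {?rho * x * sigma_mat (Suc ?m) r * y | x y. x \<in> Qpar ?m e \<and> y \<in> Qpar ?m e}"
      then obtain x y where xy: "x \<in> Qpar ?m e" "y \<in> Qpar ?m e" "w = ?rho * x * sigma_mat (Suc ?m) r * y" by blast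
      have "x * sigma_mat (Suc ?m) r * y \<in> ?D" unfolding dcoset_eq using xy by blast
      then show "w \<in> (\<lambda>g. ?rho * g) ` ?D" unfolding xy(3) assoc[OF xy(1,2)] by (rule imageI)
    next
      fix w assume "w \<in> (\<lambda>g. ?rho * g) ` ?D"
      then obtain x y where xy: "x \<in> Qpar ?m e" "y \<in> Qpar ?m e" "w = ?rho * (x * sigma_mat (Suc ?m) r * y)"
        unfolding dcoset_eq by blast
      then show "w \<in> {?rho * x * sigma_mat (Suc ?m) r * y | x y. x \<in> Qpar ?m e \<and> y \<in> Qpar ?m e}"
        unfolding xy(3) assoc[OF xy(1,2), symmetric] by blast
    qed
    finally show ?thesis .
  qed
  have inj: "inj_on (\<lambda>g. ?rho * g) ?D"
  proof (rule inj_on_inverseI[of _ "\<lambda>g. ?rho * g"])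
    fix w assume "w \<in> ?D"
    then have w: "w \<in> carrier_mat (2 * ?m + 2) (2 * ?m + 2)" by (rule dcoset_carrier)
    have "?rho * (?rho * w) = ?rho * ?rho * w" by (rule assoc_mult_mat[symmetric, OF rho_blk_carrier rho_blk_carrier w])
    also have "\<dots> = w" unfolding rho_blk_involution[OF delta_eps_carrier delta_eps_1(1)] using w by (rule left_mult_one_mat)
    finally show "?rho * (?rho * w) = w" .
  qed
  have gpos: "g > 0" unfolding g_def by (rule card_GL_pos)
  have q1: "real q > 1" using q_gt_1 by simp
  have Sk2: "Sk * Sk = q ^ (r * (r + 1))"
    using card_Skew_square[of ?m] by (simp add: Sk_def mult.commute)
  have gm: "real gm = (real q ^ (r + 1) - 1) * real q ^ r * real g"
    using real_card_GL_Suc[of r] by (simp add: g_def gm_def)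
  have g1: "real (card (GL 1 :: 'a mat set)) = real q - 1" using real_card_GL_Suc[of 0] by (simp add: GL_0)
  have sk1: "card (Skew 1 :: 'a mat set) = 1" unfolding Skew_1 by simp
  define Br where "Br = card {w \<in> Qpar ?m e. sigma_mat (Suc ?m) r * w * sigma_mat (Suc ?m) r \<in> Qpar ?m e}"
  have Br: "real Br = real g * (real q ^ r * (real q - 1)) * (real q ^ r * (real q ^ 2 * (real q + 1)))"
    unfolding Br_def card_sigma_stabilizer[of r 1] of_nat_mult g1 sk1 by (simp add: g_def)
  have Q: "card (Qpar ?m e) = gm * (Sk * (q ^ (2 * ?m) * (q + 1)))" unfolding card_Qpar gm_def Sk_def ..
  have v: "real q ^ (2 * ?m) = real q ^ r * real q ^ r * real q ^ 2"
    by (simp add: power2_eq_square mult_2 power_add)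
  have zuv: "real Sk * real Sk * real q ^ r * real q ^ (2 * ?m) = real q ^ (r * r + 4 * r + 2)"
  proof -
    have "real Sk * real Sk = real q ^ (r * (r + 1))" using arg_cong[OF Sk2, of real] by simp
    then have "real Sk * real Sk * real q ^ r * real q ^ (2 * ?m) = real q ^ (r * (r + 1) + r + 2 * ?m)"
      by (simp only: power_add)
    also have "r * (r + 1) + r + 2 * ?m = r * r + 4 * r + 2" by simp
    finally show ?thesis .
  qed
  \<comment> \<open>The factor shared by \<open>Br\<close> and the order of \<open>Q\<close>,
    cancelled below; what remains of \<open>Br\<close> is \<open>q - 1\<close>.\<close>
  define c where "c = real g * real q ^ r * real q ^ r * real q ^ 2 * (real q + 1)"
  have c: "c \<noteq> 0" using gpos q1 by (simp add: c_def)
  define Z where "Z = (real q ^ (r + 1) - 1) * (real Sk * real Sk * real q ^ r * real q ^ (2 * ?m)) * (real q + 1)"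
  have Y: "Y = Z / (real q - 1)" unfolding Y_def Z_def zuv by simp
  have Brc: "real Br = c * (real q - 1)" unfolding Br c_def by (simp only: mult_ac)
  have "real (card ?R) = real (card ?D)" unfolding rhoD card_image[OF inj] ..
  moreover have "real (card ?D) * (real q - 1) = Z * real gm"
  proof -
    have "real Br * real (card ?D) = real (card (Qpar ?m e)) * real (card (Qpar ?m e))"
      using double_coset_character_sum(2)[OF delta_eps_carrier delta_eps_1, of r 1]
      unfolding dcoset_eq[symmetric] Br_def[symmetric] by (simp only: flip: of_nat_mult)
    then have "c * (real (card ?D) * (real q - 1)) =
      ((real q ^ (r + 1) - 1) * real q ^ r * real g * (real Sk * ((real q ^ r * real q ^ r * real q ^ 2) * (real q + 1)))) *
      (real gm * (real Sk * (real q ^ (2 * ?m) * (real q + 1))))"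
      unfolding Brc Q of_nat_mult of_nat_power of_nat_add of_nat_1
      by (subst (asm) (2) gm, subst (asm) (2) v) (simp only: mult_ac)
    also have "\<dots> = c * (Z * real gm)" unfolding c_def Z_def by (simp only: mult_ac)
    finally show ?thesis using c by simp
  qed
  ultimately show "real (card ?R) = Y * real (card (GL ?m :: 'a mat set))"
    unfolding Y gm_def[symmetric] using q1 by (simp add: field_simps)
  show "(\<Sum>g\<in>?R. lam (\<beta> * mat_trace g)) =
      of_real ((-1) ^ r * (Y * real (card (SymGL r :: 'a mat set)))) * kloosterman lam (\<beta>^2)" if \<beta>: "\<beta> \<noteq> 0"
  proof -
    let ?K = "kloosterman lam (\<beta>^2)" and ?E = "\<Sum>g\<in>?R. lam (\<beta> * mat_trace g)"
    have E: "?E = (\<Sum>g\<in>?D. lam (\<beta> * mat_trace (?rho * g)))" unfolding rhoD by (subst sum.reindex[OF inj]) simp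
    have T: "(\<Sum>w\<in>Qpar ?m e. lam (\<beta> * mat_trace (?rho * w * sigma_mat (Suc ?m) r))) =
      of_real ((real q + 1) * real Sk * (real s * real q ^ r * ((-1) ^ r * real q ^ r * real q ^ 2))) * ?K"
      unfolding sum_lam_Qpar[OF \<beta> delta_eps_carrier, of r 1 1] sum_lam_SO2_reflected matrix_kloosterman_1[OF \<beta>]
        power_minus[of "of_nat q" r] Sk_def s_def by (simp add: mult_ac)
    have "of_nat Br * ?E = of_nat (card (Qpar ?m e)) *
      (of_real ((real q + 1) * real Sk * (real s * real q ^ r * ((-1) ^ r * real q ^ r * real q ^ 2))) * ?K)"
      using double_coset_character_sum(1)[OF delta_eps_carrier delta_eps_1, of r 1 \<beta>]
      unfolding dcoset_eq[symmetric] Br_def[symmetric] T E .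
    moreover have "real (card (Qpar ?m e)) * ((real q + 1) * real Sk * (real s * real q ^ r * ((-1) ^ r * real q ^ r * real q ^ 2))) =
      c * (Z * ((-1) ^ r * real s))"
      unfolding Q of_nat_mult of_nat_power of_nat_add of_nat_1 gm c_def Z_def by (simp only: mult_ac)
    ultimately have "of_real (real Br) * ?E = of_real (c * (Z * ((-1) ^ r * real s))) * ?K"
      by (metis (no_types, lifting) mult.assoc of_real_mult of_real_of_nat_eq)
    then have "of_real c * (of_real (real q - 1) * ?E) = of_real c * (of_real (Z * ((-1) ^ r * real s)) * ?K)"
      unfolding Brc of_real_mult by (simp only: mult.assoc)
    then have "of_real (real q - 1) * ?E = of_real (Z * ((-1) ^ r * real s)) * ?K" using c by simp
    then have "?E = of_real (Z * ((-1) ^ r * real s)) * ?K / of_real (real q - 1)"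
      using q1 by (simp add: field_simps del: of_real_diff)
    then show ?thesis unfolding Y s_def by (simp add: mult_ac)
  qed
qed

text \<open>Two templates, for \<open>k = 0\<close> and \<open>k = 1\<close>, reduce every case to
  matching the constants with the counts of symmetric and invertible matrices. The parity of
  \<open>n\<close> decides whether the symmetric block has even or odd size, and with it the
  sign.\<close>

lemma code_parameters:
  assumes adm: "admissible i eta n"
  defines "D \<equiv> DC i eta n e" and "A \<equiv> Aconst i eta n (real q)" and "B \<equiv> Bconst i eta n (real q)"
  shows "finite D \<and> real (card D) = A * B \<and> A \<noteq> 0 \<and>
    (\<forall>\<beta>. \<beta> \<noteq> 0 \<longrightarrow> (\<Sum>g\<in>D. lam (\<beta> * mat_trace g)) = of_real (of_int eta * A) * kloosterman lam (\<beta>^2))"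
proof -
  let ?s = "\<lambda>n. real (card (SymGL n :: 'a mat set))" and ?g = "\<lambda>n. real (card (GL n :: 'a mat set))"
  let ?Q = "real q"
  have q1: "?Q > 1" using q_gt_1 by simp
  have s0: "?s n \<noteq> 0" for n by (metis card_SymGL_pos less_irrefl of_nat_eq_0_iff)
  have g0: "?g n \<noteq> 0" for n by (metis card_GL_pos less_irrefl of_nat_eq_0_iff)
  have qp: "?Q ^ n \<noteq> 1" if "n > 0" for n using one_less_power[OF q1 that] by simp
  \<comment> \<open>The condition on \<open>B\<close> is \<open>N = A * B\<close> with the power of
    \<open>q\<close> common to both sides removed; it is stated as a product to avoid dividing by
    the symmetric count.\<close>
  have top: ?thesis
    if D': "D = dcoset (Suc m) e m" and A': "A = ?Q ^ (m * m + 2 * m) * ?s m"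
      and B': "?Q ^ m * ?g m * (?Q + 1) = ?s m * B" and eta: "- ((-1) ^ m) = real_of_int eta" for m
  proof -
    have card: "real (card D) = ?Q ^ (m * m + 2 * m) * (?s m * B)" unfolding D' top_dcoset(1) B' ..
    have "real (card D) \<noteq> 0" unfolding D' top_dcoset(1) using q1 g0[of m] by simp
    \<comment> \<open>The cardinality of an infinite set would be zero.\<close>
    then have "finite D" by (metis card.infinite of_nat_0)
    moreover have "A \<noteq> 0" unfolding A' using q1 s0[of m] by simp
    moreover have "real (card D) = A * B" unfolding card A' by (simp only: mult.assoc)
    moreover have "(\<Sum>g\<in>D. lam (\<beta> * mat_trace g)) = of_real (of_int eta * A) * kloosterman lam (\<beta>^2)"
      if "\<beta> \<noteq> 0" for \<beta> unfolding D' top_dcoset(2)[OF that] A' eta ..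
    ultimately show ?thesis by blast
  qed
  \<comment> \<open>The analogue for \<open>k = 1\<close>, where the factor removed from
    \<open>N = A * B\<close> is the \<open>Y\<close> of \<open>subtop_rho_dcoset\<close>.\<close>
  have sub: ?thesis
    if D': "D = rho_dcoset (Suc (r + 1)) e r"
      and A': "A = (?Q + 1) * ((?Q ^ (r + 1) - 1) / (?Q - 1)) * ?Q ^ (r * r + 4 * r + 2) * ?s r"
      and B': "?g (r + 1) = ?s r * B" and eta: "(-1) ^ r = real_of_int eta" for r
  proof -
    have Y: "(?Q + 1) * ((?Q ^ (r + 1) - 1) / (?Q - 1)) * ?Q ^ (r * r + 4 * r + 2) \<noteq> 0"
      using q1 qp[of "r + 1"] by auto
    have "real (card D) \<noteq> 0" unfolding D' subtop_rho_dcoset(1) using Y g0[of "r + 1"] by simp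
    then have "finite D" by (metis card.infinite of_nat_0)
    moreover have "A \<noteq> 0" unfolding A' using Y s0[of r] by simp
    moreover have "real (card D) = A * B" unfolding D' subtop_rho_dcoset(1) B' A' by (simp only: mult.assoc)
    moreover have "(\<Sum>g\<in>D. lam (\<beta> * mat_trace g)) = of_real (of_int eta * A) * kloosterman lam (\<beta>^2)"
      if "\<beta> \<noteq> 0" for \<beta> unfolding D' subtop_rho_dcoset(2)[OF that] A' eta ..
    ultimately show ?thesis by blast
  qed
  consider (plus) "i = 1 \<or> i = 3" "eta = 1" "n \<ge> 2" "even n" | (minus1) "i = 1" "eta = -1" "odd n"
    | (minus3) "i = 3" "eta = -1" "n \<ge> 3" "odd n"
    using adm unfolding admissible_def by auto
  then show ?thesis
  proof cases
    case plus
    obtain k where "n = 2 * k" using plus(4) by blast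
    with plus(3) have n: "n = 2 * (k - 1) + 2" by simp
    define j where "j = k - 1"
    \<comment> \<open>The symmetric block has odd size \<open>n - 1 = 2 * j + 1\<close> for
      \<open>i = 1\<close> and even size \<open>n - 2 = 2 * j\<close> for \<open>i = 3\<close>; both
      give sign plus.\<close>
    have n: "n = 2 * j + 2" using n by (simp only: j_def)
    have simps: "n - 1 = 2 * j + 1" "n - 2 = 2 * j" "(n - 2) div 2 = j" "Suc (2 * j + 1) = n" using n by simp_all
    have sq: "n ^ 2 div 4 = (j + 1) * (j + 1)" "(n - 2) ^ 2 div 4 = j * j"
      unfolding simps(2) by (simp_all add: n power2_eq_square algebra_simps)
    show ?thesis
    proof (cases "i = 1")
      case True
      have "5 * n ^ 2 - 2 * n - 4 = 4 * (5 * (j * j) + 9 * j + 3)" by (simp add: n power2_eq_square algebra_simps)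
      then have ex: "(5 * n ^ 2 - 2 * n - 4) div 4 = 5 * (j * j) + 9 * j + 3" by simp
      show ?thesis
      proof (rule top[of "2 * j + 1"])
        show "D = dcoset (Suc (2 * j + 1)) e (2 * j + 1)" by (simp add: D_def DC_def n True)
        have "A = ?Q ^ (5 * (j * j) + 9 * j + 3) * (?Q ^ (2 * j + 1) - 1) * odd_prod j"
          using True plus(2) ex simps by (simp add: A_def Aconst_def)
        \<comment> \<open>The exponent of \<open>A\<close> splits into the one of
          \<open>top_dcoset\<close> at \<open>m = 2 * j + 1\<close> and the
          \<open>j * (j + 1)\<close> of the symmetric count; the other cases split alike.\<close>
        also have "5 * (j * j) + 9 * j + 3 = ((2 * j + 1) * (2 * j + 1) + 2 * (2 * j + 1)) + j * (j + 1)" by (simp add: algebra_simps)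
        also have "?Q ^ \<dots> * (?Q ^ (2 * j + 1) - 1) * odd_prod j =
          ?Q ^ ((2 * j + 1) * (2 * j + 1) + 2 * (2 * j + 1)) * (?Q ^ (j * (j + 1)) * (odd_prod j * (?Q ^ (2 * j + 1) - 1)))"
          unfolding power_add[of _ "(2 * j + 1) * (2 * j + 1) + 2 * (2 * j + 1)"] by (simp only: mult_ac)
        also have "odd_prod j * (?Q ^ (2 * j + 1) - 1) = odd_prod (j + 1)" by simp
        finally show "A = ?Q ^ ((2 * j + 1) * (2 * j + 1) + 2 * (2 * j + 1)) * ?s (2 * j + 1)"
          unfolding real_card_SymGL(2) .
        have e1: "n ^ 2 div 4 = (2 * j + 1) + j * j" using sq(1) by simp
        have B: "B = (?Q + 1) * ?Q ^ ((2 * j + 1) + j * j) * even_prod j"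
          using True plus(2) simps e1 by (simp add: B_def Bconst_def)
        show "?Q ^ (2 * j + 1) * ?g (2 * j + 1) * (?Q + 1) = ?s (2 * j + 1) * B"
          unfolding B real_card_GL(2) power_add[of _ "2 * j + 1" "j * j"] by (simp only: mult_ac)
      qed (use plus in simp)
    next
      case False
      then have i: "i = 3" using plus by simp
      have "5 * n ^ 2 - 2 * n - 8 = 4 * (5 * (j * j) + 9 * j + 2)" by (simp add: n power2_eq_square algebra_simps)
      then have ex: "(5 * n ^ 2 - 2 * n - 8) div 4 = 5 * (j * j) + 9 * j + 2" by simp
      show ?thesis
      proof (rule sub[of "2 * j"])
        show "D = rho_dcoset (Suc (2 * j + 1)) e (2 * j)" by (simp add: D_def DC_def n i)
        have "A = (?Q + 1) * ?Q ^ (5 * (j * j) + 9 * j + 2) * ((?Q ^ (2 * j + 1) - 1) / (?Q - 1)) * odd_prod j"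
          using i plus(2) ex simps by (simp add: A_def Aconst_def qbinom_def)
        also have "5 * (j * j) + 9 * j + 2 = (2 * j * (2 * j) + 4 * (2 * j) + 2) + j * (j + 1)" by (simp add: algebra_simps)
        finally show "A = (?Q + 1) * ((?Q ^ (2 * j + 1) - 1) / (?Q - 1)) * ?Q ^ (2 * j * (2 * j) + 4 * (2 * j) + 2) * ?s (2 * j)"
          unfolding real_card_SymGL(1) power_add[of _ "2 * j * (2 * j) + 4 * (2 * j) + 2" "j * (j + 1)"] by (simp only: mult_ac)
        have B: "B = ?Q ^ (j * j) * (?Q ^ (2 * j + 1) - 1) * even_prod j"
          using i plus(2) sq simps by (simp add: B_def Bconst_def)
        show "?g (2 * j + 1) = ?s (2 * j) * B"
          unfolding B real_card_GL(2) conjunct1[OF real_card_SymGL_step] by (simp only: mult_ac)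
      qed (use plus in simp)
    qed
  next
    case minus1
    obtain j where n: "n = 2 * j + 1" using minus1(3) by (rule oddE)
    have simps: "n - 1 = 2 * j" "(n - 1) div 2 = j" "Suc (2 * j) = n" using n by simp_all
    have sq: "(n - 1) ^ 2 div 4 = j * j" unfolding simps(1) by (simp add: power2_eq_square algebra_simps)
    have "5 * (n ^ 2 - 1) = 4 * (5 * (j * j) + 5 * j)" by (simp add: n power2_eq_square algebra_simps)
    then have ex: "5 * (n ^ 2 - 1) div 4 = 5 * (j * j) + 5 * j" by simp
    show ?thesis
    proof (rule top[of "2 * j"])
      show "D = dcoset (Suc (2 * j)) e (2 * j)" by (simp add: D_def DC_def n minus1)
      have "A = ?Q ^ (5 * (j * j) + 5 * j) * odd_prod j"
        using minus1(1,2) ex simps by (simp add: A_def Aconst_def)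
      also have "5 * (j * j) + 5 * j = (2 * j * (2 * j) + 2 * (2 * j)) + j * (j + 1)" by (simp add: algebra_simps)
      finally show "A = ?Q ^ (2 * j * (2 * j) + 2 * (2 * j)) * ?s (2 * j)"
        unfolding real_card_SymGL(1) power_add[of _ "2 * j * (2 * j) + 2 * (2 * j)" "j * (j + 1)"] by (simp only: mult_ac)
      have B: "B = (?Q + 1) * ?Q ^ (j * j) * even_prod j"
        using minus1(1,2) sq simps by (simp add: B_def Bconst_def)
      have "?Q ^ (2 * j) * ?g (2 * j) * (?Q + 1) = (?g (2 * j) * ?Q ^ (2 * j)) * (?Q + 1)" by (simp only: mult_ac)
      then show "?Q ^ (2 * j) * ?g (2 * j) * (?Q + 1) = ?s (2 * j) * B"
        unfolding B real_card_GL(1) by (simp only: mult_ac)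
    qed (use minus1 in simp)
  next
    case minus3
    obtain k where "n = 2 * k + 1" using minus3(4) by (rule oddE)
    with minus3(3) have n: "n = 2 * (k - 1) + 3" by simp
    define l where "l = k - 1"
    \<comment> \<open>Here \<open>r = n - 2 = 2 * l + 1\<close> is odd, while the linear group has
      even size \<open>r + 1\<close>.\<close>
    have n: "n = 2 * l + 3" using n by (simp only: l_def)
    have simps: "n - 1 = 2 * l + 2" "n - 2 = 2 * l + 1" "(n - 1) div 2 = l + 1" "Suc (2 * l + 1 + 1) = n" using n by simp_all
    have sq: "(n - 1) ^ 2 div 4 = (l + 1) * (l + 1)" unfolding simps(1) by (simp add: power2_eq_square algebra_simps)
    have "5 * n ^ 2 - 4 * n - 5 = 4 * (5 * (l * l) + 13 * l + 7)" by (simp add: n power2_eq_square algebra_simps)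
    then have ex: "(5 * n ^ 2 - 4 * n - 5) div 4 = 5 * (l * l) + 13 * l + 7" by simp
    show ?thesis
    proof (rule sub[of "2 * l + 1"])
      show "D = rho_dcoset (Suc (2 * l + 1 + 1)) e (2 * l + 1)" by (simp add: D_def DC_def n minus3 eval_nat_numeral)
      have "A = (?Q + 1) * ?Q ^ (5 * (l * l) + 13 * l + 7) * ((?Q ^ (2 * l + 2) - 1) / (?Q - 1)) * odd_prod (l + 1)"
        using minus3(1,2) unfolding A_def Aconst_def ex simps by (simp add: qbinom_def)
      also have "5 * (l * l) + 13 * l + 7 = ((2 * l + 1) * (2 * l + 1) + 4 * (2 * l + 1) + 2) + l * (l + 1)" by (simp add: algebra_simps)
      also have "2 * l + 2 = 2 * l + 1 + 1" by simp
      finally show "A = (?Q + 1) * ((?Q ^ (2 * l + 1 + 1) - 1) / (?Q - 1)) *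
          ?Q ^ ((2 * l + 1) * (2 * l + 1) + 4 * (2 * l + 1) + 2) * ?s (2 * l + 1)"
        unfolding real_card_SymGL(2) power_add[of _ "(2 * l + 1) * (2 * l + 1) + 4 * (2 * l + 1) + 2" "l * (l + 1)"]
        by (simp only: mult_ac)
      have "B = ?Q ^ ((l + 1) * (l + 1)) * even_prod (l + 1)"
        using minus3(1,2) unfolding B_def Bconst_def sq unfolding simps by simp
      \<comment> \<open>The even size is reached from the odd one by
        \<open>real_card_GL_Suc\<close>; the new factors are the last factor of
        \<open>even_prod (l + 1)\<close> and the increment from \<open>l * l\<close> to the next
        square in the exponent.\<close>
      also have "even_prod (l + 1) = even_prod l * (?Q ^ (2 * l + 2) - 1)" by simp
      also have "(l + 1) * (l + 1) = l * l + (2 * l + 1)" by simp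
      finally have B: "B = ?Q ^ (l * l + (2 * l + 1)) * (even_prod l * (?Q ^ (2 * l + 2) - 1))" .
      have "?g (2 * l + 1 + 1) = (?Q ^ (2 * l + 2) - 1) * ?Q ^ (2 * l + 1) * ?g (2 * l + 1)"
        using real_card_GL_Suc[of "2 * l + 1"] by simp
      then show "?g (2 * l + 1 + 1) = ?s (2 * l + 1) * B"
        unfolding B real_card_GL(2) power_add[of _ "l * l" "2 * l + 1"] by (simp only: mult_ac)
    qed (use minus3 in simp)
  qed
qed

end

text \<open>For \<open>t > N\<close> truncated subtraction would make the binomial coefficient one
  instead of zero, hence the case distinction. The exponent of two is negative throughout, hence
  \<open>powi\<close>.\<close>

theorem theorem1:
  fixes s n i :: nat and eta :: int and e :: "'a::{field,finite}"
  assumes "s \<ge> 1" and "card (UNIV :: 'a set) = 3 ^ s"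
    and "e \<noteq> 0" and "\<not> (\<exists>b. e = b ^ 2)"
    and "admissible i eta n"
  defines "q \<equiv> card (UNIV :: 'a set)"
    and "D \<equiv> DC i eta n e"
    and "N \<equiv> card (DC i eta n e)"
    and "A \<equiv> Aconst i eta n (real (card (UNIV :: 'a set)))"
    and "B \<equiv> Bconst i eta n (real (card (UNIV :: 'a set)))"
  shows "real N = A * B \<and>
    (\<forall>h::nat. h \<ge> 1 \<longrightarrow>
      (- of_int eta) ^ h * SK s TYPE('a) h =
        - (\<Sum>l<h. (- of_int eta) ^ l * of_nat (h choose l) * complex_of_real B ^ (h - l) * SK s TYPE('a) l)
        + of_nat q * complex_of_real A powi (- int h) *
          (\<Sum>j=0..min N h. (-1) ^ j * of_nat (weight_dist D j) *
             (\<Sum>t=j..h. of_nat (fact t * Stirling h t * 3 ^ (h - t)) *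
                (2::complex) powi (int t - int h - int j - 1) *
                of_nat (if t \<le> N then (N - j) choose (N - t) else 0))))"
proof -
  interpret nonsquare_setup "can_char s :: 'a \<Rightarrow> complex" q e
  proof
    show "(3::'a) = 0" by (rule card_three_power_imp_char[OF assms(2)])
    show "can_char s (x + y) = can_char s x * can_char s y" for x y :: 'a by (rule can_char_add[OF assms(2)])
    show "can_char s (0::'a) = 1" by (rule can_char_zero[OF assms(2)])
    show "\<exists>x::'a. can_char s x \<noteq> 1" by (rule can_char_nontrivial[OF assms(2,1)])
  qed (use assms in \<open>simp_all add: q_def\<close>)
  have par: "finite D" "real N = A * B" "A \<noteq> 0"
    "\<And>\<beta>. \<beta> \<noteq> 0 \<Longrightarrow> (\<Sum>g\<in>D. can_char s (\<beta> * mat_trace g)) = of_real (of_int eta * A) * kloosterman (can_char s) (\<beta>^2)"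
    using code_parameters[OF assms(5)] unfolding D_def N_def A_def B_def q_def by blast+
  have "(- of_int eta) ^ h * SK s TYPE('a) h =
        - (\<Sum>l<h. (- of_int eta) ^ l * of_nat (h choose l) * complex_of_real B ^ (h - l) * SK s TYPE('a) l)
        + of_nat q * complex_of_real A powi (- int h) *
          (\<Sum>j=0..min N h. (-1) ^ j * of_nat (weight_dist D j) *
             (\<Sum>t=j..h. of_nat (fact t * Stirling h t * 3 ^ (h - t)) *
                (2::complex) powi (int t - int h - int j - 1) *
                of_nat (if t \<le> N then (N - j) choose (N - t) else 0)))" if h: "h \<ge> 1" for h
    using power_moment_recursion[OF par(1) _ par(3) par(4) h, of B] par(2)
    unfolding SK_def N_def D_def of_real_of_int_eq by blast
  then show ?thesis using par(2) by blast
qed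

end
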